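(* The set of limit points (in $\mathbb R$) of $T_{\operatorname{graph}}$ is some set $S_{\operatorname{graph}}$ of Pisot numbers. Furthermore, $T_{\operatorname{graph}}\cup S_{\operatorname{graph}}$ is a closed subset of $\mathbb R$.
   Context: Graphs are finite simple graphs; the eigenvalues of a graph are those of its adjacency matrix (all real). A Pisot number is a real algebraic integer $\theta>1$ all of whose other Galois conjugates have modulus $<1$. A Salem number is a real algebraic integer $\tau>1$ whose other conjugates all have modulus $\le 1$, at least one having modulus exactly $1$. A graph $G$ is a Salem graph if either (i) $G$ is nonbipartite, has exactly one eigenvalue $\lambda>2$ and no eigenvalues in $(-\infty,-2)$; or (ii) $G$ is bipartite, has exactly one eigenvalue $\lambda>2$ and only the eigenvalue $-\lambda$ in $(-\infty,-2)$. A Salem graph is trivial if it is nonbipartite and $\lambda\in\mathbb Z$, or bipartite and $\lambda^2\in\mathbb Z$. For a nontrivial Salem graph $G$, $\tau(G)$ is the larger root of $z+1/z=\lambda$ in the nonbipartite case and of $\sqrt z+1/\sqrt z=\lambda$ in the bipartite case (it is a Salem number). $T_{\operatorname{graph}}$ denotes the set of all $\tau(G)$ for $G$ a nontrivial Salem graph. *)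

theory Defs
  imports "HOL-Analysis.Analysis" "Jordan_Normal_Form.Char_Poly"
begin

definition simple_graph :: "nat \<Rightarrow> (nat \<Rightarrow> nat \<Rightarrow> bool) \<Rightarrow> bool" where
  "simple_graph n E \<longleftrightarrow> (\<forall>i<n. \<not> E i i) \<and> (\<forall>i<n. \<forall>j<n. E i j \<longleftrightarrow> E j i)"

definition adj_matrix :: "nat \<Rightarrow> (nat \<Rightarrow> nat \<Rightarrow> bool) \<Rightarrow> real mat" where
  "adj_matrix n E = mat n n (\<lambda>(i, j). if E i j then 1 else 0)"

definition graph_char_poly :: "nat \<Rightarrow> (nat \<Rightarrow> nat \<Rightarrow> bool) \<Rightarrow> real poly" where
  "graph_char_poly n E = char_poly (adj_matrix n E)"

definition eigenvalues :: "nat \<Rightarrow> (nat \<Rightarrow> nat \<Rightarrow> bool) \<Rightarrow> real set" where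
  "eigenvalues n E = {x. poly (graph_char_poly n E) x = 0}"

definition eig_mult :: "nat \<Rightarrow> (nat \<Rightarrow> nat \<Rightarrow> bool) \<Rightarrow> real \<Rightarrow> nat" where
  "eig_mult n E x = order x (graph_char_poly n E)"

definition bipartite :: "nat \<Rightarrow> (nat \<Rightarrow> nat \<Rightarrow> bool) \<Rightarrow> bool" where
  "bipartite n E \<longleftrightarrow> (\<exists>c :: nat \<Rightarrow> bool. \<forall>i<n. \<forall>j<n. E i j \<longrightarrow> c i \<noteq> c j)"

definition unique_big_eig :: "nat \<Rightarrow> (nat \<Rightarrow> nat \<Rightarrow> bool) \<Rightarrow> real \<Rightarrow> bool" where
  "unique_big_eig n E lam \<longleftrightarrow>
     lam > 2 \<and> {x \<in> eigenvalues n E. x > 2} = {lam} \<and> eig_mult n E lam = 1"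

definition salem_graph :: "nat \<Rightarrow> (nat \<Rightarrow> nat \<Rightarrow> bool) \<Rightarrow> bool" where
  "salem_graph n E \<longleftrightarrow> simple_graph n E \<and>
     (\<exists>lam. unique_big_eig n E lam \<and>
        (if bipartite n E then {x \<in> eigenvalues n E. x < -2} = {-lam}
         else {x \<in> eigenvalues n E. x < -2} = {}))"

definition salem_lambda :: "nat \<Rightarrow> (nat \<Rightarrow> nat \<Rightarrow> bool) \<Rightarrow> real" where
  "salem_lambda n E = (THE lam. unique_big_eig n E lam)"

definition trivial_salem_graph :: "nat \<Rightarrow> (nat \<Rightarrow> nat \<Rightarrow> bool) \<Rightarrow> bool" where
  "trivial_salem_graph n E \<longleftrightarrow> salem_graph n E \<and>
     ((\<not> bipartite n E \<and> salem_lambda n E \<in> \<int>) \<or>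
      (bipartite n E \<and> (salem_lambda n E)^2 \<in> \<int>))"

definition salem_tau :: "nat \<Rightarrow> (nat \<Rightarrow> nat \<Rightarrow> bool) \<Rightarrow> real" where
  "salem_tau n E =
     (if bipartite n E
      then (GREATEST z. z > 0 \<and> sqrt z + 1 / sqrt z = salem_lambda n E)
      else (GREATEST z. z \<noteq> 0 \<and> z + 1 / z = salem_lambda n E))"

definition T_graph :: "real set" where
  "T_graph = {salem_tau n E | n E. salem_graph n E \<and> \<not> trivial_salem_graph n E}"

definition pisot :: "real \<Rightarrow> bool" where
  "pisot \<theta> \<longleftrightarrow> \<theta> > 1 \<and>
     (\<exists>p :: int poly. lead_coeff p = 1 \<and> irreducible p \<and>
        poly (map_poly of_int p) \<theta> = 0 \<and>
        (\<forall>z :: complex. poly (map_poly of_int p) z = 0 \<and> z \<noteq> complex_of_real \<theta> \<longrightarrow> cmod z < 1))"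

end

theory Submission
  imports Defs
begin

text \<open>
  Closedness is automatic, so the point is that every limit point is a Pisot number. Let
  \<open>G\<^sub>k\<close> be Salem graphs whose distinct indices \<open>\<lambda>\<^sub>k\<close> converge. Since the quadratic form
  \<open>\<langle>f, A f\<rangle> - 2 \<langle>f, f\<rangle>\<close> of \<open>G\<^sub>k\<close> is not positive on any plane, and degrees are bounded,
  \<open>G\<^sub>k\<close> has a vertex set \<open>K\<close> of bounded size on which the form takes a positive value, and the
  form is nonpositive on functions supported away from \<open>K\<close>. Test functions of affine Dynkin type
  then show that far from \<open>K\<close> a vertex of degree at least 3 carries a leaf wherever the distance
  from \<open>K\<close> increases. Hence, after passing to a subsequence, all \<open>G\<^sub>k\<close> consist of one fixed core
  \<open>(A, B)\<close>, with a path of length tending to infinity leaving the core at each vertex of \<open>B\<close>, and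
  of a remote part.

  In the limit the paths become infinite rays and contribute \<open>z\<close> to the diagonal at \<open>B\<close>: with
  \<open>\<lambda> = z + 1 / z\<close>, the relevant determinant is that of \<open>(1 + z\<^sup>2) I - z A - z\<^sup>2 1\<^sub>B\<close>, an integer
  polynomial \<open>Q\<close> with \<open>Q(0) = 1\<close>. Eigenvectors for \<open>\<lambda>\<^sub>k\<close> give \<open>Q(1 / \<phi>) = 0\<close> for
  \<open>\<phi> + 1 / \<phi> = lim \<lambda>\<^sub>k\<close>. Conversely a root of \<open>Q\<close> in the open unit disc is real and yields
  approximate eigenvectors of \<open>G\<^sub>k\<close>, so it is \<open>1 / \<phi>\<close> or, in the bipartite case, \<open>- 1 / \<phi>\<close>.
  A conjugate of \<open>\<phi>\<close> on the unit circle would force, by conjugation, an eigenvector of the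
  core for \<open>\<phi> + 1 / \<phi>\<close> vanishing on \<open>B\<close>; extended by zero it is an eigenvector of every
  \<open>G\<^sub>k\<close>, contradicting that the \<open>\<lambda>\<^sub>k\<close> differ from their limit. So \<open>\<phi>\<close>, or \<open>\<phi>\<^sup>2\<close> in the
  bipartite case, is a Pisot number.
\<close>

section \<open>Diagonalization of real symmetric matrices\<close>

text \<open>The remote part of a graph is arbitrary, so no estimate may depend on it. Eigenvectors
  are controlled at the feet of the rays by their boundedness at the far ends, and trial vectors are
  cut off before the rays end; either way the error is geometrically small in the ray length. This
  decay is lost on the unit circle. Conjugates there need an algebraic argument, and the condition
  that a core eigenvector vanishes on \<open>B\<close> is therefore put into a second integer
  polynomial, \<open>trap_poly\<close>, so that it passes between conjugates. The core must stay
  bounded along the sequence, although rays may end at any distance from \<open>K\<close>. The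
  number of vertices at distance \<open>d\<close> that continue outward for two steps does not
  increase with \<open>d\<close> and is bounded at \<open>d = 8\<close>. Hence long windows without
  loss exist, and a counting argument places them at one common radius for infinitely many graphs.
  The core contains \<open>K\<close>, so the form takes a positive value on it. This depends on the
  core alone and keeps all indices uniformly above 2, which excludes the limit index 2.\<close>

lemma real_symmetric_eigenvalue:
  fixes A :: "real mat"
  assumes A: "A \<in> carrier_mat n n" and sym: "A\<^sup>T = A" and n: "n > 0"
  shows "\<exists>r. eigenvalue A r"
proof -
  let ?h = "of_real :: real \<Rightarrow> complex"
  let ?A = "map_mat ?h A"
  have cA: "?A \<in> carrier_mat n n" using A by simp
  have "degree (char_poly ?A) = n" using degree_monic_char_poly[OF cA] by simp
  then have "\<not> constant (poly (char_poly ?A))" using n by (simp add: constant_degree)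
  then obtain z where z: "poly (char_poly ?A) z = 0" using fundamental_theorem_of_algebra by blast
  then have "eigenvalue ?A z" using eigenvalue_root_char_poly[OF cA] by simp
  then obtain x where x: "x \<in> carrier_vec n" "x \<noteq> 0\<^sub>v n" "?A *\<^sub>v x = z \<cdot>\<^sub>v x"
    unfolding eigenvalue_def eigenvector_def using A by auto
  define s where "s = (\<Sum>i<n. \<Sum>j<n. cnj (x $ i) * (?h (A $$ (i,j)) * x $ j))"
  define t where "t = (\<Sum>i<n. (cmod (x $ i))\<^sup>2)"
  have e: "(\<Sum>j<n. ?h (A $$ (i,j)) * x $ j) = z * x $ i" if i: "i < n" for i
  proof -
    have "(?A *\<^sub>v x) $ i = (\<Sum>j<n. ?h (A $$ (i,j)) * x $ j)"
      using i A x(1) by (simp add: scalar_prod_def atLeast0LessThan)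
    then show ?thesis using x i by simp
  qed
  have "s = (\<Sum>i<n. cnj (x $ i) * (z * x $ i))"
    unfolding s_def by (intro sum.cong refl) (simp add: sum_distrib_left[symmetric] e)
  also have "\<dots> = z * of_real t"
    unfolding t_def of_real_sum sum_distrib_left
    by (intro sum.cong refl) (metis complex_norm_square mult.commute mult.left_commute of_real_power)
  finally have s1: "s = z * of_real t" .
  have Aij: "A $$ (i,j) = A $$ (j,i)" if "i < n" "j < n" for i j
    using A sym that by (metis carrier_matD index_transpose_mat(1))
  have "cnj s = (\<Sum>i<n. \<Sum>j<n. x $ i * (?h (A $$ (i,j)) * cnj (x $ j)))"
    unfolding s_def by simp
  also have "\<dots> = (\<Sum>j<n. \<Sum>i<n. x $ i * (?h (A $$ (i,j)) * cnj (x $ j)))"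
    by (rule sum.swap)
  also have "\<dots> = s" unfolding s_def
    by (intro sum.cong refl) (auto simp: Aij)
  finally have s2: "cnj s = s" .
  have "\<exists>i<n. x $ i \<noteq> 0" using x(1,2) by (auto simp: vec_eq_iff)
  then obtain i where i: "i < n" "x $ i \<noteq> 0" by auto
  have "(cmod (x $ i))\<^sup>2 \<le> t" unfolding t_def using i by (intro member_le_sum) auto
  moreover have "(cmod (x $ i))\<^sup>2 > 0" using i by simp
  ultimately have "t > 0" by linarith
  then have "cnj z = z" using s1 s2 by auto
  then have "z \<in> \<real>" by (simp add: complex_is_Real_iff complex_eq_iff)
  then obtain r where r: "z = ?h r" by (auto simp: Reals_def)
  have "char_poly ?A = map_poly ?h (char_poly A)" using of_real_hom.char_poly_hom[OF A] by simp
  with z r have "poly (char_poly A) r = 0" by simp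
  then show ?thesis using eigenvalue_root_char_poly[OF A] by blast
qed

text \<open>The reflection in the hyperplane orthogonal to \<open>w\<close>. For
  \<open>w = 0\<close> the convention \<open>2 / 0 = 0\<close> makes it the identity, which is
  wanted when the eigenvector is already \<open>e0\<close>.\<close>

definition householder :: "nat \<Rightarrow> real vec \<Rightarrow> real mat" where
  "householder n w = mat n n (\<lambda>(i,j). (if i = j then 1 else 0) - 2 / (w \<bullet> w) * (w $ i * w $ j))"

lemma householder_carrier [simp]: "householder n w \<in> carrier_mat n n"
  by (simp add: householder_def)

lemma householder_sym: "(householder n w)\<^sup>T = householder n w"
  by (rule eq_matI) (auto simp: householder_def)

lemma householder_mult_vec:
  assumes "w \<in> carrier_vec n" "x \<in> carrier_vec n"
  shows "householder n w *\<^sub>v x = x - (2 / (w \<bullet> w) * (w \<bullet> x)) \<cdot>\<^sub>v w"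
proof (rule eq_vecI)
  fix i assume "i < dim_vec (x - (2 / (w \<bullet> w) * (w \<bullet> x)) \<cdot>\<^sub>v w)"
  then have i: "i < n" using assms by auto
  define c where "c = 2 / (w \<bullet> w)"
  have wx: "w \<bullet> x = (\<Sum>j<n. w $ j * x $ j)" using assms by (simp add: scalar_prod_def atLeast0LessThan)
  have "(householder n w *\<^sub>v x) $ i = (\<Sum>j<n. ((if i = j then 1 else 0) - c * (w $ i * w $ j)) * x $ j)"
    using assms i by (simp add: householder_def c_def scalar_prod_def[of _ x] atLeast0LessThan)
  also have "\<dots> = (\<Sum>j<n. (if i = j then x $ j else 0)) - (\<Sum>j<n. c * w $ i * (w $ j * x $ j))"
    unfolding sum_subtractf[symmetric] by (intro sum.cong) (auto simp: algebra_simps)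
  also have "\<dots> = x $ i - c * w $ i * (w \<bullet> x)"
    using i by (simp add: sum_distrib_left[symmetric] wx)
  finally show "(householder n w *\<^sub>v x) $ i = (x - (2 / (w \<bullet> w) * (w \<bullet> x)) \<cdot>\<^sub>v w) $ i"
    using i assms by (simp add: algebra_simps c_def[symmetric])
qed (use assms in \<open>auto simp: householder_def\<close>)

lemma householder_involution:
  assumes w: "w \<in> carrier_vec n"
  shows "householder n w * householder n w = 1\<^sub>m n"
proof (rule eq_matI)
  fix i j assume "i < dim_row (1\<^sub>m n)" "j < dim_col (1\<^sub>m n)"
  then have ij: "i < n" "j < n" by auto
  define c where "c = 2 / (w \<bullet> w)"
  have ww: "w \<bullet> w = (\<Sum>k<n. w $ k * w $ k)" using w by (simp add: scalar_prod_def atLeast0LessThan)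
  have c: "c * c * (w \<bullet> w) = 2 * c" by (simp add: c_def)
  have "(householder n w * householder n w) $$ (i,j)
     = (\<Sum>k<n. ((if i = k then 1 else 0) - c * (w $ i * w $ k)) * ((if k = j then 1 else 0) - c * (w $ k * w $ j)))"
    using ij by (simp add: householder_def scalar_prod_def atLeast0LessThan c_def)
  also have "\<dots> = (\<Sum>k<n. (if k = i then (if i = j then 1 else 0) - c * (w $ i * w $ j) else 0)
       + (if k = j then - c * (w $ i * w $ j) else 0) + c * c * (w $ i * w $ j) * (w $ k * w $ k))"
    by (intro sum.cong refl) (auto simp: algebra_simps)
  also have "\<dots> = (if i = j then 1 else 0) - 2 * c * (w $ i * w $ j) + c * c * (w $ i * w $ j) * (w \<bullet> w)"
    using ij by (simp add: sum.distrib sum_distrib_left[symmetric] ww)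
  also have "\<dots> = (if i = j then 1 else 0)" using c by (auto simp: algebra_simps)
  finally show "(householder n w * householder n w) $$ (i,j) = 1\<^sub>m n $$ (i,j)" using ij by simp
qed (auto simp: householder_def)

theorem real_symmetric_diagonalization:
  fixes A :: "real mat"
  assumes "A \<in> carrier_mat n n" "A\<^sup>T = A"
  shows "\<exists>U. U \<in> carrier_mat n n \<and> U\<^sup>T * U = 1\<^sub>m n \<and> diagonal_mat (U\<^sup>T * A * U)"
  using assms
proof (induction n arbitrary: A)
  case 0
  then show ?case by (intro exI[of _ "1\<^sub>m 0"]) (auto simp: diagonal_mat_def)
next
  case (Suc m)
  let ?n = "Suc m"
  note A = Suc.prems(1) and sym = Suc.prems(2)
  obtain r where "eigenvalue A r" using real_symmetric_eigenvalue[OF A sym] by auto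
  then obtain x where x: "x \<in> carrier_vec ?n" "x \<noteq> 0\<^sub>v ?n" "A *\<^sub>v x = r \<cdot>\<^sub>v x"
    unfolding eigenvalue_def eigenvector_def using A by auto
  have xx: "x \<bullet> x > 0" using x conjugate_square_greater_0_vec[OF x(1)] by simp
  define v where "v = (1 / sqrt (x \<bullet> x)) \<cdot>\<^sub>v x"
  have v: "v \<in> carrier_vec ?n" using x by (simp add: v_def)
  have Av: "A *\<^sub>v v = r \<cdot>\<^sub>v v"
    unfolding v_def using x A by (simp add: mult_mat_vec[of _ ?n ?n] smult_smult_assoc mult.commute)
  have vv: "v \<bullet> v = 1" unfolding v_def using x xx by (simp add: field_simps)
  define e0 where "e0 = (unit_vec ?n 0 :: real vec)"
  have e0: "e0 \<in> carrier_vec ?n" by (simp add: e0_def)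
  \<comment> \<open>The reflection along the difference of two unit vectors exchanges them.
    Conjugation by it turns the eigenvector \<open>v\<close> into \<open>e0\<close>, so that the
    first row and column split off.\<close>
  define w where "w = v - e0"
  have w: "w \<in> carrier_vec ?n" using v e0 by (simp add: w_def)
  have we: "w \<bullet> e0 = v $ 0 - 1" unfolding w_def using v e0
    by (simp add: minus_scalar_prod_distrib[of _ ?n]) (simp add: e0_def)
  have wv: "w \<bullet> v = 1 - v $ 0" unfolding w_def using v e0
    by (simp add: minus_scalar_prod_distrib[of _ ?n] vv) (simp add: e0_def)
  have ww: "w \<bullet> w = 2 * (1 - v $ 0)"
    using we wv v e0 w by (subst (2) w_def) (simp add: scalar_prod_minus_distrib[of _ ?n])
  define H where "H = householder ?n w"
  have H: "H \<in> carrier_mat ?n ?n" and Hs: "H\<^sup>T = H" and HH: "H * H = 1\<^sub>m ?n"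
    using householder_sym householder_involution[OF w] by (auto simp: H_def)
  have He: "H *\<^sub>v e0 = v"
  proof (cases "w \<bullet> w = 0")
    case True
    then have "w = 0\<^sub>v ?n" using conjugate_square_eq_0_vec[OF w] by simp
    then have "(v - e0) $ i = 0" if "i < ?n" for i using that unfolding w_def by simp
    then have ve: "v = e0" using v e0 by (intro eq_vecI) auto
    show ?thesis unfolding H_def householder_mult_vec[OF w e0] using True ve e0 w by (auto intro!: eq_vecI)
  next
    case False
    then have "2 / (w \<bullet> w) * (w \<bullet> e0) = -1" using ww we by (simp add: field_simps)
    then show ?thesis unfolding H_def householder_mult_vec[OF w e0] using v e0 w
      by (auto intro!: eq_vecI simp: w_def)
  qed
  have Hv: "H *\<^sub>v v = e0"
    using He HH H e0 by (metis assoc_mult_mat_vec one_mult_mat_vec)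
  define A' where "A' = H * A * H"
  have A': "A' \<in> carrier_mat ?n ?n" using H A by (simp add: A'_def)
  have A's: "A'\<^sup>T = A'" unfolding A'_def using H A Hs sym
    by (simp add: transpose_mult[of _ ?n ?n _ ?n] assoc_mult_mat[of _ ?n ?n _ ?n _ ?n])
  have "A' *\<^sub>v e0 = H *\<^sub>v (A *\<^sub>v (H *\<^sub>v e0))" unfolding A'_def using H A e0
    by (simp add: assoc_mult_mat_vec[of _ ?n ?n _ ?n])
  also have "\<dots> = r \<cdot>\<^sub>v e0" using He Av Hv H v by (simp add: mult_mat_vec[of _ ?n ?n])
  finally have A'e: "A' *\<^sub>v e0 = r \<cdot>\<^sub>v e0" .
  have col: "A' $$ (i,0) = (if i = 0 then r else 0)" if "i < ?n" for i
  proof -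
    have "(A' *\<^sub>v e0) $ i = A' $$ (i,0)" using A' that by (simp add: e0_def)
    then show ?thesis using A'e that by (auto simp: e0_def split: if_splits)
  qed
  have row: "A' $$ (0,i) = (if i = 0 then r else 0)" if "i < ?n" for i
    using col[OF that] A's A' that by (metis carrier_matD index_transpose_mat(1) zero_less_Suc)
  define B where "B = mat m m (\<lambda>(i,j). A' $$ (Suc i, Suc j))"
  have B: "B \<in> carrier_mat m m" by (simp add: B_def)
  have Bs: "B\<^sup>T = B" unfolding B_def using A's A'
    by (intro eq_matI) (auto, metis A' A's Suc_less_eq carrier_matD(1,2) index_transpose_mat(1))
  obtain U' where U': "U' \<in> carrier_mat m m" "U'\<^sup>T * U' = 1\<^sub>m m" "diagonal_mat (U'\<^sup>T * B * U')"
    using Suc.IH[OF B Bs] by auto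
  define R where "R = mat 1 1 (\<lambda>_. r)"
  have blk: "A' = four_block_mat R (0\<^sub>m 1 m) (0\<^sub>m m 1) B"
    using A' by (intro eq_matI) (auto simp: R_def B_def col row)
  define F where "F = four_block_mat (1\<^sub>m 1) (0\<^sub>m 1 m) (0\<^sub>m m 1) U'"
  have F: "F \<in> carrier_mat ?n ?n" using U' by (auto simp: F_def)
  have Ft: "F\<^sup>T = four_block_mat (1\<^sub>m 1) (0\<^sub>m 1 m) (0\<^sub>m m 1) (U'\<^sup>T)"
    unfolding F_def using U' by (subst transpose_four_block_mat) auto
  have Ut: "U'\<^sup>T \<in> carrier_mat m m" using U' by auto
  have R: "R \<in> carrier_mat 1 1" by (simp add: R_def)
  have "F\<^sup>T * F = four_block_mat (1\<^sub>m 1) (0\<^sub>m 1 m) (0\<^sub>m m 1) (1\<^sub>m m)"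
    unfolding Ft unfolding F_def using U' Ut
    by (subst mult_four_block_mat[of _ 1 1 _ m _ m _ _ 1 _ m]) auto
  also have "\<dots> = 1\<^sub>m ?n" by (rule eq_matI) auto
  finally have FF: "F\<^sup>T * F = 1\<^sub>m ?n" .
  have "F\<^sup>T * A' * F = four_block_mat R (0\<^sub>m 1 m) (0\<^sub>m m 1) (U'\<^sup>T * B * U')"
    unfolding Ft blk unfolding F_def using U' Ut R B
    apply (subst mult_four_block_mat[of _ 1 1 _ m _ m _ _ 1 _ m]; (simp; fail)?)
    apply (subst mult_four_block_mat[of _ 1 1 _ m _ m _ _ 1 _ m]; (simp; fail)?)
    done
  then have FD: "diagonal_mat (F\<^sup>T * A' * F)" using U'(1,3) Ut R B
    by (auto simp: diagonal_mat_def)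
  define U where "U = H * F"
  have U: "U \<in> carrier_mat ?n ?n" using H F by (simp add: U_def)
  have Utt: "U\<^sup>T = F\<^sup>T * H" unfolding U_def using H F Hs by (simp add: transpose_mult[of _ ?n ?n _ ?n])
  have Ftc: "F\<^sup>T \<in> carrier_mat ?n ?n" using F by simp
  have "U\<^sup>T * U = F\<^sup>T * (H * H) * F" unfolding Utt unfolding U_def using Ftc H F
    by (simp add: assoc_mult_mat[of _ ?n ?n _ ?n _ ?n])
  then have 1: "U\<^sup>T * U = 1\<^sub>m ?n" using HH FF Ftc by simp
  have "U\<^sup>T * A * U = F\<^sup>T * A' * F" unfolding Utt unfolding U_def A'_def using Ftc H F A
    by (simp add: assoc_mult_mat[of _ ?n ?n _ ?n _ ?n])
  then show ?case using U 1 FD by auto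
qed

section \<open>Quadratic forms of graphs\<close>

text \<open>The vertices form an arbitrary finite set, not an initial segment, so that induced
  subgraphs are again instances; the search for a minimal hot set relies on this.\<close>

locale fgraph =
  fixes V :: "nat set" and N :: "nat \<Rightarrow> nat set"
  assumes finV [simp]: "finite V"
    and N_sub: "v \<in> V \<Longrightarrow> N v \<subseteq> V"
    and N_sym: "u \<in> V \<Longrightarrow> v \<in> V \<Longrightarrow> u \<in> N v \<Longrightarrow> v \<in> N u"
    and N_irr: "v \<in> V \<Longrightarrow> v \<notin> N v"
begin

definition ip :: "(nat \<Rightarrow> real) \<Rightarrow> (nat \<Rightarrow> real) \<Rightarrow> real" where
  "ip f g = (\<Sum>v\<in>V. f v * g v)"

definition adj :: "(nat \<Rightarrow> real) \<Rightarrow> nat \<Rightarrow> real" where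
  "adj f v = (\<Sum>u\<in>N v. f u)"

definition qf :: "(nat \<Rightarrow> real) \<Rightarrow> real" where
  "qf f = ip f (adj f) - 2 * ip f f"

text \<open>The subgraph induced by \<open>S\<close> has an eigenvalue greater than 2.\<close>
definition hot :: "nat set \<Rightarrow> bool" where
  "hot S \<longleftrightarrow> (\<exists>f. (\<forall>v. v \<notin> S \<longrightarrow> f v = 0) \<and> qf f > 0)"

lemma finN [simp]: "v \<in> V \<Longrightarrow> finite (N v)"
  using N_sub finite_subset finV by metis

lemma adj_V: "v \<in> V \<Longrightarrow> adj f v = (\<Sum>u\<in>V. if u \<in> N v then f u else 0)"
  unfolding adj_def using N_sub by (simp add: sum.inter_restrict[symmetric] Int_absorb1)

lemma ip_commute: "ip f g = ip g f"
  by (simp add: ip_def mult.commute)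

lemma adj_sym: "ip (adj f) g = ip f (adj g)"
proof -
  have "ip (adj f) g = (\<Sum>v\<in>V. \<Sum>u\<in>V. if u \<in> N v then f u * g v else 0)"
    unfolding ip_def by (intro sum.cong refl) (auto simp: adj_V sum_distrib_right intro!: sum.cong)
  also have "\<dots> = (\<Sum>u\<in>V. \<Sum>v\<in>V. if v \<in> N u then f u * g v else 0)"
    by (subst sum.swap) (auto intro!: sum.cong dest: N_sym)
  also have "\<dots> = ip f (adj g)"
    unfolding ip_def by (intro sum.cong refl) (auto simp: adj_V sum_distrib_left intro!: sum.cong)
  finally show ?thesis .
qed

lemma hot_mono: "hot S \<Longrightarrow> S \<subseteq> T \<Longrightarrow> hot T"
  unfolding hot_def by blast

lemma ip_add_left: "ip (\<lambda>v. f v + g v) h = ip f h + ip g h"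
  by (simp add: ip_def sum.distrib algebra_simps)
lemma ip_add_right: "ip h (\<lambda>v. f v + g v) = ip h f + ip h g"
  by (simp add: ip_def sum.distrib algebra_simps)
lemma ip_scale_left: "ip (\<lambda>v. c * f v) h = c * ip f h"
  by (simp add: ip_def sum_distrib_left mult.assoc)
lemma ip_scale_right: "ip h (\<lambda>v. c * f v) = c * ip h f"
  by (simp add: ip_def sum_distrib_left mult.left_commute)
lemma adj_add: "adj (\<lambda>v. f v + g v) = (\<lambda>v. adj f v + adj g v)"
  by (rule ext) (simp add: adj_def sum.distrib)
lemma adj_scale: "adj (\<lambda>v. c * f v) = (\<lambda>v. c * adj f v)"
  by (rule ext) (simp add: adj_def sum_distrib_left)

lemma qf_lincomb:
  "qf (\<lambda>v. a * f v + b * g v) = a\<^sup>2 * qf f + b\<^sup>2 * qf g + 2 * a * b * (ip f (adj g) - 2 * ip f g)"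
proof -
  have "ip g (adj f) = ip f (adj g)" by (metis adj_sym ip_commute)
  then show ?thesis unfolding qf_def
    by (simp add: adj_add adj_scale ip_add_left ip_add_right ip_scale_left ip_scale_right
      power2_eq_square ip_commute[of g f]) (simp add: algebra_simps)
qed

lemma ip_nonneg: "ip f f \<ge> 0"
  by (simp add: ip_def sum_nonneg)

end

text \<open>Indexing an orthonormal eigenbasis by \<open>k < n\<close> records multiplicities: by
  \<open>small\<close>, the eigenvalue \<open>lam\<close> is simple and the only one above 2.
  Conditions on negative eigenvalues are stated separately later.\<close>

locale spec_graph = fgraph "{..<n}" N for n N +
  fixes e :: "nat \<Rightarrow> nat \<Rightarrow> real" and \<mu> :: "nat \<Rightarrow> real" and k0 :: nat and lam :: real
  assumes complete: "i < n \<Longrightarrow> j < n \<Longrightarrow> (\<Sum>k<n. e k i * e k j) = (if i = j then 1 else 0)"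
    and orth: "k < n \<Longrightarrow> l < n \<Longrightarrow> (\<Sum>i<n. e k i * e l i) = (if k = l then 1 else 0)"
    and eig: "k < n \<Longrightarrow> i < n \<Longrightarrow> adj (e k) i = \<mu> k * e k i"
    and k0: "k0 < n" "\<mu> k0 = lam" "lam > 2"
    and small: "k < n \<Longrightarrow> k \<noteq> k0 \<Longrightarrow> \<mu> k \<le> 2"
begin

definition co :: "(nat \<Rightarrow> real) \<Rightarrow> nat \<Rightarrow> real" where
  "co f k = (\<Sum>i<n. f i * e k i)"

lemma co_ip: "co f k = ip f (e k)"
  by (simp add: co_def ip_def)

lemma parseval: "ip f g = (\<Sum>k<n. co f k * co g k)"
proof -
  have "(\<Sum>k<n. co f k * co g k) = (\<Sum>k<n. \<Sum>i<n. \<Sum>j<n. f i * g j * (e k i * e k j))"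
    unfolding co_def sum_product by (intro sum.cong refl) (simp add: algebra_simps)
  also have "\<dots> = (\<Sum>i<n. \<Sum>k<n. \<Sum>j<n. f i * g j * (e k i * e k j))" by (rule sum.swap)
  also have "\<dots> = (\<Sum>i<n. \<Sum>j<n. \<Sum>k<n. f i * g j * (e k i * e k j))"
    by (intro sum.cong refl sum.swap)
  also have "\<dots> = (\<Sum>i<n. \<Sum>j<n. if i = j then f i * g j else 0)"
    by (intro sum.cong refl) (simp add: sum_distrib_left[symmetric] complete)
  also have "\<dots> = ip f g" by (simp add: ip_def)
  finally show ?thesis by simp
qed

lemma co_adj: "k < n \<Longrightarrow> co (adj f) k = \<mu> k * co f k"
  unfolding co_ip adj_sym
  by (simp add: ip_def eig sum_distrib_left algebra_simps)

lemma mu_le: "k < n \<Longrightarrow> \<mu> k \<le> lam"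
  using small[of k] k0 by (cases "k = k0") auto

lemma rayleigh: "ip f (adj f) \<le> lam * ip f f"
proof -
  have "\<mu> k * (co f k * co f k) \<le> lam * (co f k * co f k)" if "k < n" for k
    using mu_le[OF that] by (intro mult_right_mono) auto
  then have "(\<Sum>k<n. \<mu> k * (co f k * co f k)) \<le> (\<Sum>k<n. lam * (co f k * co f k))"
    by (intro sum_mono) auto
  moreover have "ip f (adj f) = (\<Sum>k<n. \<mu> k * (co f k * co f k))"
    unfolding parseval by (intro sum.cong refl) (simp add: co_adj)
  ultimately show ?thesis by (simp add: parseval sum_distrib_left)
qed

lemma qf_orth_top:
  assumes "co f k0 = 0"
  shows "qf f \<le> 0"
proof -
  have "(\<mu> k - 2) * (co f k * co f k) \<le> 0" if "k < n" for k
    using assms small[OF that] by (cases "k = k0") (auto intro: mult_nonpos_nonneg)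
  then have "(\<Sum>k<n. (\<mu> k - 2) * (co f k * co f k)) \<le> 0"
    by (intro sum_nonpos) auto
  moreover have "ip f (adj f) = (\<Sum>k<n. \<mu> k * (co f k * co f k))"
    unfolding parseval by (intro sum.cong refl) (simp add: co_adj)
  ultimately show ?thesis unfolding qf_def
    by (simp add: parseval sum_distrib_left sum_subtractf algebra_simps)
qed

text \<open>In eigencoordinates, subtracting \<open>x * g v\<close> from \<open>adj g v\<close>
  multiplies the \<open>k\<close>-th coordinate by \<open>\<mu> k - x\<close>. Used
  contrapositively: a vector that almost satisfies the eigenvalue equation for \<open>x\<close>
  forces an eigenvalue near \<open>x\<close>.\<close>

lemma quasimode:
  assumes "\<delta> \<ge> 0" "\<And>k. k < n \<Longrightarrow> \<delta> \<le> \<bar>\<mu> k - x\<bar>"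
  shows "\<delta>\<^sup>2 * ip g g \<le> (\<Sum>v<n. (adj g v - x * g v)\<^sup>2)"
proof -
  let ?h = "\<lambda>v. adj g v + (- x) * g v"
  have c: "co ?h k = (\<mu> k - x) * co g k" if "k < n" for k
    using co_adj[OF that, of g] unfolding co_ip ip_add_left ip_scale_left by (simp add: algebra_simps)
  have ipc: "ip ?h ?h = (\<Sum>k<n. (\<mu> k - x)\<^sup>2 * (co g k)\<^sup>2)"
    unfolding parseval
  proof (intro sum.cong refl)
    fix k assume "k \<in> {..<n}"
    then have "co ?h k = (\<mu> k - x) * co g k" using c by simp
    then show "co ?h k * co ?h k = (\<mu> k - x)\<^sup>2 * (co g k)\<^sup>2"
      by (simp only: power2_eq_square) (simp only: mult.assoc mult.left_commute)
  qed
  have "(\<Sum>k<n. \<delta>\<^sup>2 * (co g k)\<^sup>2) \<le> (\<Sum>k<n. (\<mu> k - x)\<^sup>2 * (co g k)\<^sup>2)"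
    using assms by (intro sum_mono mult_right_mono) (auto simp: abs_le_square_iff[symmetric])
  moreover note ipc
  moreover have "ip ?h ?h = (\<Sum>v<n. (adj g v - x * g v)\<^sup>2)"
    by (simp add: ip_def power2_eq_square)
  ultimately show ?thesis
    by (simp add: parseval sum_distrib_left power2_eq_square[of "co g _"])
qed

text \<open>Two test vectors with disjoint supports and no edges between them span a plane on which
  the form is positive definite. A plane always meets the hyperplane orthogonal to the top
  eigenvector, where the form is nonpositive.\<close>

lemma two_hot:
  assumes S: "hot S" and T: "hot T" and ST: "S \<inter> T = {}"
    and na: "\<And>s t. s \<in> S \<Longrightarrow> t \<in> T \<Longrightarrow> s < n \<Longrightarrow> t < n \<Longrightarrow> t \<notin> N s"
  shows False
proof -
  obtain f where f: "\<And>v. v \<notin> S \<Longrightarrow> f v = 0" "qf f > 0" using S unfolding hot_def by auto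
  obtain g where g: "\<And>v. v \<notin> T \<Longrightarrow> g v = 0" "qf g > 0" using T unfolding hot_def by auto
  have 1: "ip f g = 0" unfolding ip_def using f(1) g(1) ST
    by (intro sum.neutral) (metis IntI empty_iff mult_eq_0_iff)
  have "f v * adj g v = 0" if v: "v < n" for v
  proof (cases "v \<in> S")
    case True
    then have "adj g v = 0" unfolding adj_def
      using na[OF True _ v] g(1) N_sub[of v] v by (intro sum.neutral) (auto simp: subset_eq)
    then show ?thesis by simp
  qed (simp add: f)
  then have 2: "ip f (adj g) = 0" unfolding ip_def by (intro sum.neutral) blast
  have c: "co (\<lambda>v. a * f v + b * g v) k0 = a * co f k0 + b * co g k0" for a b
    by (simp add: co_ip ip_add_left ip_scale_left)
  show False
  proof (cases "co f k0 = 0")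
    case True then show False using qf_orth_top f(2) by force
  next
    case False
    let ?a = "co g k0" and ?b = "- co f k0"
    have "qf (\<lambda>v. ?a * f v + ?b * g v) \<le> 0" by (rule qf_orth_top) (simp only: c, simp)
    moreover have "?a\<^sup>2 * qf f \<ge> 0" "?b\<^sup>2 * qf g > 0" using f g False by auto
    moreover have "qf (\<lambda>v. ?a * f v + ?b * g v) = ?a\<^sup>2 * qf f + ?b\<^sup>2 * qf g"
      by (subst qf_lincomb) (simp add: 1 2)
    ultimately show False by linarith
  qed
qed

lemma eigenvector:
  "\<exists>f. ip f f = 1 \<and> (\<forall>v<n. adj f v = lam * f v)"
  using eig[OF k0(1)] orth[OF k0(1) k0(1)] k0 by (intro exI[of _ "e k0"]) (auto simp: ip_def)

text \<open>Test vector: \<open>s\<close> at \<open>v\<close> and \<open>1\<close> on its neighbours, with \<open>s\<^sup>2 = deg v\<close>.\<close>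
lemma degree_le:
  assumes v: "v < n"
  shows "real (card (N v)) \<le> lam\<^sup>2"
proof -
  define d where "d = card (N v)"
  define s where "s = sqrt (real d)"
  define f where "f = (\<lambda>u. if u = v then s else if u \<in> N v then 1 else (0::real))"
  have ss: "s * s = real d" by (simp add: s_def)
  have s0: "s \<ge> 0" by (simp add: s_def)
  have vN: "v \<notin> N v" using N_irr v by auto
  have Nv: "N v \<subseteq> {..<n}" using N_sub v by auto
  have split: "(\<Sum>u<n. f u * h u) = s * h v + (\<Sum>u\<in>N v. h u)" for h
  proof -
    have "(\<Sum>u<n. f u * h u) = (\<Sum>u\<in>insert v (N v). f u * h u)"
      using v Nv by (intro sum.mono_neutral_right) (auto simp: f_def)
    also have "\<dots> = s * h v + (\<Sum>u\<in>N v. f u * h u)"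
      using v vN by (subst sum.insert) (auto simp: f_def)
    also have "(\<Sum>u\<in>N v. f u * h u) = (\<Sum>u\<in>N v. h u)"
      using vN by (intro sum.cong) (auto simp: f_def)
    finally show ?thesis .
  qed
  have fN: "(\<Sum>u\<in>N v. f u) = (\<Sum>u\<in>N v. 1)" using vN by (intro sum.cong) (auto simp: f_def)
  have ff: "ip f f = 2 * real d"
    unfolding ip_def split fN using ss by (simp add: f_def d_def)
  have av: "adj f v = real d" unfolding adj_def d_def fN by simp
  have au: "adj f u \<ge> s" if u: "u \<in> N v" for u
  proof -
    have un: "u < n" using u Nv by auto
    have "v \<in> N u" using N_sym[of u v] u un v by auto
    then have "f v \<le> adj f u" unfolding adj_def using un s0 by (intro member_le_sum) (auto simp: f_def)
    then show ?thesis by (simp add: f_def)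
  qed
  have "(\<Sum>u\<in>N v. s) \<le> (\<Sum>u\<in>N v. adj f u)" using au by (intro sum_mono) auto
  then have "ip f (adj f) \<ge> 2 * s * real d"
    unfolding ip_def split av by (simp add: d_def mult.commute)
  then have "2 * s * real d \<le> lam * (2 * real d)" using rayleigh[of f] ff by simp
  then have "s \<le> lam \<or> d = 0" by (cases "d = 0") auto
  then show ?thesis
  proof
    assume "s \<le> lam" then have "s * s \<le> lam * lam" using s0 by (intro mult_mono) auto
    then show ?thesis by (simp add: ss d_def power2_eq_square)
  qed (simp add: d_def[symmetric])
qed

end

section \<open>Positive forms from affine Dynkin diagrams\<close>

context fgraph
begin

lemma adj_ge_sum:
  assumes "v \<in> V" "\<And>u. f u \<ge> 0" "X \<subseteq> N v"
  shows "sum f X \<le> adj f v"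
  unfolding adj_def using assms by (intro sum_mono2) auto

text \<open>A small positive value at the extra vertex \<open>y\<close> makes the quadratic form strictly positive.\<close>
lemma hot_subharmonic:
  assumes f0: "\<And>v. f v \<ge> 0" and supp: "\<And>v. f v \<noteq> 0 \<Longrightarrow> v \<in> S" and S: "S \<subseteq> V"
    and sub: "\<And>v. f v \<noteq> 0 \<Longrightarrow> 2 * f v \<le> adj f v"
    and y: "y \<in> V" "f y = 0" and xy: "x \<in> N y" "f x \<noteq> 0"
  shows "hot (insert y S)"
proof -
  define g where "g = (\<lambda>v. if v = y then (1::real) else 0)"
  have gg: "ip h g = h y" for h unfolding ip_def g_def using y by (simp add: if_distrib cong: if_cong)
  have "f v * (2 * f v) \<le> f v * adj f v" for v
    using f0[of v] sub[of v] by (cases "f v = 0") (auto intro: mult_left_mono)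
  then have "(\<Sum>v\<in>V. f v * (2 * f v)) \<le> ip f (adj f)" unfolding ip_def by (intro sum_mono) auto
  then have qf: "qf f \<ge> 0" unfolding qf_def ip_def by (simp add: sum_distrib_left algebra_simps)
  define a where "a = ip f (adj g) - 2 * ip f g"
  have "ip f (adj g) = adj f y" by (simp add: adj_sym[symmetric] gg)
  moreover have "adj f y \<ge> f x" using adj_ge_sum[OF y(1), of f "{x}"] f0 xy by simp
  ultimately have a: "a > 0" using f0[of x] xy y by (simp add: a_def gg)
  have "y \<notin> N y" using N_irr y by auto
  then have "adj g y = 0" unfolding adj_def g_def by (intro sum.neutral) auto
  then have qg: "qf g = -2" unfolding qf_def by (simp add: ip_commute[of g] gg) (simp add: g_def)
  have "qf (\<lambda>v. 1 * f v + (a/2) * g v) = qf f + a\<^sup>2 / 2"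
    unfolding qf_lincomb qg a_def[symmetric] by (simp add: power2_eq_square)
  then have "qf (\<lambda>v. 1 * f v + (a/2) * g v) > 0" using qf a by (simp add: add_nonneg_pos)
  moreover have "1 * f v + (a/2) * g v = 0" if "v \<notin> insert y S" for v
    using that supp[of v] by (auto simp: g_def)
  ultimately show ?thesis unfolding hot_def by (intro exI[of _ "\<lambda>v. 1 * f v + (a/2) * g v"]) simp
qed

text \<open>The indicator function of \<open>S\<close> satisfies the subharmonic inequality because
  every vertex of \<open>S\<close> has two neighbours in \<open>S\<close>. Cycles, the diagrams of
  affine type \<open>A\<close>, are the case in point.\<close>

lemma hot_two_neighbours:
  assumes S: "S \<subseteq> V" and two: "\<forall>v\<in>S. \<exists>u\<in>S. \<exists>w\<in>S. u \<noteq> w \<and> u \<in> N v \<and> w \<in> N v"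
    and y: "y \<in> V" "y \<notin> S" and x: "x \<in> S" "x \<in> N y"
  shows "hot (insert y S)"
proof (rule hot_subharmonic[of "indicat_real S" S y x])
  fix v assume "indicat_real S v \<noteq> 0"
  then have v: "v \<in> S" by (auto simp: indicator_def split: if_splits)
  then obtain u w where uw: "u \<noteq> w" "u \<in> N v \<inter> S" "w \<in> N v \<inter> S" using two by blast
  have "sum (indicat_real S) {u,w} \<le> adj (indicat_real S) v"
    using uw v S by (intro adj_ge_sum) auto
  then show "2 * indicat_real S v \<le> adj (indicat_real S) v" using uw v by simp
qed (use S y x in \<open>auto simp: indicator_def split: if_splits\<close>)

definition nwalk :: "nat list \<Rightarrow> bool" where
  "nwalk ps \<longleftrightarrow> distinct ps \<and> set ps \<subseteq> V \<and> successively (\<lambda>u v. v \<in> N u) ps"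

text \<open>If \<open>y\<close> lies on the path there is a cycle through \<open>p\<^sub>0\<close> with the extra vertex \<open>b\<close>;
  otherwise the vertices carry the affine Dynkin diagram of type \<open>E\<^sub>8\<close> with the extra vertex \<open>p\<^sub>6\<close>.\<close>
lemma hot_arm:
  assumes w: "nwalk [p0,p1,p2,p3,p4,p5,p6]"
    and ab: "a \<in> N p0" "b \<in> N p0" "a \<noteq> b"
      "a \<notin> {p0,p1,p2,p3,p4,p5,p6}" "b \<notin> {p0,p1,p2,p3,p4,p5,p6}"
    and y: "y \<in> N a" "y \<noteq> p0"
  shows "hot {p0,p1,p2,p3,p4,p5,p6,a,b,y}"
proof -
  have d: "distinct [p0,p1,p2,p3,p4,p5,p6]" and V: "{p0,p1,p2,p3,p4,p5,p6} \<subseteq> V"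
    using w by (auto simp: nwalk_def)
  have s: "p1 \<in> N p0" "p2 \<in> N p1" "p3 \<in> N p2" "p4 \<in> N p3" "p5 \<in> N p4" "p6 \<in> N p5"
    using w by (simp_all add: nwalk_def)
  have aV: "a \<in> V" "b \<in> V" using ab V N_sub by auto
  have yV: "y \<in> V" using y aV N_sub by auto
  have s': "p0 \<in> N p1" "p1 \<in> N p2" "p2 \<in> N p3" "p3 \<in> N p4" "p4 \<in> N p5" "p5 \<in> N p6"
    "p0 \<in> N a" "p0 \<in> N b" "a \<in> N y"
    using s V ab aV y yV by (auto intro: N_sym)
  have ya: "y \<noteq> a" using y N_irr aV by auto
  have d1: "distinct [a,b,p0,p1,p2,p3,p4,p5,p6]" using d ab by simp
  have d2: "distinct [p6,p5,p4,p3,p2,p1,p0,b,a]" using d ab by auto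
  note hot = hot_two_neighbours[where y=b and x=p0, OF _ _ _ _ _ s'(8)]
  consider "y = b" | "y = p1" | "y = p2" | "y = p3" | "y = p4" | "y = p5" | "y = p6"
    | "y \<notin> {b,p0,p1,p2,p3,p4,p5,p6}" using y by blast
  then show ?thesis
  proof cases
    case 1
    \<comment> \<open>The triangle \<open>p0\<close>, \<open>a\<close>, \<open>b\<close> already
      uses up \<open>b\<close>, so here \<open>p1\<close> is the extra vertex.\<close>
    have "hot (insert p1 {p0,a,b})"
      by (rule hot_two_neighbours[of _ _ p0]) (use 1 ab(1,2) y s s' V aV d1 d2 in simp_all)
    then show ?thesis by (rule hot_mono) auto
  next
    case 2
    have "hot (insert b {p0,a,p1})"
      by (rule hot) (use 2 ab(1,2) y s s' V aV d1 d2 in simp_all)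
    then show ?thesis by (rule hot_mono) auto
  next
    case 3
    have "hot (insert b {p0,a,p1,p2})"
      by (rule hot) (use 3 ab(1,2) y s s' V aV d1 d2 in simp_all)
    then show ?thesis by (rule hot_mono) auto
  next
    case 4
    have "hot (insert b {p0,a,p1,p2,p3})"
      by (rule hot) (use 4 ab(1,2) y s s' V aV d1 d2 in simp_all)
    then show ?thesis by (rule hot_mono) auto
  next
    case 5
    have "hot (insert b {p0,a,p1,p2,p3,p4})"
      by (rule hot) (use 5 ab(1,2) y s s' V aV d1 d2 in simp_all)
    then show ?thesis by (rule hot_mono) auto
  next
    case 6
    have "hot (insert b {p0,a,p1,p2,p3,p4,p5})"
      by (rule hot) (use 6 ab(1,2) y s s' V aV d1 d2 in simp_all)
    then show ?thesis by (rule hot_mono) auto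
  next
    case 7
    have "hot (insert b {p0,a,p1,p2,p3,p4,p5,p6})"
      by (rule hot) (use 7 ab(1,2) y s s' V aV d1 d2 in simp_all)
    then show ?thesis by (rule hot_mono) auto
  next
    case 8
    have d1: "distinct [y,a,b,p0,p1,p2,p3,p4,p5,p6]" using d1 8 ya by simp
    have d2: "distinct [p6,p5,p4,p3,p2,p1,p0,b,a,y]" using d2 8 ya by auto
    \<comment> \<open>The marks of affine type \<open>E\<^sub>8\<close>: 6 at the branching vertex
      and arms 5, 4, 3, 2, 1 and 4, 2 and 3. Edges beyond those of the diagram only increase
      \<open>adj f\<close>, so the diagram need not be induced.\<close>
    define f where "f = (\<lambda>v. if v = p0 then 6 else if v = p1 then 5 else if v = p2 then 4 else if v = p3 then 3
      else if v = p4 then 2 else if v = p5 then 1 else if v = a then 4 else if v = y then 2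
      else if v = b then 3 else (0::real))"
    have fs: "f v \<noteq> 0 \<Longrightarrow> v \<in> {p0,p1,p2,p3,p4,p5,a,b,y}" for v by (simp add: f_def split: if_splits)
    have f: "f p0 = 6" "f p1 = 5" "f p2 = 4" "f p3 = 3" "f p4 = 2" "f p5 = 1" "f p6 = 0" "f a = 4" "f y = 2" "f b = 3"
      using d1 d2 8 ya by (simp_all add: f_def)
    have f0: "f v \<ge> 0" for v by (simp add: f_def)
    have "hot (insert p6 {p0,p1,p2,p3,p4,p5,a,b,y})"
    proof (rule hot_subharmonic[of f _ p6 p5, OF f0 fs])
      fix v assume "f v \<noteq> 0"
      then have "v \<in> {p0,p1,p2,p3,p4,p5,a,b,y}" by (rule fs)
      then consider "v = p0" | "v = p1" | "v = p2" | "v = p3" | "v = p4" | "v = p5" | "v = a" | "v = b" | "v = y"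
        by blast
      then show "2 * f v \<le> adj f v"
      proof cases
        case 1 then show ?thesis using adj_ge_sum[of p0 f "{p1,a,b}", OF _ f0] f V s ab(1,2) d1 d2 by simp
      next
        case 2 then show ?thesis using adj_ge_sum[of p1 f "{p0,p2}", OF _ f0] f V s s' d1 d2 by simp
      next
        case 3 then show ?thesis using adj_ge_sum[of p2 f "{p1,p3}", OF _ f0] f V s s' d1 d2 by simp
      next
        case 4 then show ?thesis using adj_ge_sum[of p3 f "{p2,p4}", OF _ f0] f V s s' d1 d2 by simp
      next
        case 5 then show ?thesis using adj_ge_sum[of p4 f "{p3,p5}", OF _ f0] f V s s' d1 d2 by simp
      next
        case 6 then show ?thesis using adj_ge_sum[of p5 f "{p4}", OF _ f0] f V s s' d1 d2 by simp
      next
        case 7 then show ?thesis using adj_ge_sum[of a f "{p0,y}", OF _ f0] f V s s' d1 d2 aV y by simp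
      next
        case 8 then show ?thesis using adj_ge_sum[of b f "{p0}", OF _ f0] f V s s' d1 d2 aV by simp
      next
        case 9 then show ?thesis using adj_ge_sum[of y f "{a}", OF _ f0] f V s s' d1 d2 aV yV by simp
      qed
    qed (use f V aV yV s' in simp_all)
    then show ?thesis by (rule hot_mono) auto
  qed
qed

text \<open>The affine Dynkin diagram of type \<open>D\<^sub>4\<close> with the extra vertex \<open>z\<close>.\<close>
lemma hot_star:
  assumes v: "v \<in> V" and d: "distinct [a,b,c,p]" and N: "{a,b,c,p} \<subseteq> N v"
    and z: "z \<in> N p" "z \<notin> {v,a,b,c}"
  shows "hot {v,a,b,c,p,z}"
proof -
  have V: "{v,a,b,c,p} \<subseteq> V" using v N N_sub by auto
  have zV: "z \<in> V" using z V N_sub by auto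
  have s: "v \<in> N a" "v \<in> N b" "v \<in> N c" "v \<in> N p" "p \<in> N z"
    using V N z zV by (auto intro: N_sym)
  have vn: "v \<notin> {a,b,c,p}" using N N_irr v by auto
  have zp: "z \<noteq> p" using z N_irr V by auto
  define f where "f = (\<lambda>u. if u = v then 2 else if u \<in> {a,b,c,p} then 1 else (0::real))"
  have f: "f v = 2" "f a = 1" "f b = 1" "f c = 1" "f p = 1" "f z = 0" and f0: "\<And>u. f u \<ge> 0"
    using vn z zp by (auto simp: f_def)
  have fs: "f u \<noteq> 0 \<Longrightarrow> u \<in> {v,a,b,c,p}" for u by (simp add: f_def split: if_splits)
  have "hot (insert z {v,a,b,c,p})"
  proof (rule hot_subharmonic[of f _ z p, OF f0 fs])
    fix u assume "f u \<noteq> 0"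
    then have "u \<in> {v,a,b,c,p}" by (rule fs)
    then consider "u = v" | "u \<in> {a,b,c,p}" by blast
    then show "2 * f u \<le> adj f u"
    proof cases
      case 1 then show ?thesis using adj_ge_sum[of v f "{a,b,c,p}", OF _ f0] f V N d by simp
    next
      case 2
      then have "sum f {v} \<le> adj f u" using V s by (intro adj_ge_sum f0) auto
      then show ?thesis using 2 f by auto
    qed
  qed (use f V zV s in simp_all)
  then show ?thesis by (rule hot_mono) auto
qed

end

section \<open>Sets of bounded size with positive form\<close>

context fgraph
begin

text \<open>By the arithmetic-geometric mean inequality the product \<open>2 * (f v * f u)\<close>
  on an edge is bounded by the squares of \<open>f v\<close> and \<open>f u\<close> with weights
  \<open>h u / h v\<close> and \<open>h v / h u\<close>. Summed over the neighbours of
  \<open>v\<close> the weights give \<open>adj h v / h v\<close>, which is at most 2.\<close>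

lemma superharmonic_qf_le:
  assumes h: "\<And>v. v \<in> V \<Longrightarrow> h v > 0" "\<And>v. v \<in> V \<Longrightarrow> adj h v \<le> 2 * h v"
  shows "qf f \<le> 0"
proof -
  let ?s = "\<lambda>F. \<Sum>v\<in>V. \<Sum>u\<in>V. if u \<in> N v then F v u else (0::real)"
  have ipf: "ip f (adj f) = ?s (\<lambda>v u. f v * f u)"
    unfolding ip_def by (intro sum.cong refl) (auto simp: adj_V sum_distrib_left intro!: sum.cong)
  have A: "?s (\<lambda>v u. (f v)\<^sup>2 / h v * h u) = (\<Sum>v\<in>V. (f v)\<^sup>2 / h v * adj h v)"
    by (intro sum.cong refl) (auto simp: adj_V sum_distrib_left intro!: sum.cong)
  have B: "?s (\<lambda>v u. (f u)\<^sup>2 / h u * h v) = ?s (\<lambda>v u. (f v)\<^sup>2 / h v * h u)"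
    by (subst sum.swap) (auto intro!: sum.cong dest: N_sym)
  have am: "2 * (f v * f u) \<le> (f v)\<^sup>2 / h v * h u + (f u)\<^sup>2 / h u * h v" if "v \<in> V" "u \<in> V" for v u
  proof -
    have p: "h v > 0" "h u > 0" using h that by auto
    have "0 \<le> (f v * h u - f u * h v)\<^sup>2 / (h v * h u)" using p by simp
    also have "\<dots> = (f v)\<^sup>2 / h v * h u + (f u)\<^sup>2 / h u * h v - 2 * (f v * f u)"
      using p by (simp add: power2_eq_square field_simps)
    finally show ?thesis by simp
  qed
  have "2 * ip f (adj f) = ?s (\<lambda>v u. 2 * (f v * f u))"
    unfolding ipf by (simp add: sum_distrib_left if_distrib cong: if_cong)
  also have "\<dots> \<le> ?s (\<lambda>v u. (f v)\<^sup>2 / h v * h u + (f u)\<^sup>2 / h u * h v)"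
  proof (intro sum_mono)
    fix v u assume "v \<in> V" "u \<in> V"
    then show "(if u \<in> N v then 2 * (f v * f u) else 0)
      \<le> (if u \<in> N v then (f v)\<^sup>2 / h v * h u + (f u)\<^sup>2 / h u * h v else 0)"
      using am[of v u] by simp
  qed
  also have "\<dots> = ?s (\<lambda>v u. (f v)\<^sup>2 / h v * h u) + ?s (\<lambda>v u. (f u)\<^sup>2 / h u * h v)"
    unfolding sum.distrib[symmetric] by (intro sum.cong refl) auto
  also have "\<dots> = 2 * (\<Sum>v\<in>V. (f v)\<^sup>2 / h v * adj h v)" unfolding B A by simp
  also have "(\<Sum>v\<in>V. (f v)\<^sup>2 / h v * adj h v) \<le> (\<Sum>v\<in>V. 2 * (f v * f v))"
  proof (intro sum_mono)
    fix v assume v: "v \<in> V"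
    have "(f v)\<^sup>2 / h v * adj h v \<le> (f v)\<^sup>2 / h v * (2 * h v)"
      using h v by (intro mult_left_mono) (auto simp: less_imp_le)
    also have "\<dots> = 2 * (f v * f v)" using h(1)[OF v] by (simp add: power2_eq_square)
    finally show "(f v)\<^sup>2 / h v * adj h v \<le> 2 * (f v * f v)" .
  qed
  finally have "2 * ip f (adj f) \<le> 2 * (\<Sum>v\<in>V. 2 * (f v * f v))" by simp
  moreover have "(\<Sum>v\<in>V. 2 * (f v * f v)) = 2 * ip f f" by (simp add: ip_def sum_distrib_left)
  ultimately show ?thesis unfolding qf_def by linarith
qed

primrec nball :: "nat set \<Rightarrow> nat \<Rightarrow> nat set" where
  "nball K 0 = K"
| "nball K (Suc d) = nball K d \<union> (\<Union>v\<in>nball K d. N v)"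

primrec sph :: "nat set \<Rightarrow> nat \<Rightarrow> nat set" where
  "sph K 0 = K"
| "sph K (Suc d) = nball K (Suc d) - nball K d"

lemma nball_mono: "d \<le> d' \<Longrightarrow> nball K d \<subseteq> nball K d'"
  by (rule lift_Suc_mono_le[of "nball K"]) auto

lemma sph_nball: "sph K d \<subseteq> nball K d"
  by (cases d) auto

lemma nball_V: "K \<subseteq> V \<Longrightarrow> nball K d \<subseteq> V"
  by (induction d) (use N_sub in auto)

lemma sph_V: "K \<subseteq> V \<Longrightarrow> sph K d \<subseteq> V"
  using nball_V sph_nball by blast

lemma sph_down: "x \<in> sph K (Suc d) \<Longrightarrow> \<exists>y\<in>sph K d. x \<in> N y"
  by (cases d) auto

lemma sph_not_nball: "x \<in> sph K d \<Longrightarrow> e < d \<Longrightarrow> x \<notin> nball K e"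
  using nball_mono[of e "d - 1" K] by (cases d) auto

lemma sph_disj: "x \<in> sph K d \<Longrightarrow> x \<in> sph K e \<Longrightarrow> d = e"
  using sph_nball sph_not_nball by (metis linorder_neqE_nat subsetD)

lemma nball_sph: "x \<in> nball K d \<Longrightarrow> \<exists>e\<le>d. x \<in> sph K e"
proof (induction d)
  case (Suc d)
  show ?case
  proof (cases "x \<in> nball K d")
    case True
    then show ?thesis using Suc.IH le_SucI by blast
  next
    case False
    then have "x \<in> sph K (Suc d)" using Suc.prems by simp
    then show ?thesis by blast
  qed
qed simp

lemma sph_nb:
  assumes "K \<subseteq> V" "x \<in> sph K d" "y \<in> N x"
  shows "\<exists>e. y \<in> sph K e \<and> e \<le> Suc d \<and> d \<le> Suc e"
proof -
  have xV: "x \<in> V" using assms sph_V by auto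
  have yV: "y \<in> V" using xV assms N_sub by auto
  have "y \<in> nball K (Suc d)" using assms sph_nball[of K d] by auto
  then obtain e where e: "e \<le> Suc d" "y \<in> sph K e" using nball_sph by blast
  have "x \<in> N y" using N_sym xV yV assms by blast
  then have "x \<in> nball K (Suc e)" using e sph_nball by auto
  then have "d \<le> Suc e" using sph_not_nball[OF assms(2)] by (meson not_le)
  then show ?thesis using e by auto
qed

lemma card_nball:
  assumes "K \<subseteq> V" and D: "\<And>v. v \<in> V \<Longrightarrow> card (N v) \<le> \<Delta>"
  shows "card (nball K d) \<le> card K * Suc \<Delta> ^ d"
proof (induction d)
  case (Suc d)
  have fin: "finite (nball K d)" using nball_V[OF assms(1)] finite_subset finV by metis
  have "card (nball K (Suc d)) \<le> card (nball K d) + card (\<Union>v\<in>nball K d. N v)"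
    by (simp add: card_Un_le)
  also have "card (\<Union>v\<in>nball K d. N v) \<le> (\<Sum>v\<in>nball K d. card (N v))"
    by (rule card_UN_le[OF fin])
  also have "\<dots> \<le> (\<Sum>v\<in>nball K d. \<Delta>)"
    using D nball_V[OF assms(1)] by (intro sum_mono) auto
  also have "card (nball K d) + \<dots> = card (nball K d) * Suc \<Delta>" by simp
  also have "\<dots> \<le> card K * Suc \<Delta> ^ d * Suc \<Delta>" using Suc by (rule mult_right_mono) simp
  finally show ?case by (simp add: mult_ac)
qed simp

text \<open>Seven vertices are what the long arm of \<open>hot_arm\<close> takes. Both orientations
  are recorded since the branching vertex is \<open>p0\<close> in one application and
  \<open>x\<close> in the other.\<close>

lemma geodesic6:
  assumes K: "K \<subseteq> V" and x: "x \<in> sph K (d + 6)"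
  obtains p5 p4 p3 p2 p1 p0 where
    "p5 \<in> sph K (d + 5)" "p4 \<in> sph K (d + 4)" "p3 \<in> sph K (d + 3)"
    "p2 \<in> sph K (d + 2)" "p1 \<in> sph K (d + 1)" "p0 \<in> sph K d"
    "nwalk [x, p5, p4, p3, p2, p1, p0]" "nwalk [p0, p1, p2, p3, p4, p5, x]"
proof -
  have S: "d + 6 = Suc (d + 5)" "d + 5 = Suc (d + 4)" "d + 4 = Suc (d + 3)" "d + 3 = Suc (d + 2)"
    "d + 2 = Suc (d + 1)" "d + 1 = Suc d" by simp_all
  obtain p5 where 5: "p5 \<in> sph K (d + 5)" "x \<in> N p5" using sph_down[of x K "d+5", folded S(1)] x by blast
  obtain p4 where 4: "p4 \<in> sph K (d + 4)" "p5 \<in> N p4" using sph_down[of p5 K "d+4", folded S(2)] 5 by blast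
  obtain p3 where 3: "p3 \<in> sph K (d + 3)" "p4 \<in> N p3" using sph_down[of p4 K "d+3", folded S(3)] 4 by blast
  obtain p2 where 2: "p2 \<in> sph K (d + 2)" "p3 \<in> N p2" using sph_down[of p3 K "d+2", folded S(4)] 3 by blast
  obtain p1 where 1: "p1 \<in> sph K (d + 1)" "p2 \<in> N p1" using sph_down[of p2 K "d+1", folded S(5)] 2 by blast
  obtain p0 where 0: "p0 \<in> sph K d" "p1 \<in> N p0" using sph_down[of p1 K d, folded S(6)] 1 by blast
  have V: "x \<in> V" "p5 \<in> V" "p4 \<in> V" "p3 \<in> V" "p2 \<in> V" "p1 \<in> V" "p0 \<in> V"
    using sph_V[OF K] x 0 1 2 3 4 5 by blast+
  have ne: "a \<noteq> b" if "a \<in> sph K i" "b \<in> sph K j" "i \<noteq> j" for a b i j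
    using sph_disj that by blast
  have d: "distinct [x, p5, p4, p3, p2, p1, p0]" "distinct [p0, p1, p2, p3, p4, p5, x]"
    using ne[OF x 5(1)] ne[OF x 4(1)] ne[OF x 3(1)] ne[OF x 2(1)] ne[OF x 1(1)] ne[OF x 0(1)]
      ne[OF 5(1) 4(1)] ne[OF 5(1) 3(1)] ne[OF 5(1) 2(1)] ne[OF 5(1) 1(1)] ne[OF 5(1) 0(1)]
      ne[OF 4(1) 3(1)] ne[OF 4(1) 2(1)] ne[OF 4(1) 1(1)] ne[OF 4(1) 0(1)]
      ne[OF 3(1) 2(1)] ne[OF 3(1) 1(1)] ne[OF 3(1) 0(1)]
      ne[OF 2(1) 1(1)] ne[OF 2(1) 0(1)] ne[OF 1(1) 0(1)] by auto
  have r: "p5 \<in> N x" "p4 \<in> N p5" "p3 \<in> N p4" "p2 \<in> N p3" "p1 \<in> N p2" "p0 \<in> N p1"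
    using N_sym V 0 1 2 3 4 5 by blast+
  have "nwalk [x, p5, p4, p3, p2, p1, p0]" "nwalk [p0, p1, p2, p3, p4, p5, x]"
    unfolding nwalk_def using d V r 0(2) 1(2) 2(2) 3(2) 4(2) 5(2) by simp_all
  then show thesis using that 0 1 2 3 4 5 by blast
qed

text \<open>\<open>S\<close> is closed under adjacency, so the form is the sum of the forms of the
  restrictions to \<open>S\<close> and to its complement. A minimal hot graph is therefore
  connected.\<close>

lemma qf_split:
  assumes S: "\<And>v. v \<in> S \<Longrightarrow> N v \<subseteq> S" "S \<subseteq> V" and f: "qf f > 0"
  shows "hot S \<or> hot (V - S)"
proof -
  define f1 where "f1 = (\<lambda>v. if v \<in> S then f v else 0)"
  define f2 where "f2 = (\<lambda>v. if v \<in> V - S then f v else 0)"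
  have out: "u \<notin> S" if "v \<in> V - S" "u \<in> N v" for u v
    using S N_sym N_sub that by blast
  have 1: "ip f1 f2 = 0" unfolding ip_def f1_def f2_def by (intro sum.neutral) auto
  have "adj f2 v = 0" if "v \<in> S" for v
    unfolding adj_def f2_def using S that by (intro sum.neutral) auto
  then have 2: "ip f1 (adj f2) = 0" unfolding ip_def f1_def by (intro sum.neutral) auto
  have "qf (\<lambda>v. 1 * f1 v + 1 * f2 v) = qf f1 + qf f2"
    by (subst qf_lincomb) (simp add: 1 2)
  moreover have "qf (\<lambda>v. 1 * f1 v + 1 * f2 v) = qf f"
  proof -
    have e: "1 * f1 v + 1 * f2 v = f v" if "v \<in> V" for v using that by (simp add: f1_def f2_def)
    have "adj (\<lambda>v. 1 * f1 v + 1 * f2 v) v = adj f v" if "v \<in> V" for v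
      unfolding adj_def using e N_sub[OF that] by (intro sum.cong refl) auto
    with e show ?thesis unfolding qf_def ip_def by (simp cong: sum.cong)
  qed
  ultimately have "qf f1 > 0 \<or> qf f2 > 0" using f by linarith
  then show ?thesis
  proof
    assume "0 < qf f1" then show ?thesis unfolding hot_def by (intro disjI1 exI[of _ f1]) (simp add: f1_def)
  next
    assume "0 < qf f2" then show ?thesis unfolding hot_def by (intro disjI2 exI[of _ f2]) (simp add: f2_def)
  qed
qed

text \<open>In a larger graph no set of at most 10 vertices is hot, which is the size of the
  configuration in \<open>hot_arm\<close>, and connectedness gives every vertex another one at
  distance 6. Then each branching vertex has degree 3 and carries two leaves, as at the ends of
  affine type \<open>D\<close>; such a graph has a positive superharmonic function and is not
  hot.\<close>

lemma minimal_hot_card: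
  assumes hotV: "hot V" and min: "\<And>S. S \<subset> V \<Longrightarrow> \<not> hot S"
    and D: "\<And>v. v \<in> V \<Longrightarrow> card (N v) \<le> \<Delta>"
  shows "card V \<le> 10 + Suc \<Delta> ^ 6"
proof (rule ccontr)
  assume "\<not> ?thesis"
  then have big: "card V > 10" "card V > Suc \<Delta> ^ 6" by auto
  have nh: "\<not> hot S" if "S \<subseteq> V" "card S \<le> 10" for S
    using min[of S] that big by (cases "S = V") auto
  have cl: "card (set xs) \<le> 10" if "length xs \<le> 10" for xs :: "nat list"
    using card_length[of xs] that by linarith
  have geo: "\<exists>x. x \<in> sph {v} 6" if v: "v \<in> V" for v
  proof (rule ccontr)
    assume "\<not> ?thesis"
    moreover have "sph {v} 6 = nball {v} 6 - nball {v} 5" using sph.simps(2)[of "{v}" 5] by simp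
    ultimately have "nball {v} 6 \<subseteq> nball {v} 5" by auto
    then have e: "N u \<subseteq> nball {v} 5" if "u \<in> nball {v} 5" for u
      using nball.simps(2)[of "{v}" 5] that by auto
    have b: "nball {v} 5 \<subseteq> V" using v by (intro nball_V) auto
    have cb: "card (nball {v} 5) < card V"
    proof -
      have "card (nball {v} 5) \<le> card {v} * Suc \<Delta> ^ 5" using v D by (intro card_nball) auto
      also have "\<dots> \<le> Suc \<Delta> ^ 6" by (simp add: power_increasing)
      finally show ?thesis using big by simp
    qed
    then have "nball {v} 5 \<noteq> V" by auto
    moreover have "v \<in> nball {v} 5" using nball_mono[of 0 5 "{v}"] by auto
    ultimately have pr: "nball {v} 5 \<subset> V" "V - nball {v} 5 \<subset> V" using b v by auto
    obtain f where "qf f > 0" using hotV unfolding hot_def by auto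
    then have "hot (nball {v} 5) \<or> hot (V - nball {v} 5)"
      using e b by (intro qf_split) auto
    then show False using min pr by blast
  qed
  \<comment> \<open>Modelled on the null vector of affine type \<open>D\<close>, which is 1 at the
    end leaves and 2 on the path between the branching vertices.\<close>
  define h where "h = (\<lambda>v. if \<exists>u. card (N u) \<ge> 3 \<and> N v = {u} then 1 else (2::real))"
  have h12: "h v \<le> 2" "h v > 0" for v by (auto simp: h_def)
  have "adj h v \<le> 2 * h v" if v: "v \<in> V" for v
  proof (cases "card (N v) \<ge> 3")
    case False
    show ?thesis
    proof (cases "\<exists>u. card (N u) \<ge> 3 \<and> N v = {u}")
      case True
      then obtain u where "N v = {u}" by auto
      then have "adj h v = h u" by (simp add: adj_def)
      moreover have "h v = 1" using True by (simp add: h_def)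
      ultimately show ?thesis using h12[of u] by simp
    next
      case F: False
      have "adj h v \<le> (\<Sum>u\<in>N v. 2)" unfolding adj_def by (intro sum_mono h12)
      also have "\<dots> \<le> 4" using False by simp
      finally have "adj h v \<le> 4" .
      moreover have "h v = 2" using F by (simp only: h_def if_False)
      ultimately show ?thesis by simp
    qed
  next
    case True
    obtain x where x: "x \<in> sph {v} (0 + 6)" using geo[OF v] by auto
    have vV: "{v} \<subseteq> V" using v by simp
    obtain p5 p4 p3 p2 p1 p0 where p:
      "p5 \<in> sph {v} (0 + 5)" "p4 \<in> sph {v} (0 + 4)" "p3 \<in> sph {v} (0 + 3)"
      "p2 \<in> sph {v} (0 + 2)" "p1 \<in> sph {v} (0 + 1)" "p0 \<in> sph {v} 0"
      and w: "nwalk [p0, p1, p2, p3, p4, p5, x]"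
      by (rule geodesic6[OF vV x], rule that; assumption)
    have p0: "p0 = v" using p by simp
    have n1: "a \<in> sph {v} 1" if "a \<in> N v" for a
      using that N_irr[OF v] by auto
    have ne: "a \<noteq> b" if "a \<in> sph {v} i" "b \<in> sph {v} j" "i \<noteq> j" for a b i j
      using sph_disj that by blast
    have notp: "a \<notin> {p0,p1,p2,p3,p4,p5,x}" if "a \<in> N v" "a \<noteq> p1" for a
      using ne[OF n1[OF that(1)] p(1)] ne[OF n1[OF that(1)] p(2)] ne[OF n1[OF that(1)] p(3)]
        ne[OF n1[OF that(1)] p(4)] ne[OF n1[OF that(1)] p(6)] ne[OF n1[OF that(1)] x] that(2) by simp
    have pV: "{p0,p1,p2,p3,p4,p5,x} \<subseteq> V" using w by (simp add: nwalk_def)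
    have p10: "p1 \<in> N v" "p2 \<in> N p1"
      using w p0 by (simp_all add: nwalk_def)
    have leaf: "N a = {v}" if a: "a \<in> N v" "a \<noteq> p1" for a
    proof -
      have "card (N v - {a, p1}) \<ge> 1"
        using True a p10 v by (simp add: card_Diff_subset)
      then obtain b where b: "b \<in> N v" "b \<noteq> a" "b \<noteq> p1"
        by (metis DiffE card.empty ex_in_conv insertCI not_one_le_zero)
      have aV: "a \<in> V" "b \<in> V" using a b v N_sub by auto
      have "y = v" if y: "y \<in> N a" for y
      proof (rule ccontr)
        assume yv: "y \<noteq> v"
        have yV: "y \<in> V" using y aV N_sub by auto
        have "hot {p0,p1,p2,p3,p4,p5,x,a,b,y}"
          using hot_arm[OF w] a b y yv notp p0 by metis
        moreover have "{p0,p1,p2,p3,p4,p5,x,a,b,y} \<subseteq> V" using pV aV yV by auto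
        moreover have "card {p0,p1,p2,p3,p4,p5,x,a,b,y} \<le> 10"
          using cl[of "[p0,p1,p2,p3,p4,p5,x,a,b,y]"] by simp
        ultimately show False using nh by blast
      qed
      moreover have "v \<in> N a" using N_sym[OF _ v a(1)] v a(1) N_sub by blast
      ultimately show ?thesis by blast
    qed
    have c3: "card (N v) = 3"
    proof (rule ccontr)
      assume "card (N v) \<noteq> 3"
      then have "card (N v - {p1}) \<ge> 3" using True p10 v by simp
      then obtain T where T: "T \<subseteq> N v - {p1}" "card T = 3" by (meson obtain_subset_with_card_n)
      then obtain a b c where abc: "T = {a,b,c}" "a \<noteq> b" "b \<noteq> c" "a \<noteq> c"
        by (auto simp: card_3_iff)
      have p2n: "p2 \<notin> {v,a,b,c}"
      proof -
        have "p2 \<noteq> v" using ne[OF p(4) p(6)] p0 by simp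
        moreover have "p2 \<notin> N v" using n1[of p2] sph_disj[OF p(4), of 1] by auto
        ultimately show ?thesis using T abc by auto
      qed
      have "hot {v,a,b,c,p1,p2}"
        using abc T p10 p2n v by (intro hot_star) auto
      moreover have "{v,a,b,c,p1,p2} \<subseteq> V" using T abc v pV N_sub by blast
      moreover have "card {v,a,b,c,p1,p2} \<le> 10" using cl[of "[v,a,b,c,p1,p2]"] by simp
      ultimately show False using nh by blast
    qed
    have h1: "h a = 1" if "a \<in> N v" "a \<noteq> p1" for a using leaf[OF that] True by (auto simp: h_def)
    have "adj h v = h p1 + (\<Sum>a\<in>N v - {p1}. h a)" unfolding adj_def
      using p10 v by (simp add: sum.remove)
    also have "(\<Sum>a\<in>N v - {p1}. h a) = (\<Sum>a\<in>N v - {p1}. 1)" using h1 by (intro sum.cong) auto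
    also have "\<dots> = 2" using c3 p10 v by simp
    finally have "adj h v \<le> 4" using h12[of p1] by simp
    moreover have "h v = 2" using c3 by (auto simp: h_def)
    ultimately show ?thesis by simp
  qed
  then have "qf f \<le> 0" for f using superharmonic_qf_le[of h] h12 by blast
  then show False using hotV unfolding hot_def by (meson not_le)
qed

lemma fgraph_restrict: "K \<subseteq> V \<Longrightarrow> fgraph K (\<lambda>v. N v \<inter> K)"
  by unfold_locales (auto intro: finite_subset[OF _ finV] N_sym dest: N_irr)

lemma hot_restrict:
  assumes K: "K \<subseteq> V" and S: "S \<subseteq> K"
  shows "fgraph.hot K (\<lambda>v. N v \<inter> K) S \<longleftrightarrow> hot S"
proof -
  interpret R: fgraph K "\<lambda>v. N v \<inter> K" by (rule fgraph_restrict[OF K])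
  have "R.qf f = qf f" if f: "\<And>v. v \<notin> S \<Longrightarrow> f v = 0" for f
  proof -
    have fK: "\<And>v. v \<notin> K \<Longrightarrow> f v = 0" using f S by auto
    have i: "R.ip f g = ip f g" for g
      unfolding R.ip_def ip_def using K fK by (intro sum.mono_neutral_left) auto
    have "R.adj f v = adj f v" if "v \<in> K" for v
      unfolding R.adj_def adj_def using fK that K by (intro sum.mono_neutral_left) auto
    then have "R.ip f (R.adj f) = R.ip f (adj f)" unfolding R.ip_def by (simp cong: sum.cong)
    then show ?thesis unfolding R.qf_def qf_def i by simp
  qed
  then show ?thesis unfolding R.hot_def hot_def by metis
qed

text \<open>A hot set of least cardinality induces a graph whose proper subsets are not hot, so
  \<open>minimal_hot_card\<close> applies to it.\<close>

lemma bounded_hot: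
  assumes hot: "hot V" and D: "\<And>v. v \<in> V \<Longrightarrow> card (N v) \<le> \<Delta>"
  obtains K where "K \<subseteq> V" "hot K" "card K \<le> 10 + Suc \<Delta> ^ 6"
proof -
  have "\<exists>K. (K \<subseteq> V \<and> hot K) \<and> (\<forall>S. S \<subseteq> V \<and> hot S \<longrightarrow> card K \<le> card S)"
    using hot ex_has_least_nat[of "\<lambda>K. K \<subseteq> V \<and> hot K" V card] by blast
  then obtain K where K: "K \<subseteq> V" "hot K" and m: "\<And>S. S \<subseteq> V \<Longrightarrow> hot S \<Longrightarrow> card K \<le> card S" by blast
  interpret R: fgraph K "\<lambda>v. N v \<inter> K" by (rule fgraph_restrict[OF K(1)])
  have "card K \<le> 10 + Suc \<Delta> ^ 6"
  proof (rule R.minimal_hot_card)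
    show "R.hot K" using hot_restrict[OF K(1)] K by auto
    show "\<not> R.hot S" if "S \<subset> K" for S
      using hot_restrict[OF K(1), of S] m[of S] that K psubset_card_mono[OF R.finV that] by auto
    show "card (N v \<inter> K) \<le> \<Delta>" if "v \<in> K" for v
    proof -
      have "card (N v \<inter> K) \<le> card (N v)" using that K by (intro card_mono) auto
      then show ?thesis using D[of v] that K by auto
    qed
  qed
  then show thesis using that K by blast
qed

end

section \<open>Rays far from a core\<close>

text \<open>Vertices \<open>\<rho> i 0\<close> with \<open>i < m\<close> form the core, with adjacency relation \<open>A\<close>; a ray
  \<open>\<rho> i 1, \<dots>, \<rho> i (M + 1)\<close> leaves the core at every \<open>i \<in> B\<close>. Nothing is said about the
  further neighbours of the last vertex \<open>\<rho> i (M + 1)\<close>.\<close>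
definition rayed ::
  "nat set \<Rightarrow> (nat \<Rightarrow> nat set) \<Rightarrow> nat \<Rightarrow> (nat \<times> nat) set \<Rightarrow> nat set \<Rightarrow> nat \<Rightarrow> (nat \<Rightarrow> nat \<Rightarrow> nat) \<Rightarrow> bool"
where
  "rayed V N m A B M \<rho> \<longleftrightarrow> B \<subseteq> {..<m} \<and> A \<subseteq> {..<m} \<times> {..<m} \<and>
     (\<forall>i<m. \<rho> i 0 \<in> V) \<and> (\<forall>i\<in>B. \<forall>j\<le>Suc M. \<rho> i j \<in> V) \<and>
     (\<forall>i<m. \<forall>i'<m. \<forall>j j'. (j = 0 \<or> i \<in> B \<and> j \<le> Suc M) \<longrightarrow> (j' = 0 \<or> i' \<in> B \<and> j' \<le> Suc M) \<longrightarrow>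
        \<rho> i j = \<rho> i' j' \<longrightarrow> i = i' \<and> j = j') \<and>
     (\<forall>i<m. N (\<rho> i 0) = (\<lambda>i'. \<rho> i' 0) ` {i'. (i, i') \<in> A} \<union> (if i \<in> B then {\<rho> i 1} else {})) \<and>
     (\<forall>i\<in>B. \<forall>j<M. N (\<rho> i (Suc j)) = {\<rho> i j, \<rho> i (Suc (Suc j))})"

lemma rayed_subset:
  assumes "rayed V N m A B M \<rho>"
  shows "A \<subseteq> {..<m} \<times> {..<m}" "B \<subseteq> {..<m}"
  using assms[unfolded rayed_def, THEN conjunct2, THEN conjunct1] assms[unfolded rayed_def, THEN conjunct1] .

text \<open>\<open>K\<close> will be a bounded hot set. A set that avoids \<open>nball K 1\<close>
  has no edges to \<open>K\<close>, and \<open>two_hot\<close> forbids it to be hot as well.\<close>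

locale cold_graph = fgraph +
  fixes K :: "nat set"
  assumes KV: "K \<subseteq> V"
    and cold: "S \<subseteq> V \<Longrightarrow> S \<inter> nball K 1 = {} \<Longrightarrow> \<not> hot S"
begin

declare sph.simps(2) [simp del]

text \<open>Two outward steps are demanded because \<open>hot_arm\<close> needs both:
  \<open>u\<close> plays the part of \<open>a\<close>, and \<open>w\<close> that of the vertex
  \<open>y\<close> beyond it. Vertices from which the distance grows only once more, as at an end of
  type \<open>D\<close>, are left out.\<close>

definition stem :: "nat \<Rightarrow> nat set" where
  "stem d = {v \<in> sph K d. \<exists>u\<in>sph K (Suc d). u \<in> N v \<and> (\<exists>w\<in>sph K (Suc (Suc d)). w \<in> N u)}"

lemma sphV: "x \<in> sph K d \<Longrightarrow> x \<in> V"
  using sph_V[OF KV] by blast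

text \<open>A third neighbour \<open>b\<close> would complete the configuration of
  \<open>hot_arm\<close>, with the long arm pointing towards \<open>K\<close>. As
  \<open>d \<ge> 8\<close>, six steps towards \<open>K\<close> end at distance at least 2, so all
  ten vertices avoid \<open>nball K 1\<close>.\<close>

lemma stem_deg:
  assumes d: "d \<ge> 8" and v: "v \<in> stem d"
  shows "card (N v) \<le> 2"
proof (rule ccontr)
  assume "\<not> ?thesis"
  then have c: "card (N v) \<ge> 3" by simp
  define e where "e = d - 6"
  have e: "d = e + 6" "e \<ge> 2" using d by (auto simp: e_def)
  have vs: "v \<in> sph K (e + 6)" using v e by (auto simp: stem_def)
  obtain u w where u: "u \<in> sph K (Suc d)" "u \<in> N v" and w: "w \<in> sph K (Suc (Suc d))" "w \<in> N u"
    using v by (auto simp: stem_def)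
  obtain p5 p4 p3 p2 p1 p0 where p: "p5 \<in> sph K (e + 5)" "p4 \<in> sph K (e + 4)" "p3 \<in> sph K (e + 3)"
    "p2 \<in> sph K (e + 2)" "p1 \<in> sph K (e + 1)" "p0 \<in> sph K e"
    and nw: "nwalk [v, p5, p4, p3, p2, p1, p0]"
    by (rule geodesic6[OF KV vs], rule that; assumption)
  have ne: "a \<noteq> b" if "a \<in> sph K i" "b \<in> sph K j" "i \<noteq> j" for a b i j
    using sph_disj that by blast
  have vV: "v \<in> V" using vs sphV by blast
  have "\<not> N v \<subseteq> {u, p5}"
  proof
    assume "N v \<subseteq> {u, p5}"
    then have "card (N v) \<le> card {u, p5}" by (intro card_mono) auto
    also have "\<dots> \<le> 2" by (simp add: card_insert_if)
    finally show False using c by simp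
  qed
  then obtain b where b: "b \<in> N v" "b \<noteq> u" "b \<noteq> p5" by blast
  obtain eb where eb: "b \<in> sph K eb" "d \<le> Suc eb"
    using sph_nb[OF KV _ b(1), of d] vs e by auto
  have bv: "b \<noteq> v" using b N_irr[OF vV] by auto
  have u1: "u \<notin> {v, p5, p4, p3, p2, p1, p0}"
    using ne[OF u(1) vs] ne[OF u(1) p(1)] ne[OF u(1) p(2)] ne[OF u(1) p(3)] ne[OF u(1) p(4)]
      ne[OF u(1) p(5)] ne[OF u(1) p(6)] e by simp
  have b1: "b \<notin> {v, p5, p4, p3, p2, p1, p0}"
    using ne[OF eb(1) p(2)] ne[OF eb(1) p(3)] ne[OF eb(1) p(4)]
      ne[OF eb(1) p(5)] ne[OF eb(1) p(6)] e eb(2) bv b by simp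
  have wv: "w \<noteq> v" using ne[OF w(1) vs] e by simp
  have hot: "hot {v, p5, p4, p3, p2, p1, p0, u, b, w}"
    using hot_arm[OF nw u(2) b(1) b(2)[symmetric] u1 b1 w(2) wv] .
  have V: "{v, p5, p4, p3, p2, p1, p0, u, b, w} \<subseteq> V"
    using sphV[OF vs] sphV[OF u(1)] sphV[OF eb(1)] sphV[OF w(1)] sphV[OF p(1)] sphV[OF p(2)]
      sphV[OF p(3)] sphV[OF p(4)] sphV[OF p(5)] sphV[OF p(6)] by simp
  have nb: "x \<notin> nball K 1" if "x \<in> sph K i" "1 < i" for x i using sph_not_nball that by blast
  have "{v, p5, p4, p3, p2, p1, p0, u, b, w} \<inter> nball K 1 = {}"
    using nb[OF vs] nb[OF u(1)] nb[OF eb(1)] nb[OF w(1)] nb[OF p(1)] nb[OF p(2)]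
      nb[OF p(3)] nb[OF p(4)] nb[OF p(5)] nb[OF p(6)] e eb(2) by simp
  then show False using cold[OF V] hot by blast
qed

lemma stem_N:
  assumes d: "Suc d \<ge> 8" and v: "v \<in> stem (Suc d)"
  shows "\<exists>p\<in>sph K d. \<exists>u\<in>sph K (Suc (Suc d)). v \<in> N p \<and> N v = {p, u}"
proof -
  have vs: "v \<in> sph K (Suc d)" using v by (auto simp: stem_def)
  obtain u where u: "u \<in> sph K (Suc (Suc d))" "u \<in> N v" using v by (auto simp: stem_def)
  obtain p where p: "p \<in> sph K d" "v \<in> N p" using sph_down[OF vs] by auto
  have pv: "p \<in> N v" using N_sym[OF sphV[OF vs] sphV[OF p(1)] p(2)] .
  have "p \<noteq> u" using sph_disj[of p K d "Suc (Suc d)"] p u by auto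
  then have "card {p, u} = 2" by simp
  then have "{p, u} = N v"
    using stem_deg[OF d v] u pv sphV[OF vs] by (intro card_seteq) auto
  then show ?thesis using p u by blast
qed

definition up :: "nat \<Rightarrow> nat \<Rightarrow> nat" where
  "up d v = (SOME u. u \<in> N v \<and> u \<in> sph K (Suc d))"

lemma up_unique:
  assumes "d \<ge> 8" "v \<in> stem d" "u \<in> N v" "u \<in> sph K (Suc d)"
  shows "up d v = u"
proof -
  obtain d' where d': "d = Suc d'" using assms(1) by (cases d) auto
  obtain p u' where p: "p \<in> sph K d'" "u' \<in> sph K (Suc d)" "N v = {p, u'}"
    using stem_N[of d' v] assms d' by auto
  have "x = u'" if "x \<in> N v" "x \<in> sph K (Suc d)" for x
    using that p sph_disj[of p K d' "Suc d"] d' by auto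
  then show ?thesis unfolding up_def using assms by (metis (mono_tags, lifting) someI_ex)
qed

lemma stem_down:
  assumes "x \<in> stem (Suc d)" "v \<in> sph K d" "x \<in> N v"
  shows "v \<in> stem d"
  using assms by (auto simp: stem_def)

lemma finite_stem: "finite (stem d)"
  by (rule finite_subset[OF _ finV]) (auto simp: stem_def sphV)

text \<open>A predecessor of a stem vertex is a stem vertex, and its outward neighbour is unique.
  Hence the number of stem vertices cannot grow with the distance.\<close>

lemma stem_sub_up:
  assumes "d \<ge> 8"
  shows "stem (Suc d) \<subseteq> up d ` stem d"
proof
  fix x assume x: "x \<in> stem (Suc d)"
  then have xs: "x \<in> sph K (Suc d)" by (simp add: stem_def)
  then obtain v where v: "v \<in> sph K d" "x \<in> N v" using sph_down by blast
  then show "x \<in> up d ` stem d" using stem_down[OF x v] up_unique[OF assms _ v(2) xs] by blast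
qed

lemma card_stem_Suc: "d \<ge> 8 \<Longrightarrow> card (stem (Suc d)) \<le> card (stem d)"
  using stem_sub_up[of d] finite_stem[of d] by (meson card_image_le card_mono finite_imageI le_trans)

lemma up_bij:
  assumes "d \<ge> 8" "card (stem (Suc d)) = card (stem d)"
  shows "bij_betw (up d) (stem d) (stem (Suc d))"
proof -
  have "stem (Suc d) = up d ` stem d"
    using stem_sub_up[OF assms(1)] finite_stem assms(2)
    by (intro card_seteq) (auto intro: card_image_le)
  then show ?thesis using assms(2) finite_stem
    by (simp add: bij_betw_def eq_card_imp_inj_on)
qed

primrec ray :: "nat \<Rightarrow> nat \<Rightarrow> nat \<Rightarrow> nat" where
  "ray R v 0 = v"
| "ray R v (Suc j) = up (R + j) (ray R v j)"

text \<open>While the number of stem vertices is constant, \<open>up\<close> is bijective between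
  consecutive levels: no ray ends and no two rays meet. Levels up to \<open>d = r + 2 + M\<close>
  are needed, since the rays start at radius \<open>r + 2\<close> and make \<open>M + 1\<close>
  steps.\<close>

lemma window_rayed:
  assumes r: "r \<ge> 8" and cst: "\<And>d. r \<le> d \<Longrightarrow> d < r + 3 + M \<Longrightarrow> card (stem (Suc d)) = card (stem d)"
  shows "\<exists>A B \<rho>. rayed V N (card (nball K (r + 2))) A B M \<rho> \<and>
     (\<lambda>i. \<rho> i 0) ` {..<card (nball K (r + 2))} = nball K (r + 2)"
proof -
  \<comment> \<open>From two levels above \<open>r\<close> on, the whole sphere consists of stem
    vertices: a vertex and its predecessor witness that the vertex two levels below is one, and
    bijectivity of \<open>up\<close> carries this back outward.\<close>
  define R where "R = r + 2"
  let ?C = "nball K R"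
  have bij: "bij_betw (up d) (stem d) (stem (Suc d))" if "r \<le> d" "d < r + 3 + M" for d
    using up_bij[of d] cst[OF that] that r by auto
  have sph_stem: "sph K d = stem d" if d: "R \<le> d" "d \<le> r + 3 + M" for d
  proof
    obtain f where f: "d = Suc (Suc f)" "r \<le> f" using d by (cases d; cases "d - 1") (auto simp: R_def)
    show "sph K d \<subseteq> stem d"
    proof
      fix x assume x: "x \<in> sph K d"
      obtain v where v: "v \<in> sph K (Suc f)" "x \<in> N v" using sph_down x f by blast
      obtain w where w: "w \<in> sph K f" "v \<in> N w" using sph_down v by blast
      have ws: "w \<in> stem f" using w v x f by (auto simp: stem_def)
      have "up f w = v" using up_unique[of f w v] f r ws w v by auto
      then have vs: "v \<in> stem (Suc f)" using bij_betw_apply[OF bij ws] f d by auto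
      have "up (Suc f) v = x" using up_unique[of "Suc f" v x] f r vs v x by auto
      then show "x \<in> stem d" using bij_betw_apply[OF bij vs] f d by auto
    qed
  qed (auto simp: stem_def)
  have ray_bij: "bij_betw (\<lambda>v. ray R v j) (sph K R) (sph K (R + j))" if "j \<le> Suc M" for j
    using that
  proof (induction j)
    case (Suc j)
    have "bij_betw (up (R + j)) (sph K (R + j)) (sph K (R + Suc j))"
      using bij[of "R + j"] sph_stem[of "R + j"] sph_stem[of "R + Suc j"] Suc.prems by (simp add: R_def)
    with Suc.IH Suc.prems have "bij_betw (up (R + j) \<circ> (\<lambda>v. ray R v j)) (sph K R) (sph K (R + Suc j))"
      by (intro bij_betw_trans) auto
    then show ?case by (simp add: o_def)
  qed (simp add: bij_betw_def)
  have ray_sph: "ray R v j \<in> sph K (R + j)" if "v \<in> sph K R" "j \<le> Suc M" for v j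
    using bij_betw_apply[OF ray_bij that(1)] that(2) by blast
  have ray_inj: "v = v' \<and> j = j'" if "v \<in> sph K R" "j \<le> Suc M" "v' \<in> sph K R" "j' \<le> Suc M" "ray R v j = ray R v' j'" for v j v' j'
  proof -
    have "R + j = R + j'" using sph_disj[OF ray_sph[OF that(1,2)], of "R + j'"] ray_sph[OF that(3,4)] that(5) by simp
    then show ?thesis using ray_bij[OF that(2)] that by (auto simp: bij_betw_def inj_on_def)
  qed
  have rayN: "N (ray R v (Suc j)) = {ray R v j, ray R v (Suc (Suc j))}" if v: "v \<in> sph K R" and j: "j < M" for v j
  proof -
    let ?x = "ray R v (Suc j)"
    have x: "?x \<in> sph K (R + Suc j)" using ray_sph[OF v, of "Suc j"] j by (simp del: ray.simps)
    have xs: "?x \<in> stem (R + Suc j)" using x sph_stem[of "R + Suc j"] j by (simp add: R_def)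
    have g8: "R + Suc j \<ge> 8" using r by (simp add: R_def)
    obtain p u where p: "p \<in> sph K (R + j)" "u \<in> sph K (Suc (Suc (R + j)))" "?x \<in> N p" "N ?x = {p, u}"
      using stem_N[of "R + j" ?x] g8 xs by (auto)
    have "up (R + Suc j) ?x = u" using up_unique[OF g8 xs, of u] p by simp
    then have u: "ray R v (Suc (Suc j)) = u" by simp
    have ps: "p \<in> stem (R + j)" using p sph_stem[of "R + j"] j by (simp add: R_def)
    have "up (R + j) p = ?x" using up_unique[of "R + j" p ?x] r ps p x by (simp add: R_def del: ray.simps)
    \<comment> \<open>The predecessor \<open>p\<close> lies on some ray; injectivity one level
      further out shows that it is the ray of \<open>v\<close>.\<close>
    moreover obtain v' where v': "v' \<in> sph K R" "p = ray R v' j"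
      using p(1) ray_bij[of j] j by (auto simp: bij_betw_def)
    ultimately have "ray R v' (Suc j) = ?x" by simp
    then have "v' = v" using ray_inj[of v' "Suc j" v "Suc j"] v v' j by simp
    then show ?thesis using p u v' by simp
  qed
  have coreN: "N x \<subseteq> ?C" if x: "x \<in> ?C" "x \<notin> sph K R" for x
  proof -
    obtain e where e: "e \<le> R" "x \<in> sph K e" using nball_sph[OF x(1)] by blast
    with x(2) have "e < R" by (metis le_neq_implies_less)
    then have "N x \<subseteq> nball K (Suc e)" "nball K (Suc e) \<subseteq> ?C"
      using e sph_nball[of K e] nball_mono[of "Suc e" R K] by auto
    then show ?thesis by blast
  qed
  have bdN: "N v = (N v \<inter> ?C) \<union> {ray R v 1}" "ray R v 1 \<notin> ?C" if v: "v \<in> sph K R" for v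
  proof -
    have vs: "v \<in> stem (Suc (r + 1))" using v sph_stem[of R] by (simp add: R_def)
    obtain p u where p: "p \<in> sph K (r + 1)" "u \<in> sph K (Suc R)" "N v = {p, u}"
      using stem_N[of "r + 1" v] r vs by (auto simp: R_def)
    have "up R v = u" using up_unique[of R v u] p r vs by (simp add: R_def)
    then have u: "ray R v 1 = u" by simp
    have "p \<in> ?C" using p(1) sph_nball[of K "r + 1"] nball_mono[of "r + 1" R K] by (auto simp: R_def simp del: nball.simps)
    moreover show "ray R v 1 \<notin> ?C" using sph_not_nball[OF p(2), of R] u by simp
    ultimately show "N v = (N v \<inter> ?C) \<union> {ray R v 1}" using p u by auto
  qed
  have finC: "finite ?C" using nball_V[OF KV] finite_subset finV by metis
  obtain g where g: "bij_betw g {..<card ?C} ?C"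
    using ex_bij_betw_nat_finite[OF finC] by (auto simp: atLeast0LessThan)
  define m where "m = card ?C"
  define \<rho> where "\<rho> = (\<lambda>i j. ray R (g i) j)"
  define B where "B = {i. i < m \<and> g i \<in> sph K R}"
  define A where "A = {(i, i'). i < m \<and> i' < m \<and> g i' \<in> N (g i)}"
  have gC: "g i \<in> ?C" if "i < m" for i using bij_betw_apply[OF g] that by (simp add: m_def)
  have ginj: "i = i'" if "i < m" "i' < m" "g i = g i'" for i i'
    using g that by (auto simp: bij_betw_def inj_on_def m_def)
  have gimg: "g ` {..<m} = ?C" using g by (simp add: bij_betw_def m_def)
  have out: "ray R v (Suc j) \<notin> ?C" if "v \<in> sph K R" "j \<le> M" for v j
    using sph_not_nball[OF ray_sph[OF that(1), of "Suc j"], of R] that(2) by simp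
  have coreA: "(\<lambda>i'. \<rho> i' 0) ` {i'. (i, i') \<in> A} = N (g i) \<inter> ?C" if "i < m" for i
    using that gimg by (auto simp: A_def \<rho>_def image_iff)
  have "rayed V N m A B M \<rho>"
    unfolding rayed_def
  proof (intro conjI allI impI ballI)
    show "B \<subseteq> {..<m}" by (auto simp: B_def)
    show "A \<subseteq> {..<m} \<times> {..<m}" by (auto simp: A_def)
    show "\<rho> i 0 \<in> V" if "i < m" for i using gC[OF that] nball_V[OF KV] by (auto simp: \<rho>_def)
    show "\<rho> i j \<in> V" if "i \<in> B" "j \<le> Suc M" for i j
      using ray_sph[of "g i" j] sphV that by (auto simp: \<rho>_def B_def)
    show "N (\<rho> i (Suc j)) = {\<rho> i j, \<rho> i (Suc (Suc j))}" if "i \<in> B" "j < M" for i j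
      using rayN[of "g i" j] that by (simp add: \<rho>_def B_def del: ray.simps)
    show "N (\<rho> i 0) = (\<lambda>i'. \<rho> i' 0) ` {i'. (i, i') \<in> A} \<union> (if i \<in> B then {\<rho> i 1} else {})" if i: "i < m" for i
    proof (cases "i \<in> B")
      case True
      then show ?thesis using coreA[OF i] bdN(1)[of "g i"] by (simp add: \<rho>_def B_def)
    next
      case False
      then have "N (g i) \<subseteq> ?C" using coreN gC[OF i] i by (simp add: B_def)
      then show ?thesis using coreA[OF i] False by (auto simp: \<rho>_def)
    qed
    fix i i' j j' assume i: "i < m" "i' < m" "j = 0 \<or> i \<in> B \<and> j \<le> Suc M" "j' = 0 \<or> i' \<in> B \<and> j' \<le> Suc M"
      and eq: "\<rho> i j = \<rho> i' j'"
    have "g i = g i' \<and> j = j'"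
    proof (cases "j = 0"; cases "j' = 0")
      assume "j = 0" "j' = 0" then show ?thesis using eq by (simp add: \<rho>_def)
    next
      assume j: "j = 0" "j' \<noteq> 0"
      then obtain k where k: "j' = Suc k" by (cases j') auto
      then have "\<rho> i' j' \<notin> ?C" using out[of "g i'" k] i j by (simp add: \<rho>_def B_def del: ray.simps)
      then show ?thesis using eq gC[OF i(1)] j by (simp add: \<rho>_def)
    next
      assume j: "j \<noteq> 0" "j' = 0"
      then obtain k where k: "j = Suc k" by (cases j) auto
      then have "\<rho> i j \<notin> ?C" using out[of "g i" k] i j by (simp add: \<rho>_def B_def del: ray.simps)
      then show ?thesis using eq gC[OF i(2)] j by (simp add: \<rho>_def)
    next
      assume j: "j \<noteq> 0" "j' \<noteq> 0"
      then show ?thesis using ray_inj[of "g i" j "g i'" j'] i eq by (simp add: \<rho>_def B_def)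
    qed
    then show "i = i'" "j = j'" using ginj i by auto
  qed
  moreover have "(\<lambda>i. \<rho> i 0) ` {..<m} = ?C" using gimg by (simp add: \<rho>_def)
  ultimately show ?thesis unfolding m_def R_def by blast
qed

end

text \<open>Were every radius bad, each \<open>r\<close> would have a window length
  \<open>k r\<close> within which all late sequences drop. Take \<open>c + 1\<close> such windows in
  a row and an index \<open>n\<close> beyond all their bounds: \<open>X n\<close> would drop
  \<open>c + 1\<close> times, starting from a value of at most \<open>c\<close>.\<close>

lemma common_window:
  fixes X :: "nat \<Rightarrow> nat \<Rightarrow> nat"
  assumes mono: "\<And>n d. d \<ge> s \<Longrightarrow> X n (Suc d) \<le> X n d" and bd: "\<And>n. X n s \<le> c"
  shows "\<exists>r\<ge>s. \<forall>k. \<exists>n\<ge>k. \<forall>d. r \<le> d \<and> d < r + k \<longrightarrow> X n (Suc d) = X n d"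
proof (rule ccontr)
  assume "\<not> ?thesis"
  then have "\<forall>r. \<exists>k. r \<ge> s \<longrightarrow> (\<forall>n\<ge>k. \<exists>d. r \<le> d \<and> d < r + k \<and> X n (Suc d) \<noteq> X n d)" by meson
  then obtain k where k: "\<And>r n. r \<ge> s \<Longrightarrow> n \<ge> k r \<Longrightarrow> \<exists>d. r \<le> d \<and> d < r + k r \<and> X n (Suc d) \<noteq> X n d" by metis
  have anti: "X n d' \<le> X n d" if "s \<le> d" "d \<le> d'" for n d d'
    using that(2) by (induction rule: dec_induct) (use mono that(1) in \<open>auto intro: le_trans\<close>)
  have drop: "X n (r + k r) < X n r" if rn: "r \<ge> s" "n \<ge> k r" for n r
  proof -
    obtain d where d: "r \<le> d" "d < r + k r" "X n (Suc d) \<noteq> X n d" using k[OF rn] by blast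
    have "X n (r + k r) \<le> X n (Suc d)" using anti d rn by auto
    also have "\<dots> < X n d" using d mono[of d n] that by auto
    also have "\<dots> \<le> X n r" using anti d rn by auto
    finally show ?thesis .
  qed
  define R where "R = rec_nat s (\<lambda>_ r. r + k r)"
  have R: "R 0 = s" "\<And>i. R (Suc i) = R i + k (R i)" by (simp_all add: R_def)
  have Rs: "R i \<ge> s" for i by (induction i) (auto simp: R)
  define n where "n = (\<Sum>i\<le>c. k (R i))"
  have nk: "n \<ge> k (R i)" if "i \<le> c" for i unfolding n_def using that by (intro member_le_sum) auto
  have "X n (R i) + i \<le> c" if "i \<le> Suc c" for i
    using that
  proof (induction i)
    case (Suc i)
    have "X n (R (Suc i)) < X n (R i)" using drop[OF Rs nk, of i] Suc.prems R by auto
    then show ?case using Suc by auto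
  qed (use bd R in auto)
  from this[of "Suc c"] show False by auto
qed

section \<open>Integer polynomials\<close>

abbreviation ieval :: "int poly \<Rightarrow> 'a :: comm_ring_1 \<Rightarrow> 'a" where
  "ieval p z \<equiv> poly (map_poly of_int p) z"

lemma ieval_mult: "ieval (p * q) z = ieval p z * ieval q z"
  by (simp add: hom_distribs)

lemma ieval_of_real: "ieval p (complex_of_real x) = of_real (ieval p x)"
  by (induction p) (auto simp: map_poly_pCons)

text \<open>The factors of a monic integer polynomial have leading coefficients 1 or -1, so the
  factor that vanishes at \<open>x\<close> becomes monic when multiplied by its own leading
  coefficient, and the degree decreases.\<close>

lemma monic_irreducible_factor:
  fixes P :: "int poly" and x :: real
  assumes "lead_coeff P = 1" "ieval P x = 0"
  shows "\<exists>p. irreducible p \<and> lead_coeff p = 1 \<and> ieval p x = 0 \<and> p dvd P"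
  using assms
proof (induction "degree P" arbitrary: P rule: less_induct)
  case less
  show ?case
  proof (cases "irreducible P")
    case True then show ?thesis using less.prems by (intro exI[of _ P]) simp
  next
    case False
    have P0: "P \<noteq> 0" using less.prems(1) by (metis coeff_0 zero_neq_one)
    have "\<not> P dvd 1"
    proof
      assume "P dvd 1"
      then have "degree P = 0" by (simp add: poly_dvd_1)
      then have "P = [:1:]" using less.prems(1) by (metis degree_eq_zeroE lead_coeff_pCons(2))
      then show False using less.prems by simp
    qed
    then obtain a b where ab: "P = a * b" "\<not> a dvd 1" "\<not> b dvd 1"
      using False P0 unfolding irreducible_def by blast
    have l: "lead_coeff a * lead_coeff b = 1" using ab less.prems by (simp add: lead_coeff_mult)
    have key: "\<exists>p. irreducible p \<and> lead_coeff p = 1 \<and> ieval p x = 0 \<and> p dvd P"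
      if c: "P = c * d" "\<not> d dvd 1" "lead_coeff c * lead_coeff d = 1" "ieval c x = 0" for c d
    proof -
      have u: "lead_coeff c = 1 \<and> lead_coeff d = 1 \<or> lead_coeff c = -1 \<and> lead_coeff d = -1"
        using c(3) zmult_eq_1_iff by blast
      have dd: "degree d > 0"
      proof (rule ccontr)
        assume "\<not> ?thesis"
        then obtain k where "d = [:k:]" by (metis degree_eq_zeroE gr0I)
        then show False using u c(2) by auto
      qed
      have c0: "c \<noteq> 0" "d \<noteq> 0" using c P0 by auto
      define c' where "c' = Polynomial.smult (lead_coeff c) c"
      have "degree c' < degree P" using c(1) c0 dd u by (auto simp: c'_def degree_mult_eq)
      moreover have "lead_coeff c' = 1" using u by (auto simp: c'_def)
      moreover have "ieval c' x = 0" using c(4) by (simp add: c'_def hom_distribs)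
      moreover have "c' dvd P" using u c(1) by (auto simp: c'_def)
      ultimately show ?thesis using less.hyps[of c'] dvd_trans by blast
    qed
    have "ieval a x * ieval b x = 0" using less.prems ab by (simp add: ieval_mult[symmetric])
    then have "ieval a x = 0 \<or> ieval b x = 0" by (simp only: mult_eq_0_iff)
    then show ?thesis
    proof
      assume "ieval a x = 0"
      then show ?thesis by (rule key[OF ab(1) ab(3) l])
    next
      have "P = b * a" "lead_coeff b * lead_coeff a = 1" using ab(1) l by (simp_all only: mult.commute)
      moreover assume "ieval b x = 0"
      ultimately show ?thesis using key[of b a] ab(2) by blast
    qed
  qed
qed

text \<open>The integer polynomials have no division with remainder, so a primitive polynomial
  \<open>m\<close> of least degree that vanishes at \<open>\<alpha>\<close> serves as minimal
  polynomial. It is irreducible, hence prime; pseudo-division makes it divide a constant multiple of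
  each polynomial vanishing at \<open>\<alpha>\<close>, hence the polynomial itself.\<close>

lemma irreducible_dvd_common_root:
  fixes p T :: "int poly" and \<alpha> :: complex
  assumes p: "irreducible p" "ieval p \<alpha> = 0" and T: "ieval T \<alpha> = 0"
  shows "p dvd T"
proof -
  let ?I = "\<lambda>f. f \<noteq> 0 \<and> ieval f \<alpha> = 0"
  have "?I p" using p by auto
  then obtain m0 where m0: "?I m0" "\<And>f. ?I f \<Longrightarrow> degree m0 \<le> degree f"
    using ex_has_least_nat[of ?I p degree] by blast
  define m where "m = primitive_part m0"
  have m0m: "m0 = Polynomial.smult (content m0) m" by (simp add: m_def)
  have cm0: "content m0 \<noteq> 0" using m0 by simp
  have "ieval m0 \<alpha> = of_int (content m0) * ieval m \<alpha>" by (subst m0m) (simp add: hom_distribs)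
  then have "of_int (content m0) * ieval m \<alpha> = 0" using m0(1) by simp
  then have "ieval m \<alpha> = 0" using cm0 by simp
  moreover have "m \<noteq> 0" using m0(1) by (simp add: m_def)
  ultimately have m: "?I m" by simp
  have md: "degree m \<le> degree f" if "?I f" for f using m0(2)[OF that] by (simp add: m_def)
  have cm: "content m = 1" using m0(1) by (simp add: m_def)
  have dm: "degree m > 0"
  proof (rule ccontr)
    assume "\<not> ?thesis"
    then obtain k where "m = [:k:]" by (metis degree_eq_zeroE gr0I)
    then show False using m by auto
  qed
  have irr: "irreducible m"
  proof (rule irreducibleI)
    show "m \<noteq> 0" using m by simp
    show "\<not> m dvd 1" using dm by (auto simp: poly_dvd_1)
    fix a b assume ab: "m = a * b"
    have ab0: "a \<noteq> 0" "b \<noteq> 0" using ab m by auto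
    have unit: "d dvd 1" if d: "m = c * d" "c \<noteq> 0" "d \<noteq> 0" "ieval c \<alpha> = 0" for c d
    proof -
      have "degree d = 0" using md[of c] d by (simp add: degree_mult_eq)
      then obtain k where k: "d = [:k:]" by (metis degree_eq_zeroE)
      have "content m = content c * content d" using d(1) by (simp add: content_mult)
      then have "content d dvd 1" using cm by (metis dvd_triv_right)
      then show ?thesis using k by simp
    qed
    have "ieval a \<alpha> * ieval b \<alpha> = 0" using m ab by (simp add: ieval_mult[symmetric])
    then have "ieval a \<alpha> = 0 \<or> ieval b \<alpha> = 0" by (simp only: mult_eq_0_iff)
    moreover have "m = b * a" using ab by (simp only: mult.commute)
    ultimately show "a dvd 1 \<or> b dvd 1" using unit[OF ab ab0] unit[of b a] ab0 by blast
  qed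
  have pr: "prime_elem m" using irr by (rule irreducible_imp_prime_elem_gcd)
  have mdvd: "m dvd f" if f: "ieval f \<alpha> = 0" for f
  proof -
    obtain a q where aq: "a \<noteq> 0" "Polynomial.smult a f = m * q + pseudo_mod f m"
      using pseudo_mod(1)[of m f] m by blast
    have "ieval (Polynomial.smult a f) \<alpha> = 0" using f by (simp add: hom_distribs)
    then have "ieval (pseudo_mod f m) \<alpha> = 0" using aq m by (simp add: hom_distribs)
    moreover have "pseudo_mod f m = 0 \<or> degree (pseudo_mod f m) < degree m"
      using pseudo_mod(2)[of m f] m by blast
    ultimately have "pseudo_mod f m = 0" using md[of "pseudo_mod f m"] by linarith
    then have "m dvd [:a:] * f" using aq by simp
    moreover have "\<not> m dvd [:a:]"
      using dm aq(1) dvd_imp_degree_le[of m "[:a:]"] by auto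
    ultimately show ?thesis using prime_elem_dvd_multD[OF pr] by blast
  qed
  have "m dvd p" using mdvd p by simp
  then have "p dvd m" using irreducibleD'[OF p(1)] irr by (auto simp: irreducible_def)
  then show ?thesis using mdvd[OF T] dvd_trans by blast
qed

lemma even_odd_parts:
  fixes p :: "int poly"
  shows "\<exists>a b. p = a \<circ>\<^sub>p [:0,0,1:] + [:0,1:] * (b \<circ>\<^sub>p [:0,0,1:])"
proof (induction p)
  case 0 then show ?case by (intro exI[of _ 0]) simp
next
  case (pCons c q)
  then obtain a b where ab: "q = a \<circ>\<^sub>p [:0,0,1:] + [:0,1:] * (b \<circ>\<^sub>p [:0,0,1:])" by blast
  have "pCons c q = [:c:] + [:0,1:] * q" by simp
  also have "\<dots> = (pCons c b) \<circ>\<^sub>p [:0,0,1:] + [:0,1:] * (a \<circ>\<^sub>p [:0,0,1:])"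
    unfolding ab by (simp add: pcompose_pCons algebra_simps)
  finally show ?case by blast
qed

text \<open>Up to sign this is the Graeffe transform of \<open>p\<close>, whose complex roots are
  the squares of those of \<open>p\<close>.\<close>

lemma ieval_even_odd:
  fixes z :: "'a :: comm_ring_1"
  assumes "p = a \<circ>\<^sub>p [:0,0,1:] + [:0,1:] * (b \<circ>\<^sub>p [:0,0,1:])"
  shows "ieval (a * a - [:0,1:] * (b * b)) (z\<^sup>2) = ieval p z * ieval p (- z)"
  unfolding assms by (simp add: hom_distribs poly_pcompose power2_eq_square algebra_simps)

lemma lead_coeff_even_odd:
  fixes p :: "int poly"
  assumes ab: "p = a \<circ>\<^sub>p [:0,0,1:] + [:0,1:] * (b \<circ>\<^sub>p [:0,0,1:])" and p: "lead_coeff p = 1"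
  shows "lead_coeff (a * a - [:0,1:] * (b * b)) = 1 \<or> lead_coeff (a * a - [:0,1:] * (b * b)) = -1"
proof -
  define S where "S = a * a - [:0,1:] * (b * b)"
  have "S \<circ>\<^sub>p [:0,0,1:] = p * (p \<circ>\<^sub>p [:0,-1:])"
  proof (subst poly_eq_poly_eq_iff[symmetric], rule ext)
    fix x :: int
    have id: "map_poly of_int f = f" for f :: "int poly" by (simp add: map_poly_idI)
    have "poly S (x\<^sup>2) = poly p x * poly p (- x)" using ieval_even_odd[OF ab, of x] unfolding id S_def by simp
    then show "poly (S \<circ>\<^sub>p [:0,0,1:]) x = poly (p * (p \<circ>\<^sub>p [:0,-1:])) x"
      by (simp add: poly_pcompose power2_eq_square)
  qed
  then have "lead_coeff (S \<circ>\<^sub>p [:0,0,1:]) = lead_coeff p * lead_coeff (p \<circ>\<^sub>p [:0,-1:])"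
    by (simp add: lead_coeff_mult)
  moreover have "lead_coeff (S \<circ>\<^sub>p [:0,0,1:]) = lead_coeff S" by (subst lead_coeff_comp) simp_all
  moreover have "lead_coeff (p \<circ>\<^sub>p [:0,-1:]) = lead_coeff p * (-1) ^ degree p" by (subst lead_coeff_comp) simp_all
  ultimately have "lead_coeff S = (-1) ^ degree p" using p by (simp only: mult_1)
  then show ?thesis unfolding S_def by (metis minus_one_power_iff)
qed

text \<open>Both \<open>\<phi>\<close> and \<open>- \<phi>\<close> may be roots of \<open>p\<close>,
  so \<open>\<phi>\<close> itself need not be a Pisot number. The Graeffe transform merges the two
  roots; \<open>\<epsilon>\<close> makes it monic.\<close>

lemma pisot_square:
  assumes \<phi>: "\<phi> > 1" and p: "lead_coeff p = 1" "ieval p \<phi> = 0"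
    and roots: "\<And>z::complex. ieval p z = 0 \<Longrightarrow> z = of_real \<phi> \<or> z = - of_real \<phi> \<or> cmod z < 1"
  shows "pisot (\<phi>\<^sup>2)"
proof -
  obtain a b where ab: "p = a \<circ>\<^sub>p [:0,0,1:] + [:0,1:] * (b \<circ>\<^sub>p [:0,0,1:])" using even_odd_parts by blast
  define S0 where "S0 = a * a - [:0,1:] * (b * b)"
  define \<epsilon> where "\<epsilon> = lead_coeff S0"
  have \<epsilon>: "\<epsilon> = 1 \<or> \<epsilon> = -1" using lead_coeff_even_odd[OF ab p(1)] by (simp add: \<epsilon>_def S0_def)
  define S where "S = Polynomial.smult \<epsilon> S0"
  have S: "lead_coeff S = 1" using \<epsilon> by (auto simp: S_def \<epsilon>_def)
  have "ieval S0 (\<phi>\<^sup>2) = 0" using ieval_even_odd[OF ab, of \<phi>] p by (simp add: S0_def)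
  then have "ieval S (\<phi>\<^sup>2) = 0" by (simp add: S_def hom_distribs)
  then obtain s where s: "irreducible s" "lead_coeff s = 1" "ieval s (\<phi>\<^sup>2) = 0" "s dvd S"
    using monic_irreducible_factor[OF S] by blast
  have "cmod y < 1" if y: "ieval s y = 0" "y \<noteq> complex_of_real (\<phi>\<^sup>2)" for y
  proof -
    obtain t where "S = s * t" using s by (auto simp: dvd_def)
    then have "ieval S y = 0" using y by (simp add: ieval_mult)
    then have "ieval S0 ((csqrt y)\<^sup>2) = 0" using \<epsilon> by (auto simp: S_def hom_distribs)
    then have "ieval p (csqrt y) * ieval p (- csqrt y) = 0"
      using ieval_even_odd[OF ab, of "csqrt y"] by (simp add: S0_def)
    then obtain w where w: "ieval p w = 0" "w\<^sup>2 = y" by (metis mult_eq_0_iff power2_csqrt power2_minus)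
    then have "cmod w < 1" using roots[of w] y by auto
    then show ?thesis using w by (metis norm_ge_zero norm_power power_less_one_iff zero_less_numeral)
  qed
  moreover have "\<phi>\<^sup>2 > 1" using \<phi> by (simp add: one_less_power)
  ultimately show ?thesis unfolding pisot_def using s by blast
qed

section \<open>The determinant of a core with infinite rays\<close>

lemma det_zero_iff_kernel:
  fixes M :: "'a :: field mat"
  assumes M: "M \<in> carrier_mat m m"
  shows "Determinant.det M = 0 \<longleftrightarrow>
    (\<exists>w :: nat \<Rightarrow> 'a. (\<exists>i<m. w i \<noteq> 0) \<and> (\<forall>i<m. (\<Sum>j<m. M $$ (i,j) * w j) = 0))"
  (is "_ \<longleftrightarrow> ?R")
proof -
  have mv: "(M *\<^sub>v v = 0\<^sub>v m) \<longleftrightarrow> (\<forall>i<m. (\<Sum>j<m. M $$ (i,j) * v $ j) = 0)" if "v \<in> carrier_vec m" for v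
    using M that by (auto simp: vec_eq_iff scalar_prod_def atLeast0LessThan)
  show ?thesis unfolding det_0_iff_vec_prod_zero_field[OF M]
  proof
    assume "\<exists>v. v \<in> carrier_vec m \<and> v \<noteq> 0\<^sub>v m \<and> M *\<^sub>v v = 0\<^sub>v m"
    then obtain v where v: "v \<in> carrier_vec m" "v \<noteq> 0\<^sub>v m" "M *\<^sub>v v = 0\<^sub>v m" by blast
    then show ?R using mv[OF v(1)] by (intro exI[of _ "\<lambda>i. v $ i"]) (auto simp: vec_eq_iff)
  next
    assume ?R
    then obtain w where w: "\<exists>i<m. w i \<noteq> 0" "\<forall>i<m. (\<Sum>j<m. M $$ (i,j) * w j) = 0" by blast
    have "vec m w \<in> carrier_vec m" by simp
    moreover have "vec m w \<noteq> 0\<^sub>v m" using w(1) by (auto simp: vec_eq_iff)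
    moreover have "M *\<^sub>v vec m w = 0\<^sub>v m" using mv[of "vec m w"] w(2) by simp
    ultimately show "\<exists>v. v \<in> carrier_vec m \<and> v \<noteq> 0\<^sub>v m \<and> M *\<^sub>v v = 0\<^sub>v m" by blast
  qed
qed

lemma ieval_hom: "comm_ring_hom (\<lambda>p. ieval p (z :: 'a :: comm_ring_1))"
  by unfold_locales (auto simp: hom_distribs)

lemma ieval_det: "ieval (Determinant.det M) z = Determinant.det (map_mat (\<lambda>p. ieval p z) M)"
  by (rule comm_ring_hom.hom_det[OF ieval_hom, symmetric])

lemma ieval_reflect_poly:
  fixes z :: "'a :: field_char_0"
  assumes "z \<noteq> 0"
  shows "ieval (reflect_poly P) z = z ^ degree P * ieval P (inverse z)"
proof -
  have "map_poly of_int (reflect_poly P) = (reflect_poly (map_poly of_int P) :: 'a poly)"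
    by (rule poly_eqI) (simp add: coeff_map_poly coeff_reflect_poly)
  then show ?thesis using poly_reflect_poly_nz[OF assms, of "map_poly of_int P"] by simp
qed

text \<open>Clears the denominators of \<open>T\<close> evaluated at \<open>y + 1 / y\<close>. A
  condition on \<open>y + 1 / y\<close> becomes an integer polynomial condition on \<open>y\<close>,
  which passes to the conjugates of \<open>y\<close>.\<close>

definition joukowsky :: "int poly \<Rightarrow> int poly" where
  "joukowsky T = (\<Sum>i\<le>degree T. Polynomial.smult (coeff T i) ([:1,0,1:] ^ i * [:0,1:] ^ (degree T - i)))"

lemma ieval_joukowsky:
  fixes y :: "'a :: field"
  assumes y: "y \<noteq> 0"
  shows "ieval (joukowsky T) y = y ^ degree T * poly (map_poly of_int T) (y + 1 / y)"
proof -
  have d: "degree (map_poly of_int T :: 'a poly) \<le> degree T" by (rule degree_map_poly_le)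
  have "poly (map_poly of_int T) (y + 1 / y) = (\<Sum>i\<le>degree T. of_int (coeff T i) * (y + 1 / y) ^ i)"
    unfolding poly_altdef using d
    by (subst sum.mono_neutral_left[of "{..degree T}"]) (auto simp: coeff_map_poly coeff_eq_0 not_le
       intro: le_degree) 
  moreover have "ieval (joukowsky T) y = (\<Sum>i\<le>degree T. of_int (coeff T i) * ((1 + y * y) ^ i * y ^ (degree T - i)))"
    unfolding joukowsky_def by (simp add: hom_distribs poly_sum)
  moreover have "(1 + y * y) ^ i * y ^ (degree T - i) = y ^ degree T * (y + 1 / y) ^ i" if "i \<le> degree T" for i
  proof -
    have "1 + y * y = y * (y + 1 / y)" using y by (simp add: field_simps)
    then have "(1 + y * y) ^ i * y ^ (degree T - i) = (y ^ i * y ^ (degree T - i)) * (y + 1 / y) ^ i"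
      by (simp add: power_mult_distrib mult_ac)
    also have "y ^ i * y ^ (degree T - i) = y ^ degree T" using that by (simp add: power_add[symmetric])
    finally show ?thesis .
  qed
  ultimately show ?thesis by (simp add: sum_distrib_left mult_ac)
qed

locale core =
  fixes m :: nat and A :: "(nat \<times> nat) set" and B :: "nat set"
  assumes A_sub: "A \<subseteq> {..<m} \<times> {..<m}" and A_sym: "(i, j) \<in> A \<Longrightarrow> (j, i) \<in> A" and B_sub: "B \<subseteq> {..<m}"
begin

definition nbr :: "(nat \<Rightarrow> 'a :: comm_monoid_add) \<Rightarrow> nat \<Rightarrow> 'a" where
  "nbr w i = (\<Sum>j<m. if (i, j) \<in> A then w j else 0)"

text \<open>\<open>z ((z + 1 / z) I - A - z D)\<close>, where \<open>D\<close> is the diagonal projection onto \<open>B\<close>: a geometric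
  sequence along an infinite ray contributes \<open>z\<close> at its foot.\<close>
definition core_mat :: "int poly mat" where
  "core_mat = mat m m (\<lambda>(i, j). (if i = j then (if i \<in> B then [:1:] else [:1, 0, 1:]) else 0)
     - (if (i, j) \<in> A then [:0, 1:] else 0))"

definition core_poly :: "int poly" where
  "core_poly = Determinant.det core_mat"

text \<open>The square of \<open>x I - A\<close> plus the projection onto \<open>B\<close>. For real
  \<open>x\<close> both summands are positive semidefinite, so the kernel of the sum is the
  intersection of their kernels, and two conditions become one determinant.\<close>

definition trap_mat :: "int poly mat" where
  "trap_mat = mat m m (\<lambda>(i, j).
     (\<Sum>k<m. ((if i = k then [:0, 1:] else 0) - (if (i, k) \<in> A then 1 else 0)) *
             ((if k = j then [:0, 1:] else 0) - (if (k, j) \<in> A then 1 else 0)))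
     + (if i = j \<and> i \<in> B then 1 else 0))"

text \<open>Vanishes at a real \<open>x\<close> iff the core has an eigenvector for \<open>x\<close> that vanishes on \<open>B\<close>.\<close>
definition trap_poly :: "int poly" where
  "trap_poly = Determinant.det trap_mat"

lemma core_mat_apply:
  fixes w :: "nat \<Rightarrow> 'a :: field"
  assumes i: "i < m"
  shows "(\<Sum>j<m. map_mat (\<lambda>p. ieval p z) core_mat $$ (i, j) * w j) =
    (1 + z\<^sup>2) * w i - z * nbr w i - (if i \<in> B then z\<^sup>2 * w i else 0)"
proof -
  have "(\<Sum>j<m. map_mat (\<lambda>p. ieval p z) core_mat $$ (i, j) * w j) =
     (\<Sum>j<m. (if i = j then ((1 + z\<^sup>2) * w i - (if i \<in> B then z\<^sup>2 * w i else 0)) else 0) - z * (if (i, j) \<in> A then w j else 0))"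
    using i by (intro sum.cong refl) (auto simp: core_mat_def hom_distribs power2_eq_square algebra_simps)
  then show ?thesis using i by (simp add: sum_subtractf sum_distrib_left[symmetric] nbr_def)
qed

lemma core_poly_root_iff:
  "ieval core_poly (z :: 'a :: field) = 0 \<longleftrightarrow>
    (\<exists>w :: nat \<Rightarrow> 'a. (\<exists>i<m. w i \<noteq> 0) \<and>
      (\<forall>i<m. (1 + z\<^sup>2) * w i - z * nbr w i - (if i \<in> B then z\<^sup>2 * w i else 0) = 0))"
  unfolding core_poly_def ieval_det
  by (subst det_zero_iff_kernel[of _ m]) (auto simp: core_mat_apply, auto simp: core_mat_def)

text \<open>At \<open>z = 0\<close> the matrix is the identity. The value 1 makes the reflected
  polynomial monic, so that its roots are algebraic integers, and excludes 0 as a root.\<close>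

lemma core_poly_0: "coeff core_poly 0 = 1"
proof -
  have "map_mat (\<lambda>p. ieval p (0::int)) core_mat = 1\<^sub>m m"
    by (rule eq_matI) (auto simp: core_mat_def hom_distribs)
  then have "ieval core_poly (0::int) = 1" unfolding core_poly_def ieval_det by simp
  then show ?thesis by (simp add: poly_0_coeff_0 map_poly_idI)
qed

lemma sum_nbr_sym:
  fixes u w :: "nat \<Rightarrow> 'a :: comm_ring_1"
  shows "(\<Sum>i<m. u i * nbr w i) = (\<Sum>i<m. nbr u i * w i)"
proof -
  have "(\<Sum>i<m. u i * nbr w i) = (\<Sum>i<m. \<Sum>j<m. if (i, j) \<in> A then u i * w j else 0)"
    unfolding nbr_def sum_distrib_left by (intro sum.cong refl) auto
  also have "\<dots> = (\<Sum>j<m. \<Sum>i<m. if (j, i) \<in> A then u i * w j else 0)"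
    by (subst sum.swap) (auto intro!: sum.cong dest: A_sym)
  also have "\<dots> = (\<Sum>i<m. nbr u i * w i)"
    unfolding nbr_def sum_distrib_right by (intro sum.cong refl) auto
  finally show ?thesis .
qed

text \<open>Pairing the kernel equation with the conjugate of \<open>w\<close> and taking imaginary parts.\<close>
lemma kernel_Im:
  fixes w :: "nat \<Rightarrow> complex"
  assumes z: "z \<noteq> 0" and w: "\<And>i. i < m \<Longrightarrow> (1 + z\<^sup>2) * w i - z * nbr w i - (if i \<in> B then z\<^sup>2 * w i else 0) = 0"
  shows "Im (z + 1 / z) * (\<Sum>i<m. (cmod (w i))\<^sup>2) = Im z * (\<Sum>i\<in>B. (cmod (w i))\<^sup>2)"
proof -
  have e: "(z + 1 / z) * w i = nbr w i + z * (if i \<in> B then w i else 0)" if "i < m" for i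
    using w[OF that] z by (auto simp: field_simps power2_eq_square split: if_splits)
  have c: "cnj x * x = of_real ((cmod x)\<^sup>2)" for x by (metis complex_norm_square mult.commute of_real_power)
  have "(\<Sum>i<m. cnj (w i) * ((z + 1 / z) * w i)) = (\<Sum>i<m. cnj (w i) * nbr w i) + (\<Sum>i<m. cnj (w i) * (z * (if i \<in> B then w i else 0)))"
    unfolding sum.distrib[symmetric] by (intro sum.cong refl) (simp add: e distrib_left)
  moreover have "(\<Sum>i<m. cnj (w i) * ((z + 1 / z) * w i)) = (z + 1 / z) * of_real (\<Sum>i<m. (cmod (w i))\<^sup>2)"
    unfolding of_real_sum sum_distrib_left by (intro sum.cong refl) (simp only: c[symmetric] mult_ac)
  moreover have "(\<Sum>i<m. cnj (w i) * (z * (if i \<in> B then w i else 0))) = z * of_real (\<Sum>i\<in>B. (cmod (w i))\<^sup>2)"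
  proof -
    have "(\<Sum>i<m. cnj (w i) * (z * (if i \<in> B then w i else 0))) = (\<Sum>i\<in>B. cnj (w i) * (z * w i))"
      using B_sub by (intro sum.mono_neutral_cong_right) auto
    also have "\<dots> = z * of_real (\<Sum>i\<in>B. (cmod (w i))\<^sup>2)"
      unfolding of_real_sum sum_distrib_left by (intro sum.cong refl) (simp only: c[symmetric] mult_ac)
    finally show ?thesis .
  qed
  moreover have "Im (\<Sum>i<m. cnj (w i) * nbr w i) = 0"
  proof -
    have "nbr (\<lambda>i. cnj (w i)) i = cnj (nbr w i)" for i
      unfolding nbr_def by (simp add: if_distrib cong: if_cong)
    then have "cnj (\<Sum>i<m. cnj (w i) * nbr w i) = (\<Sum>i<m. w i * nbr (\<lambda>i. cnj (w i)) i)" by simp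
    also have "\<dots> = (\<Sum>i<m. nbr w i * cnj (w i))" by (rule sum_nbr_sym)
    also have "\<dots> = (\<Sum>i<m. cnj (w i) * nbr w i)" by (simp add: mult.commute)
    finally show ?thesis by (metis add.inverse_inverse cnj.simps(2) equal_neg_zero)
  qed
  ultimately have "Im ((z + 1 / z) * of_real (\<Sum>i<m. (cmod (w i))\<^sup>2)) = Im (z * of_real (\<Sum>i\<in>B. (cmod (w i))\<^sup>2))"
    by simp
  then show ?thesis by (simp only: Im_complex_of_real Re_complex_of_real times_complex.sel mult_zero_right add_0)
qed

lemma sum_cmod_pos:
  fixes w :: "nat \<Rightarrow> complex"
  assumes "i < m" "w i \<noteq> 0"
  shows "(\<Sum>i<m. (cmod (w i))\<^sup>2) > 0"
proof -
  have "(cmod (w i))\<^sup>2 \<le> (\<Sum>i<m. (cmod (w i))\<^sup>2)" using assms by (intro member_le_sum) auto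
  moreover have "(cmod (w i))\<^sup>2 > 0" using assms by simp
  ultimately show ?thesis by linarith
qed

lemma Im_inverse_sum: "z \<noteq> 0 \<Longrightarrow> Im (z + 1 / z) = Im z * (1 - 1 / (cmod z)\<^sup>2)"
  by (simp add: Im_divide cmod_power2 algebra_simps)

text \<open>Inside the disc \<open>1 - 1 / (cmod z)\<^sup>2\<close> is negative. If
  \<open>Im z\<close> could be cancelled in \<open>kernel_Im\<close>, a negative multiple of the
  total mass of \<open>w\<close> would equal its mass on \<open>B\<close>.\<close>

lemma core_root_real:
  assumes z: "cmod z < 1" "ieval core_poly z = 0"
  shows "Im z = 0"
proof (rule ccontr)
  assume Im: "Im z \<noteq> 0"
  then have z0: "z \<noteq> 0" by auto
  obtain w :: "nat \<Rightarrow> complex" and i where w: "i < m" "w i \<noteq> 0"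
    "\<And>i. i < m \<Longrightarrow> (1 + z\<^sup>2) * w i - z * nbr w i - (if i \<in> B then z\<^sup>2 * w i else 0) = 0"
    using z(2) unfolding core_poly_root_iff by blast
  have "(1 - 1 / (cmod z)\<^sup>2) * (\<Sum>i<m. (cmod (w i))\<^sup>2) = (\<Sum>i\<in>B. (cmod (w i))\<^sup>2)"
    using kernel_Im[OF z0 w(3)] Im unfolding Im_inverse_sum[OF z0] by simp
  moreover have "1 - 1 / (cmod z)\<^sup>2 < 0" using z(1) z0 by (simp add: power_less_one_iff abs_square_less_1)
  then have "(1 - 1 / (cmod z)\<^sup>2) * (\<Sum>i<m. (cmod (w i))\<^sup>2) < 0"
    using sum_cmod_pos[of i w, OF w(1,2)] by (rule mult_neg_pos)
  moreover have "(\<Sum>i\<in>B. (cmod (w i))\<^sup>2) \<ge> 0" by (simp add: sum_nonneg)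
  ultimately show False by linarith
qed

lemma trap_mat_apply:
  fixes w :: "nat \<Rightarrow> 'a :: field"
  assumes i: "i < m"
  shows "(\<Sum>j<m. map_mat (\<lambda>p. ieval p x) trap_mat $$ (i, j) * w j) =
    (x * (x * w i - nbr w i) - nbr (\<lambda>k. x * w k - nbr w k) i) + (if i \<in> B then w i else 0)"
proof -
  let ?d = "\<lambda>i k. (if i = k then x else 0) - (if (i, k) \<in> A then 1 else 0)"
  have d: "(\<Sum>j<m. ?d k j * v j) = x * v k - nbr v k" if "k < m" for k and v :: "nat \<Rightarrow> 'a"
  proof -
    have "(\<Sum>j<m. ?d k j * v j) = (\<Sum>j<m. (if k = j then x * v j else 0) - (if (k, j) \<in> A then v j else 0))"
      by (intro sum.cong refl) (auto simp: algebra_simps)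
    then show ?thesis using that by (simp add: sum_subtractf nbr_def)
  qed
  have "(\<Sum>j<m. map_mat (\<lambda>p. ieval p x) trap_mat $$ (i, j) * w j) =
     (\<Sum>j<m. (\<Sum>k<m. ?d i k * (?d k j * w j)) + (if i = j then (if i \<in> B then w i else 0) else 0))"
  proof (intro sum.cong refl)
    fix j assume "j \<in> {..<m}"
    then have "map_mat (\<lambda>p. ieval p x) trap_mat $$ (i, j) = (\<Sum>k<m. ?d i k * ?d k j) + (if i = j \<and> i \<in> B then 1 else 0)"
      using i by (auto simp: trap_mat_def hom_distribs poly_sum intro!: sum.cong)
    then show "map_mat (\<lambda>p. ieval p x) trap_mat $$ (i, j) * w j =
        (\<Sum>k<m. ?d i k * (?d k j * w j)) + (if i = j then (if i \<in> B then w i else 0) else 0)"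
      by (simp only: distrib_right sum_distrib_right mult.assoc) (simp split: if_split)
  qed
  also have "\<dots> = (\<Sum>j<m. \<Sum>k<m. ?d i k * (?d k j * w j)) + (if i \<in> B then w i else 0)"
    using i by (simp add: sum.distrib)
  also have "(\<Sum>j<m. \<Sum>k<m. ?d i k * (?d k j * w j)) = (\<Sum>k<m. ?d i k * (\<Sum>j<m. ?d k j * w j))"
    by (subst sum.swap) (simp only: sum_distrib_left)
  also have "\<dots> = (\<Sum>k<m. ?d i k * (x * w k - nbr w k))"
    by (intro sum.cong refl arg_cong2[where f = "(*)"] d) auto
  also have "\<dots> = x * (x * w i - nbr w i) - nbr (\<lambda>k. x * w k - nbr w k) i" by (rule d[OF i])
  finally show ?thesis .
qed

lemma trap_poly_root:
  fixes w :: "nat \<Rightarrow> 'a :: field"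
  assumes "i < m" "w i \<noteq> 0" "\<And>i. i < m \<Longrightarrow> nbr w i = x * w i" "\<And>i. i \<in> B \<Longrightarrow> w i = 0"
  shows "ieval trap_poly x = 0"
proof -
  have "nbr (\<lambda>k. x * w k - nbr w k) i = 0" for i unfolding nbr_def using assms(3)
    by (intro sum.neutral) (auto simp: nbr_def[symmetric])
  then show ?thesis
    unfolding trap_poly_def ieval_det
    using assms by (subst det_zero_iff_kernel[of _ m], (simp add: trap_mat_def; fail))
      (intro exI[of _ w], auto simp: trap_mat_apply)
qed

lemma trap_poly_kernel:
  fixes x :: real
  assumes "ieval trap_poly x = 0"
  obtains w :: "nat \<Rightarrow> real" and i where "i < m" "w i \<noteq> 0"
    "\<And>i. i < m \<Longrightarrow> nbr w i = x * w i" "\<And>i. i \<in> B \<Longrightarrow> w i = 0"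
proof -
  have "Determinant.det (map_mat (\<lambda>p. ieval p x) trap_mat) = 0"
    using assms by (simp add: trap_poly_def ieval_det)
  then obtain w :: "nat \<Rightarrow> real" and i0 where w: "i0 < m" "w i0 \<noteq> 0"
    "\<And>i. i < m \<Longrightarrow> (\<Sum>j<m. map_mat (\<lambda>p. ieval p x) trap_mat $$ (i, j) * w j) = 0"
    by (subst (asm) det_zero_iff_kernel[of _ m]) (auto simp: trap_mat_def)
  define u where "u = (\<lambda>k. x * w k - nbr w k)"
  have e: "x * u i - nbr u i + (if i \<in> B then w i else 0) = 0" if "i < m" for i
    using w(3)[OF that] unfolding trap_mat_apply[OF that] u_def .
  \<comment> \<open>Pairing the kernel equation with \<open>w\<close> gives the sum of the squares
    of \<open>u\<close> plus the sum of the squares of \<open>w\<close> over \<open>B\<close>; over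
    the reals both must vanish.\<close>
  have "(\<Sum>i<m. w i * (x * u i - nbr u i + (if i \<in> B then w i else 0))) = 0"
    using e by (intro sum.neutral) auto
  moreover have "(\<Sum>i<m. w i * (x * u i - nbr u i + (if i \<in> B then w i else 0))) =
    (\<Sum>i<m. x * w i * u i) - (\<Sum>i<m. w i * nbr u i) + (\<Sum>i<m. if i \<in> B then w i * w i else 0)"
    unfolding sum_subtractf[symmetric] sum.distrib[symmetric] by (intro sum.cong refl) (auto simp: algebra_simps)
  moreover have "(\<Sum>i<m. x * w i * u i) - (\<Sum>i<m. w i * nbr u i) = (\<Sum>i<m. u i * u i)"
    unfolding sum_nbr_sym sum_subtractf[symmetric] by (intro sum.cong refl) (simp add: u_def algebra_simps)
  moreover have n1: "(\<Sum>i<m. u i * u i) \<ge> 0" "(\<Sum>i<m. if i \<in> B then w i * w i else 0) \<ge> 0"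
    by (auto intro!: sum_nonneg)
  ultimately have z: "(\<Sum>i<m. u i * u i) = 0" "(\<Sum>i<m. if i \<in> B then w i * w i else 0) = 0"
    by linarith+
  have "u i = 0" if "i < m" for i
    using z(1) that by (subst (asm) sum_nonneg_eq_0_iff) auto
  then have "nbr w i = x * w i" if "i < m" for i using that by (force simp: u_def)
  moreover have "w i = 0" if i: "i \<in> B" for i
  proof -
    have "\<forall>i\<in>{..<m}. (if i \<in> B then w i * w i else 0) = 0"
      using z(2) by (subst (asm) sum_nonneg_eq_0_iff) auto
    then have "(if i \<in> B then w i * w i else 0) = 0" using i B_sub by blast
    then show ?thesis using i by simp
  qed
  ultimately show thesis using that w by blast
qed

text \<open>On the unit circle \<open>z + 1 / z\<close> is real, so \<open>kernel_Im\<close> says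
  that \<open>Im z\<close> times the mass of \<open>w\<close> on \<open>B\<close> is zero. Then the
  rays contribute nothing and \<open>w\<close> is an eigenvector of the core.\<close>

lemma circle_root_trap:
  assumes z: "cmod z = 1" "Im z \<noteq> 0" and Q: "ieval core_poly z = 0"
  shows "ieval trap_poly (z + 1 / z) = 0"
proof -
  have z0: "z \<noteq> 0" using z by auto
  obtain w :: "nat \<Rightarrow> complex" and i where w: "i < m" "w i \<noteq> 0"
    "\<And>i. i < m \<Longrightarrow> (1 + z\<^sup>2) * w i - z * nbr w i - (if i \<in> B then z\<^sup>2 * w i else 0) = 0"
    using Q unfolding core_poly_root_iff by blast
  have "Im (z + 1 / z) = 0" using Im_inverse_sum[OF z0] z by simp
  then have "(\<Sum>i\<in>B. (cmod (w i))\<^sup>2) = 0" using kernel_Im[OF z0 w(3)] z(2) by simp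
  then have wB: "w i = 0" if "i \<in> B" for i
    using that B_sub finite_subset[OF B_sub] by (subst (asm) sum_nonneg_eq_0_iff) auto
  have "nbr w i = (z + 1 / z) * w i" if "i < m" for i
    using w(3)[OF that] wB[of i] z0 by (auto simp: field_simps power2_eq_square split: if_splits)
  then show ?thesis using trap_poly_root[of i w, OF w(1,2)] wB by blast
qed

text \<open>A conjugate of \<open>\<phi>\<close> on the unit circle would make \<open>\<phi> + 1 / \<phi>\<close> an eigenvalue of the core
  with an eigenvector vanishing at the feet of all rays.\<close>
lemma no_conjugate_on_circle:
  fixes \<phi> :: real and \<alpha> :: complex
  assumes \<phi>: "\<phi> > 1" and p: "irreducible p" "ieval p \<phi> = 0" "p dvd reflect_poly core_poly"
    and \<alpha>: "ieval p \<alpha> = 0" "cmod \<alpha> = 1"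
  shows "ieval trap_poly (\<phi> + 1 / \<phi>) = 0"
proof -
  have \<alpha>0: "\<alpha> \<noteq> 0" using \<alpha> by auto
  have dvd: "ieval T \<phi> = 0" if T: "ieval T \<alpha> = 0" for T
  proof -
    obtain q where "T = p * q" using irreducible_dvd_common_root[OF p(1) \<alpha>(1) T] by (auto simp: dvd_def)
    then show ?thesis using p by (simp add: ieval_mult)
  qed
  \<comment> \<open>At 1 and -1 the imaginary part vanishes and \<open>kernel_Im\<close> gives
    nothing, so these points are excluded first: their linear polynomials would vanish at
    \<open>\<phi>\<close> too.\<close>
  have "\<alpha> \<noteq> 1" using dvd[of "[:-1,1:]"] \<phi> by (auto simp: hom_distribs)
  moreover have "\<alpha> \<noteq> -1" using dvd[of "[:1,1:]"] \<phi> by (auto simp: hom_distribs)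
  ultimately have Im: "Im \<alpha> \<noteq> 0" using \<alpha>(2)
    by (metis Re_complex_of_real abs_eq_iff cmod_eq_Re complex_is_Real_iff of_real_1 of_real_Re of_real_minus abs_1)
  obtain r where "reflect_poly core_poly = p * r" using p(3) by (auto simp: dvd_def)
  then have "ieval (reflect_poly core_poly) \<alpha> = 0" using \<alpha> by (simp add: ieval_mult)
  then have "ieval core_poly (inverse \<alpha>) = 0"
    using ieval_reflect_poly[OF \<alpha>0] \<alpha>0 by simp
  moreover have "cmod (inverse \<alpha>) = 1" using \<alpha> by (simp add: norm_inverse)
  moreover have "Im (inverse \<alpha>) \<noteq> 0" using Im \<alpha>0 by (simp add: complex_eq_iff)
  ultimately have "ieval trap_poly (inverse \<alpha> + 1 / inverse \<alpha>) = 0" by (rule circle_root_trap[rotated 2])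
  then have "ieval trap_poly (\<alpha> + 1 / \<alpha>) = 0" by (simp add: inverse_eq_divide add.commute)
  then have "ieval (joukowsky trap_poly) \<alpha> = 0" using ieval_joukowsky[OF \<alpha>0] by simp
  then have "ieval (joukowsky trap_poly) \<phi> = 0" by (rule dvd)
  then show ?thesis using ieval_joukowsky[of \<phi> trap_poly] \<phi> by simp
qed

end

section \<open>Cores with long rays\<close>

lemma (in fgraph) rayed_sym:
  assumes "rayed V N m A B M \<rho>" "(i, j) \<in> A"
  shows "(j, i) \<in> A"
proof -
  note r = assms(1)[unfolded rayed_def]
  have A: "A \<subseteq> {..<m} \<times> {..<m}" using r by simp
  note V = r[THEN conjunct2, THEN conjunct2, THEN conjunct1, rule_format]
  note inj = r[THEN conjunct2, THEN conjunct2, THEN conjunct2, THEN conjunct2, THEN conjunct1, rule_format]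
  note N0 = r[THEN conjunct2, THEN conjunct2, THEN conjunct2, THEN conjunct2, THEN conjunct2, THEN conjunct1, rule_format]
  have ij: "i < m" "j < m" using A assms(2) by auto
  have "\<rho> j 0 \<in> N (\<rho> i 0)" unfolding N0[OF ij(1)] using assms(2) by blast
  then have "\<rho> i 0 \<in> N (\<rho> j 0)" using N_sym[OF V V] ij by blast
  then have "\<rho> i 0 \<in> (\<lambda>i'. \<rho> i' 0) ` {i'. (j, i') \<in> A} \<union> (if j \<in> B then {\<rho> j 1} else {})"
    unfolding N0[OF ij(2)] .
  then consider i' where "(j, i') \<in> A" "\<rho> i 0 = \<rho> i' 0" | "j \<in> B" "\<rho> i 0 = \<rho> j 1"
    by (auto split: if_splits)
  then show ?thesis
  proof cases
    case 1
    then have "i' < m" using A by auto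
    then have "i = i'" using inj[of i i' 0 0] ij 1 by blast
    then show ?thesis using 1 by simp
  next
    case 2
    then have "(0::nat) = 1" using inj[of i j 0 1] ij 2 by simp
    then show ?thesis by simp
  qed
qed

locale rayed_graph = spec_graph n N e \<mu> k0 lam + core m A B
  for n N e \<mu> k0 lam m A B +
  fixes M :: nat and \<rho> :: "nat \<Rightarrow> nat \<Rightarrow> nat"
  assumes rayed: "rayed {..<n} N m A B M \<rho>" and M1: "M \<ge> 1"
begin

lemma \<rho>0: "i < m \<Longrightarrow> \<rho> i 0 < n"
  using rayed[unfolded rayed_def, THEN conjunct2, THEN conjunct2, THEN conjunct1, rule_format] by blast

lemma \<rho>B: "i \<in> B \<Longrightarrow> j \<le> Suc M \<Longrightarrow> \<rho> i j < n"
  using rayed[unfolded rayed_def, THEN conjunct2, THEN conjunct2, THEN conjunct2, THEN conjunct1, rule_format] by blast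

lemmas N0 = rayed[unfolded rayed_def, THEN conjunct2, THEN conjunct2, THEN conjunct2, THEN conjunct2, THEN conjunct2, THEN conjunct1, rule_format]
lemmas NS = rayed[unfolded rayed_def, THEN conjunct2, THEN conjunct2, THEN conjunct2, THEN conjunct2, THEN conjunct2, THEN conjunct2, rule_format]

definition ok :: "nat \<Rightarrow> nat \<Rightarrow> bool" where
  "ok i j \<longleftrightarrow> i < m \<and> (j = 0 \<or> i \<in> B \<and> j \<le> Suc M)"

lemma \<rho>inj: "ok i j \<Longrightarrow> ok i' j' \<Longrightarrow> \<rho> i j = \<rho> i' j' \<longleftrightarrow> i = i' \<and> j = j'"
  using rayed[unfolded rayed_def, THEN conjunct2, THEN conjunct2, THEN conjunct2, THEN conjunct2, THEN conjunct1, rule_format, of i i' j j'] unfolding ok_def by blast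

lemma Bm: "i \<in> B \<Longrightarrow> i < m"
  using B_sub by auto

lemma finB: "finite B"
  using B_sub finite_subset by blast

text \<open>The kernel vector of the core with infinite rays, cut off after position
  \<open>M\<close>. Summing over index pairs transports it to the vertices without an inverse of
  \<open>\<rho>\<close>.\<close>

definition bump :: "(nat \<Rightarrow> real) \<Rightarrow> real \<Rightarrow> nat \<Rightarrow> real" where
  "bump w z v = (\<Sum>(i, j)\<in>{(i, j). i < m \<and> j \<le> M \<and> (j = 0 \<or> i \<in> B)}. if \<rho> i j = v then w i * z ^ j else 0)"

lemma bump_at:
  assumes "i < m" "j \<le> M" "j = 0 \<or> i \<in> B"
  shows "bump w z (\<rho> i j) = w i * z ^ j"
proof -
  let ?I = "{(i, j). i < m \<and> j \<le> M \<and> (j = 0 \<or> i \<in> B)}"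
  have fin: "finite ?I" by (rule finite_subset[of _ "{..<m} \<times> {..M}"]) auto
  have "bump w z (\<rho> i j) = (\<Sum>x\<in>?I. if x = (i, j) then w i * z ^ j else 0)"
    unfolding bump_def
  proof (intro sum.cong refl)
    fix x assume x: "x \<in> ?I"
    obtain i' j' where x': "x = (i', j')" by (cases x)
    have "\<rho> i' j' = \<rho> i j \<longleftrightarrow> i' = i \<and> j' = j"
      using x x' assms by (intro \<rho>inj) (auto simp: ok_def)
    then show "(case x of (i', j') \<Rightarrow> if \<rho> i' j' = \<rho> i j then w i' * z ^ j' else 0) =
        (if x = (i, j) then w i * z ^ j else 0)" using x' by simp
  qed
  then show ?thesis using assms fin by simp
qed

lemma bump_nz:
  assumes "bump w z v \<noteq> 0"
  obtains i j where "i < m" "j \<le> M" "j = 0 \<or> i \<in> B" "v = \<rho> i j"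
proof -
  have "\<exists>x\<in>{(i, j). i < m \<and> j \<le> M \<and> (j = 0 \<or> i \<in> B)}. (case x of (i, j) \<Rightarrow> if \<rho> i j = v then w i * z ^ j else 0) \<noteq> 0"
    using assms unfolding bump_def by (meson sum.neutral)
  then show thesis using that by (auto split: if_splits)
qed

lemma bump_end: "i \<in> B \<Longrightarrow> bump w z (\<rho> i (Suc M)) = 0"
proof (rule ccontr)
  assume i: "i \<in> B" "bump w z (\<rho> i (Suc M)) \<noteq> 0"
  obtain i' j' where x: "i' < m" "j' \<le> M" "j' = 0 \<or> i' \<in> B" "\<rho> i (Suc M) = \<rho> i' j'"
    using bump_nz[OF i(2)] by metis
  then have "Suc M = j'" using \<rho>inj[of i "Suc M" i' j'] i Bm by (auto simp: ok_def)
  then show False using x by simp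
qed

lemma adj_core:
  assumes i: "i < m"
  shows "adj F (\<rho> i 0) = nbr (\<lambda>j. F (\<rho> j 0)) i + (if i \<in> B then F (\<rho> i 1) else 0)"
proof -
  let ?A = "{j. (i, j) \<in> A}"
  have Am: "j < m" if "(i, j) \<in> A" for j using A_sub that by auto
  have inj: "inj_on (\<lambda>j. \<rho> j 0) ?A"
  proof (rule inj_onI)
    fix x y assume "x \<in> ?A" "y \<in> ?A" "\<rho> x 0 = \<rho> y 0"
    then show "x = y" using \<rho>inj[of x 0 y 0] Am by (simp add: ok_def)
  qed
  have eq: "{j \<in> {..<m}. (i, j) \<in> A} = ?A" using Am by blast
  have fin: "finite ?A" unfolding eq[symmetric] by simp
  have s: "(\<Sum>u\<in>(\<lambda>j. \<rho> j 0) ` ?A. F u) = nbr (\<lambda>j. F (\<rho> j 0)) i"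
    unfolding nbr_def sum.reindex[OF inj] o_def by (simp only: eq[symmetric] sum.inter_filter finite_lessThan)
  have "\<rho> i 1 \<notin> (\<lambda>j. \<rho> j 0) ` ?A" if "i \<in> B"
  proof
    assume "\<rho> i 1 \<in> (\<lambda>j. \<rho> j 0) ` ?A"
    then obtain j where "(i, j) \<in> A" "\<rho> i 1 = \<rho> j 0" by auto
    then show False using \<rho>inj[of i 1 j 0] Am i that by (simp add: ok_def)
  qed
  then show ?thesis unfolding adj_def N0[OF i] using fin s by (simp add: add.commute)
qed

lemma nbr_cong: "(\<And>j. j < m \<Longrightarrow> u j = w j) \<Longrightarrow> nbr u i = nbr w i"
  unfolding nbr_def by (intro sum.cong) auto

text \<open>The eigenvalue equation is exact except where a ray is cut: at \<open>\<rho> i M\<close>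
  the term \<open>w i * z ^ Suc M\<close> is missing, and at \<open>\<rho> i (Suc M)\<close> the
  term \<open>w i * z ^ M\<close> is not balanced. No other vertex outside the rays and the core
  meets the support, because \<open>rayed\<close> prescribes the neighbourhoods of all vertices in
  it.\<close>

lemma bump_error:
  assumes z: "z \<noteq> 0" "\<bar>z\<bar> \<le> 1" and v: "v < n"
    and w: "\<And>i. i < m \<Longrightarrow> (1 + z\<^sup>2) * w i - z * nbr w i - (if i \<in> B then z\<^sup>2 * w i else 0) = 0"
  shows "(adj (bump w z) v - (z + 1 / z) * bump w z v)\<^sup>2 \<le>
    (\<Sum>i\<in>B. if v = \<rho> i M \<or> v = \<rho> i (Suc M) then (w i)\<^sup>2 * z ^ (2 * M) else 0)" (is "?e\<^sup>2 \<le> ?R")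
proof -
  let ?g = "bump w z" and ?x = "z + 1 / z"
  have R0: "?R \<ge> 0" by (intro sum_nonneg) (auto simp: zero_le_even_power)
  have Ri: "(w i)\<^sup>2 * z ^ (2 * M) \<le> ?R" if "i \<in> B" "v = \<rho> i M \<or> v = \<rho> i (Suc M)" for i
  proof -
    have "(if v = \<rho> i M \<or> v = \<rho> i (Suc M) then (w i)\<^sup>2 * z ^ (2 * M) else 0) \<le> ?R"
      using that(1) finB by (intro member_le_sum) (auto simp: zero_le_even_power)
    then show ?thesis using that by simp
  qed
  consider (a) i where "i < m" "v = \<rho> i 0" | (b) i j where "i \<in> B" "j < M" "v = \<rho> i (Suc j)"
    | (c) i where "i \<in> B" "v = \<rho> i (Suc M)"
    | (d) "\<And>i. i < m \<Longrightarrow> v \<noteq> \<rho> i 0" "\<And>i j. i \<in> B \<Longrightarrow> j < M \<Longrightarrow> v \<noteq> \<rho> i (Suc j)" "\<And>i. i \<in> B \<Longrightarrow> v \<noteq> \<rho> i (Suc M)"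
    by blast
  then show ?thesis
  proof cases
    case (a i)
    have "nbr (\<lambda>j. ?g (\<rho> j 0)) i = nbr w i" by (rule nbr_cong) (simp add: bump_at)
    then have s2: "adj ?g v = nbr w i + (if i \<in> B then z * w i else 0)"
      using adj_core[OF a(1), of ?g] bump_at[OF a(1) M1, of w z] a(2) by simp
    have "?g v = w i" using bump_at[OF a(1), of 0] a(2) by simp
    then have "?e = 0" using s2 w[OF a(1)] z(1) by (auto simp: field_simps power2_eq_square split: if_splits)
    then show ?thesis using R0 by simp
  next
    case (b i j)
    have im: "i < m" using b Bm by simp
    have ne: "\<rho> i j \<noteq> \<rho> i (Suc (Suc j))" using \<rho>inj[of i j i "Suc (Suc j)"] b im by (auto simp: ok_def)
    have a: "adj ?g v = ?g (\<rho> i j) + ?g (\<rho> i (Suc (Suc j)))"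
      unfolding adj_def b(3) NS[OF b(1,2)] using ne by simp
    have g1: "?g (\<rho> i j) = w i * z ^ j" "?g v = w i * z ^ Suc j"
      using bump_at[OF im, of j w z] bump_at[OF im, of "Suc j" w z] b by auto
    show ?thesis
    proof (cases "Suc (Suc j) \<le> M")
      case True
      then have "?g (\<rho> i (Suc (Suc j))) = w i * z ^ Suc (Suc j)" using bump_at[OF im] b by blast
      then have "?e = 0" using a g1 z(1) by (simp add: field_simps)
      then show ?thesis using R0 by simp
    next
      case False
      then have j: "M = Suc j" using b by simp
      have "?g (\<rho> i (Suc (Suc j))) = 0" using bump_end[OF b(1)] j by simp
      then have "?e = - (w i * z ^ Suc M)" using a g1 z(1) j by (simp add: field_simps)
      then have "?e\<^sup>2 = ((w i)\<^sup>2 * z ^ (2 * M)) * z\<^sup>2" by (simp add: power_mult_distrib power_mult mult_ac power2_eq_square power_mult[symmetric] power_add[symmetric] mult_2)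
      also have "\<dots> \<le> (w i)\<^sup>2 * z ^ (2 * M)"
        using z(2) by (intro mult_right_le_one_le) (auto simp: zero_le_even_power abs_square_le_1)
      also have "\<dots> \<le> ?R" using b j by (intro Ri) auto
      finally show ?thesis .
    qed
  next
    case (c i)
    have im: "i < m" using c Bm by simp
    obtain M' where M': "M = Suc M'" using M1 by (cases M) auto
    have "v \<in> N (\<rho> i M)" using NS[OF c(1), of M'] M' c by simp
    then have mem: "\<rho> i M \<in> N v" using N_sym[of v "\<rho> i M"] v \<rho>B[OF c(1), of M] by simp
    have "?g u = 0" if u: "u \<in> N v" "u \<noteq> \<rho> i M" for u
    proof (rule ccontr)
      assume "?g u \<noteq> 0"
      then obtain i' j' where x: "i' < m" "j' \<le> M" "j' = 0 \<or> i' \<in> B" "u = \<rho> i' j'" using bump_nz by metis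
      have un: "u < n" using u N_sub[of v] v by auto
      have vN: "v \<in> N u" using N_sym[of u v] u un v by simp
      have okc: "ok i (Suc M)" using c im by (simp add: ok_def)
      show False
      proof (cases j')
        case 0
        then have "v \<in> (\<lambda>i'. \<rho> i' 0) ` {i''. (i', i'') \<in> A} \<union> (if i' \<in> B then {\<rho> i' 1} else {})"
          using vN x N0 by auto
        then consider i'' where "(i', i'') \<in> A" "\<rho> i (Suc M) = \<rho> i'' 0" | "i' \<in> B" "\<rho> i (Suc M) = \<rho> i' 1"
          using c by (auto split: if_splits)
        then show False
        proof cases
          case 1 then show False using \<rho>inj[OF okc, of i'' 0] A_sub by (auto simp: ok_def)
        next
          case 2 then show False using \<rho>inj[OF okc, of i' 1] x M1 by (auto simp: ok_def)
        qed
      next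
        case (Suc j)
        then have i'B: "i' \<in> B" using x by simp
        then have "v = \<rho> i' j \<or> v = \<rho> i' (Suc (Suc j))" using vN x NS[of i' j] Suc by auto
        then have "(i = i' \<and> Suc M = j) \<or> (i = i' \<and> Suc M = Suc (Suc j))"
          using \<rho>inj[OF okc, of i' j] \<rho>inj[OF okc, of i' "Suc (Suc j)"] x Suc i'B c(2) by (auto simp: ok_def)
        then show False using x Suc u by auto
      qed
    qed
    then have "adj ?g v = (\<Sum>u\<in>{\<rho> i M}. ?g u)" unfolding adj_def
      using mem v by (intro sum.mono_neutral_right) auto
    then have "adj ?g v = w i * z ^ M" using bump_at[OF im, of M w z] c by simp
    moreover have "?g v = 0" using bump_end c by simp
    ultimately have "?e\<^sup>2 = (w i)\<^sup>2 * z ^ (2 * M)" by (simp add: power_mult_distrib power_mult[symmetric] mult.commute)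
    then show ?thesis using Ri[OF c(1)] c by simp
  next
    case d
    have inim: "v \<noteq> \<rho> i j" if "ok i j" for i j
      using that d by (cases j) (auto simp: ok_def le_Suc_eq Suc_le_eq)
    have "?g u = 0" if u: "u \<in> N v" for u
    proof (rule ccontr)
      assume "?g u \<noteq> 0"
      then obtain i' j' where x: "i' < m" "j' \<le> M" "j' = 0 \<or> i' \<in> B" "u = \<rho> i' j'" using bump_nz by metis
      have un: "u < n" using u N_sub[of v] v by auto
      have vN: "v \<in> N u" using N_sym[of u v] u un v by simp
      show False
      proof (cases j')
        case 0
        then have "v \<in> (\<lambda>i'. \<rho> i' 0) ` {i''. (i', i'') \<in> A} \<union> (if i' \<in> B then {\<rho> i' 1} else {})"
          using vN x N0 by auto
        then consider i'' where "(i', i'') \<in> A" "v = \<rho> i'' 0" | "i' \<in> B" "v = \<rho> i' 1"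
          by (auto split: if_splits)
        then show False
        proof cases
          case 1 then show False using inim[of i'' 0] A_sub by (auto simp: ok_def)
        next
          case 2 then show False using inim[of i' 1] x by (auto simp: ok_def)
        qed
      next
        case (Suc j)
        then have i'B: "i' \<in> B" using x by simp
        then have "v = \<rho> i' j \<or> v = \<rho> i' (Suc (Suc j))" using vN x NS[of i' j] Suc by auto
        then show False using inim[of i' j] inim[of i' "Suc (Suc j)"] x Suc i'B by (auto simp: ok_def)
      qed
    qed
    then have "adj ?g v = 0" unfolding adj_def by (intro sum.neutral) auto
    moreover have "?g v = 0"
    proof (rule ccontr)
      assume "?g v \<noteq> 0"
      then obtain i' j' where x: "i' < m" "j' \<le> M" "j' = 0 \<or> i' \<in> B" "v = \<rho> i' j'" using bump_nz by metis
      then show False using inim[of i' j'] by (auto simp: ok_def)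
    qed
    ultimately show ?thesis using R0 by simp
  qed
qed

lemma bump_total_error:
  assumes z: "z \<noteq> 0" "\<bar>z\<bar> \<le> 1"
    and w: "\<And>i. i < m \<Longrightarrow> (1 + z\<^sup>2) * w i - z * nbr w i - (if i \<in> B then z\<^sup>2 * w i else 0) = 0"
  shows "(\<Sum>v<n. (adj (bump w z) v - (z + 1 / z) * bump w z v)\<^sup>2) \<le> 2 * z ^ (2 * M) * (\<Sum>i\<in>B. (w i)\<^sup>2)"
proof -
  have "(\<Sum>v<n. (adj (bump w z) v - (z + 1 / z) * bump w z v)\<^sup>2) \<le>
    (\<Sum>v<n. \<Sum>i\<in>B. if v = \<rho> i M \<or> v = \<rho> i (Suc M) then (w i)\<^sup>2 * z ^ (2 * M) else 0)"
    using bump_error[OF z _ w] by (intro sum_mono) auto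
  also have "\<dots> = (\<Sum>i\<in>B. \<Sum>v<n. if v = \<rho> i M \<or> v = \<rho> i (Suc M) then (w i)\<^sup>2 * z ^ (2 * M) else 0)"
    by (rule sum.swap)
  also have "\<dots> \<le> (\<Sum>i\<in>B. 2 * z ^ (2 * M) * (w i)\<^sup>2)"
  proof (intro sum_mono)
    fix i assume i: "i \<in> B"
    have nn: "(w i)\<^sup>2 * z ^ (2 * M) \<ge> 0" by (simp add: zero_le_even_power)
    have "(\<Sum>v<n. if v = \<rho> i M \<or> v = \<rho> i (Suc M) then (w i)\<^sup>2 * z ^ (2 * M) else 0)
      \<le> (\<Sum>v<n. (if v = \<rho> i M then (w i)\<^sup>2 * z ^ (2 * M) else 0) + (if v = \<rho> i (Suc M) then (w i)\<^sup>2 * z ^ (2 * M) else 0))"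
      using nn by (intro sum_mono) auto
    also have "\<dots> = 2 * z ^ (2 * M) * (w i)\<^sup>2"
      using \<rho>B[OF i, of M] \<rho>B[OF i, of "Suc M"] by (simp add: sum.distrib)
    finally show "(\<Sum>v<n. if v = \<rho> i M \<or> v = \<rho> i (Suc M) then (w i)\<^sup>2 * z ^ (2 * M) else 0)
      \<le> 2 * z ^ (2 * M) * (w i)\<^sup>2" .
  qed
  finally show ?thesis by (simp add: sum_distrib_left)
qed

lemma sum_core: "(\<Sum>v\<in>(\<lambda>i. \<rho> i 0) ` {..<m}. F v) = (\<Sum>i<m. F (\<rho> i 0))"
  using \<rho>inj by (subst sum.reindex) (auto intro!: inj_onI simp: ok_def)

lemma bump_norm: "(\<Sum>i<m. (w i)\<^sup>2) \<le> ip (bump w z) (bump w z)"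
proof -
  have "(\<Sum>i<m. (w i)\<^sup>2) = (\<Sum>i<m. bump w z (\<rho> i 0) * bump w z (\<rho> i 0))"
    by (intro sum.cong refl) (simp add: bump_at power2_eq_square)
  also have "\<dots> = (\<Sum>v\<in>(\<lambda>i. \<rho> i 0) ` {..<m}. bump w z v * bump w z v)" by (simp add: sum_core)
  also have "\<dots> \<le> ip (bump w z) (bump w z)" unfolding ip_def
    using \<rho>0 by (intro sum_mono2) auto
  finally show ?thesis .
qed

lemma sumsq_pos: "i < m \<Longrightarrow> w i \<noteq> 0 \<Longrightarrow> (\<Sum>i<m. (w i :: real)\<^sup>2) > 0"
  by (rule sum_pos2) auto

lemma near_eigenvalue:
  assumes z: "z \<noteq> 0" "\<bar>z\<bar> \<le> 1" and i0: "i0 < m" "w i0 \<noteq> 0"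
    and w: "\<And>i. i < m \<Longrightarrow> (1 + z\<^sup>2) * w i - z * nbr w i - (if i \<in> B then z\<^sup>2 * w i else 0) = 0"
    and d: "\<delta> > 0" "2 * z ^ (2 * M) < \<delta>\<^sup>2"
  shows "\<exists>l<n. \<bar>\<mu> l - (z + 1 / z)\<bar> < \<delta>"
proof (rule ccontr)
  assume no: "\<not> ?thesis"
  have "\<delta> \<le> \<bar>\<mu> l - (z + 1 / z)\<bar>" if "l < n" for l using no that by (meson not_less)
  then have "\<delta>\<^sup>2 * ip (bump w z) (bump w z) \<le> (\<Sum>v<n. (adj (bump w z) v - (z + 1 / z) * bump w z v)\<^sup>2)"
    using d by (intro quasimode) auto
  also have "\<dots> \<le> 2 * z ^ (2 * M) * (\<Sum>i\<in>B. (w i)\<^sup>2)" by (rule bump_total_error[OF z w])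
  also have "\<dots> \<le> 2 * z ^ (2 * M) * (\<Sum>i<m. (w i)\<^sup>2)"
    using B_sub by (intro mult_left_mono sum_mono2) (auto simp: zero_le_even_power)
  also have "\<dots> < \<delta>\<^sup>2 * (\<Sum>i<m. (w i)\<^sup>2)"
    using d sumsq_pos[of i0 w, OF i0] by (intro mult_strict_right_mono) auto
  also have "\<dots> \<le> \<delta>\<^sup>2 * ip (bump w z) (bump w z)" using bump_norm by (intro mult_left_mono) auto
  finally show False by simp
qed

text \<open>As \<open>w\<close> vanishes on \<open>B\<close>, its extension is zero along the rays
  and nothing is lost by cutting them. With error 0, the least distance \<open>\<delta>\<close> from
  \<open>z + 1 / z\<close> to the spectrum cannot be positive.\<close>

lemma exact_eigenvalue:
  assumes z: "z \<noteq> 0" "\<bar>z\<bar> \<le> 1" and i0: "i0 < m" "w i0 \<noteq> 0"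
    and w: "\<And>i. i < m \<Longrightarrow> nbr w i = (z + 1 / z) * w i" "\<And>i. i \<in> B \<Longrightarrow> w i = 0"
  shows "\<exists>l<n. \<mu> l = z + 1 / z"
proof (rule ccontr)
  assume no: "\<not> ?thesis"
  define \<delta> where "\<delta> = Min ((\<lambda>l. \<bar>\<mu> l - (z + 1 / z)\<bar>) ` {..<n})"
  have ne: "(\<lambda>l. \<bar>\<mu> l - (z + 1 / z)\<bar>) ` {..<n} \<noteq> {}" using k0(1) by auto
  have \<delta>: "\<delta> > 0" unfolding \<delta>_def using ne no by (subst Min_gr_iff) auto
  have k: "(1 + z\<^sup>2) * w i - z * nbr w i - (if i \<in> B then z\<^sup>2 * w i else 0) = 0" if "i < m" for i
    using w(1)[OF that] w(2)[of i] z by (auto simp: field_simps power2_eq_square)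
  have "\<delta>\<^sup>2 * ip (bump w z) (bump w z) \<le> (\<Sum>v<n. (adj (bump w z) v - (z + 1 / z) * bump w z v)\<^sup>2)"
    using \<delta> by (intro quasimode) (auto simp: \<delta>_def)
  also have "\<dots> \<le> 2 * z ^ (2 * M) * (\<Sum>i\<in>B. (w i)\<^sup>2)" by (rule bump_total_error[OF z k])
  also have "\<dots> = 0" using w(2) by simp
  finally have "\<delta>\<^sup>2 * ip (bump w z) (bump w z) \<le> 0" .
  moreover have "ip (bump w z) (bump w z) > 0" using bump_norm[of w z] sumsq_pos[of i0 w, OF i0] by linarith
  then have "\<delta>\<^sup>2 * ip (bump w z) (bump w z) > 0" using \<delta> by simp
  ultimately show False by linarith
qed

lemma unit_le_1:
  assumes "ip f f = 1" "v < n"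
  shows "\<bar>f v\<bar> \<le> 1"
proof -
  have "f v * f v \<le> ip f f" unfolding ip_def using assms by (intro member_le_sum) auto
  then show ?thesis using assms by (simp add: abs_square_le_1 power2_eq_square[symmetric])
qed

text \<open>Along a ray an eigenvector satisfies a linear recurrence; boundedness at the far end
  makes the growing solution negligible at the foot.\<close>
lemma eigenvector_ray:
  assumes f: "ip f f = 1" "\<And>v. v < n \<Longrightarrow> adj f v = lam * f v"
    and \<zeta>: "0 < \<zeta>" "\<zeta> < 1" "lam = \<zeta> + 1 / \<zeta>" and i: "i \<in> B"
  shows "\<bar>f (\<rho> i 1) - \<zeta> * f (\<rho> i 0)\<bar> \<le> 2 * \<zeta> ^ M"
proof -
  \<comment> \<open>The difference removes the solution \<open>\<zeta> ^ j\<close> of the recurrence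
    and leaves the growing one, which is multiplied by \<open>1 / \<zeta>\<close> at each
    step.\<close>
  define h where "h = (\<lambda>j. f (\<rho> i (Suc j)) - \<zeta> * f (\<rho> i j))"
  have im: "i < m" using i Bm by simp
  have step: "h j = \<zeta> * h (Suc j)" if j: "j < M" for j
  proof -
    have ne: "\<rho> i j \<noteq> \<rho> i (Suc (Suc j))" using \<rho>inj[of i j i "Suc (Suc j)"] j i im by (auto simp: ok_def)
    have "adj f (\<rho> i (Suc j)) = f (\<rho> i j) + f (\<rho> i (Suc (Suc j)))"
      unfolding adj_def NS[OF i j] using ne by simp
    then have "lam * f (\<rho> i (Suc j)) = f (\<rho> i j) + f (\<rho> i (Suc (Suc j)))"
      using f(2)[of "\<rho> i (Suc j)"] \<rho>B[OF i, of "Suc j"] j by simp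
    then show ?thesis using \<zeta> unfolding h_def by (simp add: field_simps)
  qed
  have "h 0 = \<zeta> ^ j * h j" if "j \<le> M" for j
    using that by (induction j) (auto simp: step)
  then have "h 0 = \<zeta> ^ M * h M" by simp
  moreover have "\<bar>h M\<bar> \<le> 2"
  proof -
    have "\<bar>f (\<rho> i (Suc M))\<bar> \<le> 1" "\<bar>f (\<rho> i M)\<bar> \<le> 1"
      using unit_le_1[OF f(1)] \<rho>B[OF i] by auto
    moreover then have "\<bar>\<zeta> * f (\<rho> i M)\<bar> \<le> 1" using \<zeta> by (simp add: abs_mult mult_le_one)
    ultimately show ?thesis unfolding h_def by linarith
  qed
  ultimately have "\<bar>h 0\<bar> \<le> \<zeta> ^ M * 2" using \<zeta> by (simp add: abs_mult)
  then show ?thesis by (simp add: h_def mult.commute)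
qed

text \<open>Off the core the form is nonpositive, so the outer part of an eigenvector is sustained
  only through the edges leaving the core: \<open>(lam - 2) * ip fo fo \<le> ip fo (adj fC)\<close>.
  The constant depends on \<open>m\<close> and \<open>\<epsilon>\<close> alone, hence is uniform
  along a sequence.\<close>

lemma eigenvector_core_mass:
  assumes f: "ip f f = 1" "\<And>v. v < n \<Longrightarrow> adj f v = lam * f v"
    and cold: "\<And>g. (\<And>i. i < m \<Longrightarrow> g (\<rho> i 0) = 0) \<Longrightarrow> qf g \<le> 0"
    and \<epsilon>: "\<epsilon> > 0" "lam \<ge> 2 + \<epsilon>"
  shows "\<exists>i<m. \<bar>f (\<rho> i 0)\<bar> \<ge> 1 / (real (m + 1) * (1 + 1 / \<epsilon>))"
proof (rule ccontr)
  define \<delta> where "\<delta> = 1 / (real (m + 1) * (1 + 1 / \<epsilon>))"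
  assume "\<not> ?thesis"
  then have small: "\<bar>f (\<rho> i 0)\<bar> < \<delta>" if "i < m" for i using that by (auto simp: \<delta>_def not_le)
  have e1: "1 + 1 / \<epsilon> \<ge> 1" using \<epsilon> by simp
  have "real (m + 1) * (1 + 1 / \<epsilon>) \<ge> 1 * 1" using e1 by (intro mult_mono) auto
  then have \<delta>: "0 < \<delta>" "\<delta> \<le> 1" unfolding \<delta>_def using e1 by (auto simp: divide_le_eq)
  let ?C = "(\<lambda>i. \<rho> i 0) ` {..<m}"
  define fC where "fC = (\<lambda>v. if v \<in> ?C then f v else 0)"
  define fo where "fo = (\<lambda>v. if v \<in> ?C then 0 else f v)"
  have C: "?C \<subseteq> {..<n}" using \<rho>0 by auto
  have CC: "ip fC h = (\<Sum>i<m. f (\<rho> i 0) * h (\<rho> i 0))" for h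
  proof -
    have "ip fC h = (\<Sum>v\<in>?C. f v * h v)" unfolding ip_def fC_def
      using C by (intro sum.mono_neutral_cong_right) auto
    then show ?thesis by (simp add: sum_core)
  qed
  have add: "f v = fC v + fo v" for v by (simp add: fC_def fo_def)
  have fof: "ip fo f = ip fo fo" unfolding ip_def fo_def by (intro sum.cong) auto
  have tot: "ip fC fC + ip fo fo = 1"
    unfolding f(1)[symmetric] ip_def sum.distrib[symmetric] by (intro sum.cong) (auto simp: fC_def fo_def)
  have "qf fo \<le> 0" by (rule cold) (auto simp: fo_def)
  then have q: "ip fo (adj fo) \<le> 2 * ip fo fo" by (simp add: qf_def)
  have "ip fo (adj f) = ip fo (adj fC) + ip fo (adj fo)"
  proof -
    have "adj f = (\<lambda>v. adj fC v + adj fo v)" using adj_add[of fC fo] add by presburger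
    then show ?thesis by (simp add: ip_add_right)
  qed
  moreover have "ip fo (adj f) = lam * ip fo f"
    unfolding ip_def sum_distrib_left using f(2) by (intro sum.cong) auto
  ultimately have "(lam - 2) * ip fo fo \<le> ip fo (adj fC)" using q fof by (simp add: algebra_simps)
  also have "ip fo (adj fC) = (\<Sum>i<m. f (\<rho> i 0) * adj fo (\<rho> i 0))"
    by (metis CC adj_sym ip_commute)
  also have "\<dots> \<le> (\<Sum>i<m. \<delta>)"
  proof (intro sum_mono)
    fix i assume "i \<in> {..<m}"
    then have i: "i < m" by simp
    have "\<bar>adj fo (\<rho> i 0)\<bar> \<le> 1"
    proof -
      have "nbr (\<lambda>j. fo (\<rho> j 0)) i = 0" unfolding nbr_def by (intro sum.neutral) (auto simp: fo_def)
      then have "adj fo (\<rho> i 0) = (if i \<in> B then fo (\<rho> i 1) else 0)" using adj_core[OF i, of fo] by simp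
      moreover have "\<bar>fo (\<rho> i 1)\<bar> \<le> \<bar>f (\<rho> i 1)\<bar>" by (simp add: fo_def)
      ultimately show ?thesis using unit_le_1[OF f(1), of "\<rho> i 1"] \<rho>B[of i 1] by auto
    qed
    then have "\<bar>f (\<rho> i 0)\<bar> * \<bar>adj fo (\<rho> i 0)\<bar> \<le> \<delta> * 1"
      using small[OF i] \<delta> by (intro mult_mono) auto
    then show "f (\<rho> i 0) * adj fo (\<rho> i 0) \<le> \<delta>" by (metis abs_le_D1 abs_mult mult.right_neutral)
  qed
  finally have 1: "(lam - 2) * ip fo fo \<le> m * \<delta>" by simp
  have "\<epsilon> * ip fo fo \<le> (lam - 2) * ip fo fo" using \<epsilon> ip_nonneg by (intro mult_right_mono) auto
  then have 2: "ip fo fo \<le> m * \<delta> / \<epsilon>" using 1 \<epsilon> by (simp add: field_simps)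
  have "ip fC fC = (\<Sum>i<m. f (\<rho> i 0) * f (\<rho> i 0))" unfolding CC by (intro sum.cong) (auto simp: fC_def)
  also have "\<dots> \<le> (\<Sum>i<m. \<delta>)"
  proof (intro sum_mono)
    fix i assume "i \<in> {..<m}"
    then have "\<bar>f (\<rho> i 0)\<bar> * \<bar>f (\<rho> i 0)\<bar> \<le> \<delta> * 1" using small[of i] \<delta> by (intro mult_mono) auto
    then show "f (\<rho> i 0) * f (\<rho> i 0) \<le> \<delta>" by simp
  qed
  finally have "1 \<le> m * \<delta> + m * \<delta> / \<epsilon>" using tot 2 by simp
  also have "\<dots> = \<delta> * (m * (1 + 1 / \<epsilon>))" using \<epsilon> by (simp add: field_simps)
  also have "\<dots> < \<delta> * (real (m + 1) * (1 + 1 / \<epsilon>))"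
  proof -
    have "0 < 1 + 1 / \<epsilon>" using e1 by linarith
    then have "real m * (1 + 1 / \<epsilon>) < real (m + 1) * (1 + 1 / \<epsilon>)" by (rule mult_strict_right_mono[rotated]) simp
    then show ?thesis using \<delta>(1) by (rule mult_strict_left_mono)
  qed
  also have "\<dots> = 1"
  proof -
    have "1 + 1 / \<epsilon> \<noteq> 0" using e1 by linarith
    then have p: "real (m + 1) * (1 + 1 / \<epsilon>) \<noteq> 0" by (metis Suc_eq_plus1 mult_eq_0_iff of_nat_neq_0)
    show ?thesis unfolding \<delta>_def by (simp only: times_divide_eq_left mult_1 divide_self[OF p])
  qed
  finally show False by simp
qed

text \<open>Here \<open>adj_mat\<close> is the adjugate. Applied to the core equation, it expresses
  the determinant times \<open>f (\<rho> i 0)\<close> as a combination of residuals; these arise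
  only at the feet of the rays and are at most \<open>2 * \<zeta> ^ M\<close>.\<close>

lemma core_poly_small:
  assumes f: "ip f f = 1" "\<And>v. v < n \<Longrightarrow> adj f v = lam * f v"
    and \<zeta>: "0 < \<zeta>" "\<zeta> < 1" "lam = \<zeta> + 1 / \<zeta>" and i: "i < m"
    and C: "\<And>i j. i < m \<Longrightarrow> j < m \<Longrightarrow> \<bar>ieval (adj_mat core_mat $$ (i, j)) \<zeta>\<bar> \<le> C"
  shows "\<bar>ieval core_poly \<zeta>\<bar> * \<bar>f (\<rho> i 0)\<bar> \<le> real m * (C * (2 * \<zeta> ^ M))"
proof -
  define w where "w = (\<lambda>i. f (\<rho> i 0))"
  have carr: "core_mat \<in> carrier_mat m m" by (simp add: core_mat_def)
  define P where "P = map_mat (\<lambda>p. ieval p \<zeta>) core_mat"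
  define D where "D = map_mat (\<lambda>p. ieval p \<zeta>) (adj_mat core_mat)"
  have P: "P \<in> carrier_mat m m" and D: "D \<in> carrier_mat m m"
    using carr adj_mat(1)[OF carr] by (auto simp: P_def D_def)
  have nb: "nbr w k + (if k \<in> B then f (\<rho> k 1) else 0) = lam * w k" if k: "k < m" for k
  proof -
    have "adj f (\<rho> k 0) = nbr w k + (if k \<in> B then f (\<rho> k 1) else 0)"
      using adj_core[OF k, of f] by (simp add: w_def)
    then show ?thesis using f(2)[OF \<rho>0[OF k]] by (simp add: w_def)
  qed
  define r where "r = (\<lambda>k. \<Sum>j<m. P $$ (k, j) * w j)"
  have r: "\<bar>r k\<bar> \<le> 2 * \<zeta> ^ M" if k: "k < m" for k
  proof -
    have "r k = (1 + \<zeta>\<^sup>2) * w k - \<zeta> * nbr w k - (if k \<in> B then \<zeta>\<^sup>2 * w k else 0)"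
      unfolding r_def P_def by (rule core_mat_apply[OF k])
    also have "\<dots> = \<zeta> * (if k \<in> B then f (\<rho> k 1) - \<zeta> * w k else 0)"
      using nb[OF k] \<zeta> by (auto simp: field_simps power2_eq_square split: if_splits)
    finally have "\<bar>r k\<bar> = \<zeta> * \<bar>if k \<in> B then f (\<rho> k 1) - \<zeta> * w k else 0\<bar>" using \<zeta> by (simp add: abs_mult)
    also have "\<dots> \<le> 1 * (2 * \<zeta> ^ M)"
      using \<zeta> eigenvector_ray[OF f \<zeta>, of k] by (intro mult_mono) (auto simp: w_def)
    finally show ?thesis by simp
  qed
  interpret h: comm_ring_hom "\<lambda>p. ieval p \<zeta>" by (rule ieval_hom)
  have "D * P = ieval core_poly \<zeta> \<cdot>\<^sub>m 1\<^sub>m m"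
  proof -
    have "D * P = map_mat (\<lambda>p. ieval p \<zeta>) (adj_mat core_mat * core_mat)"
      unfolding D_def P_def by (rule h.mat_hom_mult[symmetric, OF adj_mat(1)[OF carr] carr])
    also have "\<dots> = ieval core_poly \<zeta> \<cdot>\<^sub>m 1\<^sub>m m"
      unfolding adj_mat(3)[OF carr] core_poly_def by (rule eq_matI) (auto simp: hom_distribs)
    finally show ?thesis .
  qed
  then have DP: "(\<Sum>k<m. D $$ (i, k) * P $$ (k, j)) = (if i = j then ieval core_poly \<zeta> else 0)" if "j < m" for j
  proof -
    have "(D * P) $$ (i, j) = (\<Sum>k<m. D $$ (i, k) * P $$ (k, j))"
      using i that D P by (simp add: scalar_prod_def atLeast0LessThan)
    then show ?thesis using \<open>D * P = _\<close> i that by (simp split: if_splits)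
  qed
  have "(\<Sum>k<m. D $$ (i, k) * r k) = (\<Sum>k<m. \<Sum>j<m. D $$ (i, k) * P $$ (k, j) * w j)"
    unfolding r_def by (simp add: sum_distrib_left mult.assoc)
  also have "\<dots> = (\<Sum>j<m. (\<Sum>k<m. D $$ (i, k) * P $$ (k, j)) * w j)"
    by (subst sum.swap) (simp add: sum_distrib_right)
  also have "\<dots> = (\<Sum>j<m. if i = j then ieval core_poly \<zeta> * w j else 0)"
    by (intro sum.cong refl) (simp add: DP)
  also have "\<dots> = ieval core_poly \<zeta> * w i" using i by simp
  finally have "\<bar>ieval core_poly \<zeta>\<bar> * \<bar>w i\<bar> = \<bar>\<Sum>k<m. D $$ (i, k) * r k\<bar>" by (simp add: abs_mult)
  also have "\<dots> \<le> (\<Sum>k<m. \<bar>D $$ (i, k) * r k\<bar>)" by (rule sum_abs)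
  also have "\<dots> \<le> (\<Sum>k<m. C * (2 * \<zeta> ^ M))"
  proof (intro sum_mono)
    fix k assume "k \<in> {..<m}"
    then have k: "k < m" by simp
    have "\<bar>D $$ (i, k)\<bar> \<le> C" using C[OF i k] i k adj_mat(1)[OF carr] by (simp add: D_def)
    then show "\<bar>D $$ (i, k) * r k\<bar> \<le> C * (2 * \<zeta> ^ M)"
      unfolding abs_mult using r[OF k] by (intro mult_mono) auto
  qed
  finally show ?thesis by (simp add: w_def)
qed

end

section \<open>Limits of cores with long rays\<close>

text \<open>The smaller root of \<open>z + 1 / z = x\<close>. Its reciprocal is
  \<open>salem_tau\<close> for the index \<open>x\<close> of a nonbipartite graph.\<close>

definition jroot :: "real \<Rightarrow> real" where
  "jroot x = (x - sqrt (x\<^sup>2 - 4)) / 2"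

lemma jroot:
  assumes x: "x > 2"
  shows "0 < jroot x" "jroot x < 1" "jroot x + 1 / jroot x = x"
proof -
  have x4: "x\<^sup>2 - 4 > 0" using x power_strict_mono[of 2 x 2] by simp
  define s where "s = sqrt (x\<^sup>2 - 4)"
  have s2: "s * s = x\<^sup>2 - 4" and s0: "s > 0" using x4 by (simp_all add: s_def)
  have "s\<^sup>2 = x\<^sup>2 - 4" using s2 by (simp only: power2_eq_square)
  then have "s\<^sup>2 < x\<^sup>2" by linarith
  then have sx: "s < x" using x by (intro power2_less_imp_less[of s x]) simp_all
  have prod: "(x - s) / 2 * ((x + s) / 2) = 1" using s2 by (simp add: algebra_simps power2_eq_square)
  have j: "jroot x = (x - s) / 2" by (simp add: jroot_def s_def)
  show p: "0 < jroot x" using sx j by simp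
  have inv: "1 / jroot x = (x + s) / 2" using prod p unfolding j by (simp add: field_simps)
  show "jroot x + 1 / jroot x = x" unfolding inv unfolding j by (simp add: add_divide_distrib diff_divide_distrib)
  have "(x + s) / 2 > 1" using x s0 by simp
  then have "1 / jroot x > 1" using inv by simp
  then show "jroot x < 1" using p by (simp add: field_simps)
qed

lemma joukowsky_inj:
  fixes a b :: real
  assumes "0 < a" "a < 1" "0 < b" "b < 1" "a + 1 / a = b + 1 / b"
  shows "a = b"
proof -
  have 1: "a * b * (a + 1 / a) = a * b * a + b" using assms(1) by (simp add: distrib_left)
  have 2: "a * b * (b + 1 / b) = a * b * b + a" using assms(3) by (simp add: distrib_left)
  have "a * b * a + b = a * b * b + a" using 1 2 assms(5) by simp
  moreover have "(a - b) * (1 - a * b) = (a * b * b + a) - (a * b * a + b)" by (simp add: algebra_simps)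
  ultimately have "(a - b) * (1 - a * b) = 0" by simp
  moreover have "a * b < 1 * 1" using assms by (intro mult_strict_mono) simp_all
  ultimately show ?thesis by auto
qed

lemma joukowsky_gt_2:
  fixes a :: real
  assumes "0 < a" "a < 1"
  shows "a + 1 / a > 2"
proof -
  have "(1 - a)\<^sup>2 / a > 0" using assms by simp
  moreover have "(1 - a)\<^sup>2 / a = a + 1 / a - 2" using assms by (simp add: power2_eq_square field_simps)
  ultimately show ?thesis by linarith
qed

lemma spec_small_gt:
  assumes "spec_graph n N e \<mu> k0 lam" "l < n" "\<mu> l > 2"
  shows "\<mu> l = lam"
proof -
  interpret spec_graph n N e \<mu> k0 lam by (rule assms)
  show ?thesis using small[OF assms(2)] assms(3) k0 by (cases "l = k0") auto
qed

text \<open>\<open>cold\<close> and \<open>gap\<close> bound eigenvectors from below on the core,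
  \<open>low\<close> locates the negative roots of \<open>core_poly\<close> in the disc, and
  \<open>ne\<close> excludes conjugates of modulus 1.\<close>

theorem rayed_limit_pisot:
  fixes n :: "nat \<Rightarrow> nat" and lam :: "nat \<Rightarrow> real" and \<phi> :: real
  assumes G: "\<And>k. rayed_graph (n k) (N k) (e k) (\<mu> k) (k0 k) (lam k) m A B (M k) (\<rho> k)"
    and M: "\<And>k. k \<le> M k"
    and cold: "\<And>k g. (\<And>i. i < m \<Longrightarrow> g (\<rho> k i 0) = 0) \<Longrightarrow> fgraph.qf {..<n k} (N k) g \<le> 0"
    and gap: "\<epsilon> > 0" "\<And>k. lam k \<ge> 2 + \<epsilon>"
    and lim: "lam \<longlonglongrightarrow> \<phi> + 1 / \<phi>" and ne: "\<And>k. lam k \<noteq> \<phi> + 1 / \<phi>" and \<phi>: "\<phi> > 1"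
    and low: "\<And>k l. l < n k \<Longrightarrow> \<mu> k l < -2 \<Longrightarrow> bip \<and> \<mu> k l = - lam k"
  shows "if bip then pisot (\<phi>\<^sup>2) else pisot \<phi>"
proof -
  interpret core m A B using G[of 0] by (simp add: rayed_graph_def)
  let ?L = "\<phi> + 1 / \<phi>"
  have SG: "spec_graph (n k) (N k) (e k) (\<mu> k) (k0 k) (lam k)" for k
    using G[of k] by (simp add: rayed_graph_def)
  define \<zeta> where "\<zeta> = (\<lambda>k. jroot (lam k))"
  have l2: "lam k > 2" for k using gap(2)[of k] gap(1) by linarith
  have \<zeta>: "0 < \<zeta> k" "\<zeta> k < 1" "lam k = \<zeta> k + 1 / \<zeta> k" for k
    using jroot[OF l2[of k]] by (simp_all add: \<zeta>_def)
  have i\<phi>: "0 < 1 / \<phi>" "1 / \<phi> < 1" using \<phi> by auto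
  have ii: "1 / (1 / \<phi>) = \<phi>" by simp
  have L2: "?L > 2" using joukowsky_gt_2[OF i\<phi>] unfolding ii by linarith
  have jL: "jroot ?L = 1 / \<phi>"
  proof (rule joukowsky_inj[OF jroot(1,2)[OF L2] i\<phi>])
    show "jroot ?L + 1 / jroot ?L = 1 / \<phi> + 1 / (1 / \<phi>)" unfolding ii jroot(3)[OF L2] by (rule add.commute)
  qed
  have \<zeta>lim: "\<zeta> \<longlonglongrightarrow> 1 / \<phi>"
  proof -
    have "(\<lambda>k. jroot (lam k)) \<longlonglongrightarrow> jroot ?L" unfolding jroot_def by (intro tendsto_intros lim) simp
    then show ?thesis unfolding jL \<zeta>_def .
  qed
  have root: "ieval core_poly (1 / \<phi>) = (0 :: real)"
  proof -
    have "\<exists>C. \<forall>x\<in>{0..1::real}. \<bar>ieval p x\<bar> \<le> C" for p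
    proof -
      have "compact ((\<lambda>x. ieval p x) ` {0..1::real})"
        by (intro compact_continuous_image continuous_intros) auto
      then have "bounded ((\<lambda>x. ieval p x) ` {0..1::real})" by (rule compact_imp_bounded)
      then show ?thesis by (auto simp: bounded_iff)
    qed
    then obtain C0 where C0: "\<And>p x. x \<in> {0..1::real} \<Longrightarrow> \<bar>ieval p x\<bar> \<le> C0 p" by metis
    define C where "C = (\<Sum>i<m. \<Sum>j<m. \<bar>C0 (adj_mat core_mat $$ (i, j))\<bar>)"
    have C: "\<bar>ieval (adj_mat core_mat $$ (i, j)) x\<bar> \<le> C" if "i < m" "j < m" "x \<in> {0..1::real}" for i j x
    proof -
      have "\<bar>ieval (adj_mat core_mat $$ (i, j)) x\<bar> \<le> \<bar>C0 (adj_mat core_mat $$ (i, j))\<bar>"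
        using C0[OF that(3)] abs_ge_self order_trans by blast
      also have "\<dots> \<le> (\<Sum>j<m. \<bar>C0 (adj_mat core_mat $$ (i, j))\<bar>)"
        using that by (intro member_le_sum) auto
      also have "\<dots> \<le> C" unfolding C_def using that
        by (intro member_le_sum[of i _ "\<lambda>i. \<Sum>j<m. \<bar>C0 (adj_mat core_mat $$ (i, j))\<bar>"]) (auto intro: sum_nonneg)
      finally show ?thesis .
    qed
    define c where "c = 1 / (real (m + 1) * (1 + 1 / \<epsilon>))"
    have c: "c > 0" unfolding c_def using gap(1) by (intro divide_pos_pos mult_pos_pos add_pos_pos) auto
    have bound: "\<bar>ieval core_poly (\<zeta> k)\<bar> * c \<le> real m * (C * (2 * \<zeta> k ^ M k))" for k
    proof -
      interpret g: rayed_graph "n k" "N k" "e k" "\<mu> k" "k0 k" "lam k" m A B "M k" "\<rho> k" by (rule G)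
      obtain f where f: "g.ip f f = 1" "\<And>v. v < n k \<Longrightarrow> g.adj f v = lam k * f v"
        using g.eigenvector by blast
      obtain i where i: "i < m" "c \<le> \<bar>f (\<rho> k i 0)\<bar>"
        using g.eigenvector_core_mass[OF f cold gap(1) gap(2)[of k]] unfolding c_def by blast
      have "\<bar>ieval core_poly (\<zeta> k)\<bar> * c \<le> \<bar>ieval core_poly (\<zeta> k)\<bar> * \<bar>f (\<rho> k i 0)\<bar>"
        using i by (intro mult_left_mono) auto
      also have "\<dots> \<le> real m * (C * (2 * \<zeta> k ^ M k))"
        using \<zeta>[of k] i C by (intro g.core_poly_small[OF f]) auto
      finally show ?thesis .
    qed
    \<comment> \<open>A number strictly between \<open>1 / \<phi>\<close> and 1: eventually
      \<open>\<zeta> k < q\<close>, so the bound on \<open>core_poly\<close> decays like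
      \<open>q ^ k\<close>.\<close>
    define q where "q = (1 / \<phi> + 1) / 2"
    have "a < (a + 1) / 2 \<and> 0 \<le> (a + 1) / 2 \<and> (a + 1) / 2 < 1" if "0 < a" "a < 1" for a :: real
      using that by simp
    from this[OF i\<phi>] have q: "1 / \<phi> < q" and q': "0 \<le> q" "q < 1" unfolding q_def by blast+
    have "C \<ge> 0" unfolding C_def by (intro sum_nonneg) auto
    have ev: "\<forall>\<^sub>F k in sequentially. \<bar>ieval core_poly (\<zeta> k)\<bar> * c \<le> real m * (C * (2 * q ^ k))"
      using order_tendstoD(2)[OF \<zeta>lim q]
    proof eventually_elim
      case (elim k)
      have "\<zeta> k ^ M k \<le> \<zeta> k ^ k" using \<zeta>[of k] M[of k] by (intro power_decreasing) auto
      also have "\<dots> \<le> q ^ k" using elim \<zeta>[of k] by (intro power_mono) auto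
      finally have "real m * (C * (2 * \<zeta> k ^ M k)) \<le> real m * (C * (2 * q ^ k))"
        using \<open>C \<ge> 0\<close> by (intro mult_left_mono) auto
      then show ?case using bound[of k] by linarith
    qed
    have "(\<lambda>k. real m * (C * (2 * q ^ k))) \<longlonglongrightarrow> real m * (C * (2 * 0))"
      using q' by (intro tendsto_intros LIMSEQ_power_zero) auto
    moreover have "(\<lambda>k. \<bar>ieval core_poly (\<zeta> k)\<bar> * c) \<longlonglongrightarrow> \<bar>ieval core_poly (1 / \<phi>)\<bar> * c"
      by (intro tendsto_intros \<zeta>lim)
    ultimately have "\<bar>ieval core_poly (1 / \<phi>)\<bar> * c \<le> real m * (C * (2 * 0))"
      using ev by (intro tendsto_le[of sequentially]) auto
    then have "\<bar>ieval core_poly (1 / \<phi>)\<bar> * c \<le> 0 * c" by simp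
    then have "\<bar>ieval core_poly (1 / \<phi>)\<bar> \<le> (0::real)" using c by (rule mult_right_le_imp_le)
    then show ?thesis by simp
  qed
  have disc_real: "z = 1 / \<phi> \<or> bip \<and> z = - (1 / \<phi>)" if z: "\<bar>z\<bar> < 1" "ieval core_poly z = 0" for z :: real
  proof -
    have z0: "z \<noteq> 0"
    proof
      assume "z = 0"
      then have "of_int (coeff core_poly 0) = (0::real)" using z(2) by (simp add: poly_0_coeff_0)
      then show False by (simp add: core_poly_0)
    qed
    obtain w :: "nat \<Rightarrow> real" and i0 where w: "i0 < m" "w i0 \<noteq> 0"
      "\<And>i. i < m \<Longrightarrow> (1 + z\<^sup>2) * w i - z * nbr w i - (if i \<in> B then z\<^sup>2 * w i else 0) = 0"
      using z(2) unfolding core_poly_root_iff by blast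
    define x where "x = z + 1 / z"
    have near: "\<forall>\<^sub>F k in sequentially. \<exists>l<n k. \<bar>\<mu> k l - x\<bar> < \<delta>" if \<delta>: "\<delta> > 0" for \<delta>
    proof -
      have "(\<lambda>k. 2 * (z\<^sup>2) ^ k) \<longlonglongrightarrow> 2 * 0"
        using z(1) by (intro tendsto_intros LIMSEQ_power_zero) (simp add: abs_square_less_1)
      then have "\<forall>\<^sub>F k in sequentially. 2 * (z\<^sup>2) ^ k < \<delta>\<^sup>2"
        by (rule order_tendstoD(2)) (use \<delta> in simp)
      then show ?thesis
      proof eventually_elim
        case (elim k)
        interpret g: rayed_graph "n k" "N k" "e k" "\<mu> k" "k0 k" "lam k" m A B "M k" "\<rho> k" by (rule G)
        have "z ^ (2 * M k) = (z\<^sup>2) ^ M k" by (simp add: power_mult)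
        also have "\<dots> \<le> (z\<^sup>2) ^ k" using z(1) M[of k]
          by (intro power_decreasing) (auto simp: abs_square_le_1)
        finally have sm: "2 * z ^ (2 * M k) < \<delta>\<^sup>2" using elim by linarith
        have "\<bar>z\<bar> \<le> 1" using z(1) by simp
        then show ?case unfolding x_def by (rule g.near_eigenvalue[of z i0 w \<delta>, OF z0 _ w \<delta> sm])
      qed
    qed
    show ?thesis
    proof (cases "z > 0")
      case True
      have x2: "x > 2" unfolding x_def using joukowsky_gt_2[OF True] z by simp
      have "lam \<longlonglongrightarrow> x"
      proof (rule tendstoI)
        fix r :: real assume r: "r > 0"
        have "\<forall>\<^sub>F k in sequentially. \<exists>l<n k. \<bar>\<mu> k l - x\<bar> < min r (x - 2)" using r x2 by (intro near) simp
        then show "\<forall>\<^sub>F k in sequentially. dist (lam k) x < r"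
        proof eventually_elim
          case (elim k)
          then obtain l where l: "l < n k" "\<bar>\<mu> k l - x\<bar> < r" "\<bar>\<mu> k l - x\<bar> < x - 2" by auto
          \<comment> \<open>The tolerance \<open>x - 2\<close> keeps the eigenvalue above 2, where
            \<open>lam k\<close> is the only one. So \<open>x\<close> is the limit of the
            indices.\<close>
          then have "\<mu> k l > 2" by linarith
          then have "\<mu> k l = lam k" using spec_small_gt[OF SG] l by blast
          then show ?case using l by (simp add: dist_real_def)
        qed
      qed
      then have "?L = x" using lim LIMSEQ_unique by blast
      then have "z = 1 / \<phi>" using joukowsky_inj[OF True _ i\<phi>] z by (simp add: x_def)
      then show ?thesis by simp
    next
      case False
      then have mz: "0 < - z" "- z < 1" using z z0 by auto
      have x2: "x < -2" unfolding x_def using joukowsky_gt_2[OF mz] by simp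
      have lx: "\<forall>\<^sub>F k in sequentially. bip \<and> dist (lam k) (- x) < r" if r: "r > 0" for r
      proof -
        have "\<forall>\<^sub>F k in sequentially. \<exists>l<n k. \<bar>\<mu> k l - x\<bar> < min r (- x - 2)" using r x2 by (intro near) simp
        then show ?thesis
        proof eventually_elim
          case (elim k)
          then obtain l where l: "l < n k" "\<bar>\<mu> k l - x\<bar> < r" "\<bar>\<mu> k l - x\<bar> < - x - 2" by auto
          then have "\<mu> k l < -2" by linarith
          then have "bip" "\<mu> k l = - lam k" using low l by blast+
          then show ?case using l by (simp add: dist_real_def)
        qed
      qed
      have "lam \<longlonglongrightarrow> - x" by (rule tendstoI, rule eventually_mono[OF lx]) auto
      then have "?L = - x" using lim LIMSEQ_unique by blast
      then have "- z = 1 / \<phi>" using joukowsky_inj[OF mz i\<phi>] by (simp add: x_def)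
      moreover have bip using eventually_happens'[OF sequentially_bot lx[of 1]] by auto
      ultimately show ?thesis by auto
    qed
  qed
  have disc: "z = of_real (1 / \<phi>) \<or> bip \<and> z = of_real (- (1 / \<phi>))" if z: "cmod z < 1" "ieval core_poly z = 0" for z
  proof -
    have "Im z = 0" by (rule core_root_real[OF z])
    then obtain x where x: "z = of_real x" by (metis complex_is_Real_iff Reals_cases)
    have "complex_of_real (ieval core_poly x) = 0" using z(2) unfolding x ieval_of_real .
    then have "ieval core_poly x = 0" by (simp only: of_real_eq_0_iff)
    moreover have "\<bar>x\<bar> < 1" using z(1) unfolding x norm_of_real .
    ultimately have "x = 1 / \<phi> \<or> bip \<and> x = - (1 / \<phi>)" by (intro disc_real)
    then show ?thesis unfolding x of_real_eq_iff .
  qed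
  have notrap: "ieval trap_poly ?L \<noteq> 0"
  proof
    assume t: "ieval trap_poly ?L = 0"
    obtain w :: "nat \<Rightarrow> real" and i where w: "i < m" "w i \<noteq> 0"
      "\<And>i. i < m \<Longrightarrow> nbr w i = ?L * w i" "\<And>i. i \<in> B \<Longrightarrow> w i = 0"
      by (rule trap_poly_kernel[OF t], rule that, assumption+)
    interpret g: rayed_graph "n 0" "N 0" "e 0" "\<mu> 0" "k0 0" "lam 0" m A B "M 0" "\<rho> 0" by (rule G)
    define z where "z = 1 / \<phi>"
    have zL: "z + 1 / z = ?L" unfolding z_def ii by (rule add.commute)
    have z01: "z \<noteq> 0" "\<bar>z\<bar> \<le> 1" using i\<phi> unfolding z_def by simp_all
    have "\<exists>l<n 0. \<mu> 0 l = z + 1 / z"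
      by (rule g.exact_eigenvalue[of z i w, OF z01 w(1,2) w(3)[folded zL] w(4)])
    then obtain l where l: "l < n 0" "\<mu> 0 l = ?L" unfolding zL by blast
    then have "lam 0 = ?L" using spec_small_gt[OF SG l(1)] L2 by simp
    then show False using ne by simp
  qed
  have "lead_coeff (reflect_poly core_poly) = 1"
    using core_poly_0 degree_reflect_poly_eq[of core_poly] by (simp add: coeff_reflect_poly)
  moreover have "ieval (reflect_poly core_poly) \<phi> = 0"
    using ieval_reflect_poly[of \<phi> core_poly] \<phi> root by (simp add: inverse_eq_divide)
  ultimately obtain p where p: "irreducible p" "lead_coeff p = 1" "ieval p \<phi> = 0" "p dvd reflect_poly core_poly"
    using monic_irreducible_factor by blast
  have roots: "\<alpha> = of_real \<phi> \<or> bip \<and> \<alpha> = - of_real \<phi> \<or> cmod \<alpha> < 1" if \<alpha>: "ieval p \<alpha> = 0" for \<alpha> :: complex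
  proof (rule ccontr)
    assume neg: "\<not> ?thesis"
    have "cmod \<alpha> \<noteq> 1" using no_conjugate_on_circle[OF \<phi> p(1,3,4) \<alpha>] notrap by blast
    with neg have big: "cmod \<alpha> > 1" by linarith
    then have \<alpha>0: "\<alpha> \<noteq> 0" by auto
    obtain r where "reflect_poly core_poly = p * r" using p(4) by (auto simp: dvd_def)
    then have "ieval (reflect_poly core_poly) \<alpha> = 0" using \<alpha> by (simp add: ieval_mult)
    then have "ieval core_poly (inverse \<alpha>) = 0" using ieval_reflect_poly[OF \<alpha>0] \<alpha>0 by simp
    moreover have "cmod (inverse \<alpha>) < 1" using big by (simp add: norm_inverse inverse_less_1_iff)
    ultimately have "inverse \<alpha> = of_real (1 / \<phi>) \<or> bip \<and> inverse \<alpha> = of_real (- (1 / \<phi>))" using disc by blast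
    then have "\<alpha> = inverse (of_real (1 / \<phi>)) \<or> bip \<and> \<alpha> = inverse (of_real (- (1 / \<phi>)))"
      by (metis inverse_inverse_eq)
    then have "\<alpha> = of_real \<phi> \<or> bip \<and> \<alpha> = - of_real \<phi>"
      by (auto simp: of_real_inverse[symmetric] inverse_eq_divide simp del: of_real_inverse)
    then show False using neg by blast
  qed
  show ?thesis
  proof (cases bip)
    case True
    then show ?thesis using pisot_square[OF \<phi> p(2,3)] roots by auto
  next
    case False
    then show ?thesis unfolding pisot_def using \<phi> p roots by auto
  qed
qed

section \<open>Salem graphs\<close>

definition nbs :: "nat \<Rightarrow> (nat \<Rightarrow> nat \<Rightarrow> bool) \<Rightarrow> nat \<Rightarrow> nat set" where
  "nbs n E v = {u. u < n \<and> E v u}"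

lemma fgraph_nbs: "simple_graph n E \<Longrightarrow> fgraph {..<n} (nbs n E)"
  by unfold_locales (auto simp: nbs_def simple_graph_def)

lemma graph_eigenbasis:
  assumes G: "simple_graph n E"
  obtains e :: "nat \<Rightarrow> nat \<Rightarrow> real" and \<mu> where
    "\<And>i j. i < n \<Longrightarrow> j < n \<Longrightarrow> (\<Sum>k<n. e k i * e k j) = (if i = j then 1 else 0)"
    "\<And>k l. k < n \<Longrightarrow> l < n \<Longrightarrow> (\<Sum>i<n. e k i * e l i) = (if k = l then 1 else 0)"
    "\<And>k i. k < n \<Longrightarrow> i < n \<Longrightarrow> (\<Sum>u\<in>nbs n E i. e k u) = \<mu> k * e k i"
    "graph_char_poly n E = (\<Prod>k<n. [:- \<mu> k, 1:])"
proof -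
  let ?A = "adj_matrix n E"
  have A: "?A \<in> carrier_mat n n" by (simp add: adj_matrix_def)
  have sym: "?A\<^sup>T = ?A" using G by (intro eq_matI) (auto simp: adj_matrix_def simple_graph_def)
  obtain U where U: "U \<in> carrier_mat n n" "U\<^sup>T * U = 1\<^sub>m n" "diagonal_mat (U\<^sup>T * ?A * U)"
    using real_symmetric_diagonalization[OF A sym] by blast
  define D where "D = U\<^sup>T * ?A * U"
  have Ut: "U\<^sup>T \<in> carrier_mat n n" using U by simp
  have D: "D \<in> carrier_mat n n" using Ut A U by (simp add: D_def)
  have UU: "U * U\<^sup>T = 1\<^sub>m n" using mat_mult_left_right_inverse[OF Ut U(1) U(2)] .
  have "U * D = (U * U\<^sup>T) * ?A * U" unfolding D_def using U(1) Ut A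
    by (simp add: assoc_mult_mat[of _ n n _ n _ n])
  then have UD: "U * D = ?A * U" unfolding UU using A by simp
  have "?A = U * D * U\<^sup>T"
    unfolding UD using A U(1) Ut UU by (simp add: assoc_mult_mat[of _ n n _ n _ n])
  then have "similar_mat_wit ?A D U U\<^sup>T" using A D U Ut UU
    by (intro similar_mat_witI) auto
  then have "char_poly ?A = char_poly D" by (intro char_poly_similar) (auto simp: similar_mat_def)
  also have "\<dots> = (\<Prod>a\<leftarrow>diag_mat D. [:- a, 1:])"
    using U(3) D by (intro char_poly_upper_triangular) (auto simp: diagonal_mat_def D_def[symmetric])
  also have "\<dots> = (\<Prod>k<n. [:- D $$ (k, k), 1:])"
    using D by (simp add: diag_mat_def o_def prod.list_conv_set_nth atLeast0LessThan)
  finally have cp: "graph_char_poly n E = (\<Prod>k<n. [:- D $$ (k, k), 1:])"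
    by (simp add: graph_char_poly_def)
  show thesis
  proof (rule that[of "\<lambda>k i. U $$ (i, k)" "\<lambda>k. D $$ (k, k)"])
    fix i j assume ij: "i < n" "j < n"
    have "(U * U\<^sup>T) $$ (i, j) = (\<Sum>k<n. U $$ (i, k) * U $$ (j, k))"
      using ij U by (simp add: scalar_prod_def atLeast0LessThan)
    then show "(\<Sum>k<n. U $$ (i, k) * U $$ (j, k)) = (if i = j then 1 else 0)" unfolding UU using ij by simp
    have "(U\<^sup>T * U) $$ (i, j) = (\<Sum>k<n. U $$ (k, i) * U $$ (k, j))"
      using ij U(1) by (simp add: scalar_prod_def atLeast0LessThan)
    then show "(\<Sum>k<n. U $$ (k, i) * U $$ (k, j)) = (if i = j then 1 else 0)" unfolding U(2) using ij by simp
  next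
    fix k i assume ki: "k < n" "i < n"
    have "(\<Sum>u\<in>nbs n E i. U $$ (u, k)) = (\<Sum>u<n. (if E i u then 1 else 0) * U $$ (u, k))"
      unfolding nbs_def by (intro sum.mono_neutral_cong_left) auto
    also have "\<dots> = (?A * U) $$ (i, k)"
      using ki U A by (simp add: scalar_prod_def atLeast0LessThan adj_matrix_def)
    also have "\<dots> = (U * D) $$ (i, k)" by (simp add: UD)
    also have "\<dots> = (\<Sum>j<n. U $$ (i, j) * D $$ (j, k))"
      using ki U D by (simp add: scalar_prod_def atLeast0LessThan)
    also have "\<dots> = (\<Sum>j<n. if j = k then U $$ (i, k) * D $$ (k, k) else 0)"
      using U(3) D ki by (intro sum.cong refl) (auto simp: diagonal_mat_def D_def[symmetric])
    also have "\<dots> = D $$ (k, k) * U $$ (i, k)" using ki by simp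
    finally show "(\<Sum>u\<in>nbs n E i. U $$ (u, k)) = D $$ (k, k) * U $$ (i, k)" .
  qed (rule cp)
qed

lemma salem_lambda_eq:
  assumes "unique_big_eig n E lam"
  shows "salem_lambda n E = lam"
  unfolding salem_lambda_def
proof (rule the_equality)
  show "unique_big_eig n E lam" by (rule assms)
  fix x assume "unique_big_eig n E x"
  then have "{lam} = {x}" using assms unfolding unique_big_eig_def by metis
  then show "x = lam" by simp
qed

lemma salem_spec_graph:
  assumes S: "salem_graph n E"
  obtains e \<mu> k0 where "spec_graph n (nbs n E) e \<mu> k0 (salem_lambda n E)"
    "\<And>l. l < n \<Longrightarrow> \<mu> l < -2 \<Longrightarrow> bipartite n E \<and> \<mu> l = - salem_lambda n E"
proof -
  have G: "simple_graph n E" using S by (simp add: salem_graph_def)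
  obtain lam where big: "unique_big_eig n E lam"
    and neg: "if bipartite n E then {x \<in> eigenvalues n E. x < -2} = {-lam}
         else {x \<in> eigenvalues n E. x < -2} = {}"
    using S unfolding salem_graph_def by blast
  have sl: "salem_lambda n E = lam" by (rule salem_lambda_eq[OF big])
  obtain e \<mu> where e: "\<And>i j. i < n \<Longrightarrow> j < n \<Longrightarrow> (\<Sum>k<n. e k i * e k j) = (if i = j then 1 else (0::real))"
    "\<And>k l. k < n \<Longrightarrow> l < n \<Longrightarrow> (\<Sum>i<n. e k i * e l i) = (if k = l then 1 else 0)"
    "\<And>k i. k < n \<Longrightarrow> i < n \<Longrightarrow> (\<Sum>u\<in>nbs n E i. e k u) = \<mu> k * e k i"
    and cp: "graph_char_poly n E = (\<Prod>k<n. [:- \<mu> k, 1:])"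
    using graph_eigenbasis[OF G] by blast
  have ev: "x \<in> eigenvalues n E \<longleftrightarrow> (\<exists>k<n. x = \<mu> k)" for x
    by (auto simp: eigenvalues_def cp poly_prod)
  have lam: "lam > 2" "{x \<in> eigenvalues n E. x > 2} = {lam}" "order lam (graph_char_poly n E) = 1"
    using big by (auto simp: unique_big_eig_def eig_mult_def)
  have "lam \<in> eigenvalues n E" using lam(2) by blast
  then obtain k0 where k0: "k0 < n" "\<mu> k0 = lam" using ev by metis
  have small: "\<mu> k \<le> 2" if k: "k < n" "k \<noteq> k0" for k
  proof (rule ccontr)
    assume "\<not> ?thesis"
    then have "\<mu> k \<in> {x \<in> eigenvalues n E. x > 2}" using k ev by auto
    then have mk: "\<mu> k = lam" using lam(2) by blast
    \<comment> \<open>A second index with an eigenvalue above 2 would make \<open>lam\<close> a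
      double root of the characteristic polynomial.\<close>
    have "(\<Prod>j\<in>{k, k0}. [:- \<mu> j, 1:]) dvd (\<Prod>k<n. [:- \<mu> k, 1:])"
      using k k0 by (intro prod_dvd_prod_subset) auto
    then have "[:- lam, 1:] ^ 2 dvd graph_char_poly n E"
      using k mk k0 by (simp add: cp power2_eq_square)
    moreover have "graph_char_poly n E \<noteq> 0" by (simp add: cp)
    ultimately have "2 \<le> order lam (graph_char_poly n E)" by (simp add: order_divides)
    then show False using lam(3) by simp
  qed
  interpret fgraph "{..<n}" "nbs n E" by (rule fgraph_nbs[OF G])
  have "spec_graph n (nbs n E) e \<mu> k0 lam"
    by unfold_locales (use e k0 lam(1) small in \<open>auto simp: adj_def\<close>)
  moreover have "bipartite n E \<and> \<mu> l = - lam" if "l < n" "\<mu> l < -2" for l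
  proof -
    have "\<mu> l \<in> {x \<in> eigenvalues n E. x < -2}" using ev that by auto
    then show ?thesis using neg by (auto split: if_splits)
  qed
  ultimately show thesis using that sl by blast
qed

text \<open>The solutions of \<open>y + 1 / y = x\<close> are \<open>t\<close> and
  \<open>1 / t\<close>, so a greatest one exists and is \<open>t\<close>; in the bipartite case this
  is applied to the square root.\<close>

lemma salem_tau_eq:
  assumes l: "salem_lambda n E > 2"
  shows "salem_tau n E = (if bipartite n E then (1 / jroot (salem_lambda n E))\<^sup>2 else 1 / jroot (salem_lambda n E))"
proof -
  define x where "x = salem_lambda n E"
  define t where "t = 1 / jroot x"
  have j: "0 < jroot x" "jroot x < 1" "jroot x + 1 / jroot x = x" using jroot l by (auto simp: x_def)
  have t: "t > 1" "t + 1 / t = x" using j by (auto simp: t_def)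
  have le: "y \<le> t" if y: "y \<noteq> 0" "y + 1 / y = x" for y
  proof -
    have 1: "y * t * (y + 1 / y) = y * t * y + t" using y(1) by (simp add: distrib_left)
    have 2: "y * t * (t + 1 / t) = y * t * t + y" using t(1) by (simp add: distrib_left)
    have "y * t * y + t = y * t * t + y" using 1 2 y(2) t(2) by simp
    moreover have "(y - t) * (y * t - 1) = (y * t * y + t) - (y * t * t + y)" by (simp add: algebra_simps)
    ultimately have "(y - t) * (y * t - 1) = 0" by simp
    then consider "y = t" | "y * t = 1" by auto
    then show ?thesis
    proof cases
      case 2
      then have "y = 1 / t" using t by (simp add: field_simps)
      moreover have "1 / t < 1" using t by simp
      ultimately show ?thesis using t by linarith
    qed simp
  qed
  show ?thesis
  proof (cases "bipartite n E")
    case True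
    have "(GREATEST z. z > 0 \<and> sqrt z + 1 / sqrt z = x) = t\<^sup>2"
    proof (rule Greatest_equality)
      show "t\<^sup>2 > 0 \<and> sqrt (t\<^sup>2) + 1 / sqrt (t\<^sup>2) = x" using t by simp
      fix y assume y: "y > 0 \<and> sqrt y + 1 / sqrt y = x"
      then have "sqrt y \<le> t" by (intro le) auto
      then have "(sqrt y)\<^sup>2 \<le> t\<^sup>2" using y by (intro power_mono) auto
      then show "y \<le> t\<^sup>2" using y by simp
    qed
    then show ?thesis using True by (simp add: salem_tau_def x_def t_def)
  next
    case False
    have "(GREATEST z. z \<noteq> 0 \<and> z + 1 / z = x) = t"
      by (rule Greatest_equality) (use t le in auto)
    then show ?thesis using False by (simp add: salem_tau_def x_def t_def)
  qed
qed

section \<open>Passage to a common core along a sequence\<close>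

context fgraph
begin

lemma qf_cong: "(\<And>v. v \<in> V \<Longrightarrow> f v = g v) \<Longrightarrow> qf f = qf g"
proof -
  assume e: "\<And>v. v \<in> V \<Longrightarrow> f v = g v"
  have "adj f v = adj g v" if "v \<in> V" for v
    unfolding adj_def using N_sub[OF that] e by (intro sum.cong) auto
  then show ?thesis using e unfolding qf_def ip_def by (simp cong: sum.cong)
qed

end

context spec_graph
begin

lemma hot_all: "hot {..<n}"
proof -
  obtain f where f: "ip f f = 1" "\<forall>v<n. adj f v = lam * f v" using eigenvector by blast
  have "ip f (adj f) = lam * ip f f"
    unfolding ip_def sum_distrib_left using f(2) by (intro sum.cong) auto
  then have "qf f > 0" unfolding qf_def using f(1) k0 by simp
  moreover have "qf (\<lambda>v. if v < n then f v else 0) = qf f" by (rule qf_cong) simp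
  ultimately show ?thesis unfolding hot_def
    by (intro exI[of _ "\<lambda>v. if v < n then f v else 0"]) auto
qed

text \<open>Collects what is needed about one graph without mentioning \<open>K\<close>, so that
  different graphs can be compared; \<open>X d\<close> will be the number of stem vertices at
  distance \<open>d\<close>. The bounds multiply the size of \<open>K\<close> by
  \<open>Suc \<Delta>\<close> for each step of a ball. The last clause, a positive form on the core,
  will separate the indices from 2.\<close>

lemma rays_of_bounded_degree:
  assumes D: "\<And>v. v < n \<Longrightarrow> card (N v) \<le> \<Delta>"
  shows "\<exists>X. (\<forall>d\<ge>8. X (Suc d) \<le> X d) \<and> X 8 \<le> (10 + Suc \<Delta> ^ 6) * Suc \<Delta> ^ 8 \<and>
    (\<forall>r M. 8 \<le> r \<longrightarrow> (\<forall>d. r \<le> d \<and> d < r + (3 + M) \<longrightarrow> X (Suc d) = X d) \<longrightarrow>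
      (\<exists>m A B \<rho>. m \<le> (10 + Suc \<Delta> ^ 6) * Suc \<Delta> ^ (r + 2) \<and> rayed {..<n} N m A B M \<rho> \<and>
         (\<forall>g. (\<forall>i<m. g (\<rho> i 0) = 0) \<longrightarrow> qf g \<le> 0) \<and>
         (\<exists>f. (\<forall>v. v \<notin> (\<lambda>i. \<rho> i 0) ` {..<m} \<longrightarrow> f v = 0) \<and> qf f > 0)))"
proof -
  obtain K where K: "K \<subseteq> {..<n}" "hot K" "card K \<le> 10 + Suc \<Delta> ^ 6"
    using bounded_hot[OF hot_all] D by blast
  interpret c: cold_graph "{..<n}" N K
  proof unfold_locales
    show "K \<subseteq> {..<n}" by (rule K)
    fix S assume S: "S \<subseteq> {..<n}" "S \<inter> nball K 1 = {}"
    show "\<not> hot S"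
    proof
      assume h: "hot S"
      show False
      proof (rule two_hot[OF K(2) h])
        show "K \<inter> S = {}" using S(2) by auto
        show "t \<notin> N s" if "s \<in> K" "t \<in> S" for s t using S(2) that by auto
      qed
    qed
  qed
  have cb: "card (nball K d) \<le> (10 + Suc \<Delta> ^ 6) * Suc \<Delta> ^ d" for d
  proof -
    have "card (nball K d) \<le> card K * Suc \<Delta> ^ d" using K D by (intro card_nball) auto
    also have "\<dots> \<le> (10 + Suc \<Delta> ^ 6) * Suc \<Delta> ^ d" using K(3) by (rule mult_right_mono) simp
    finally show ?thesis .
  qed
  have finb: "finite (nball K d)" for d using nball_V[OF K(1)] finite_subset by blast
  have "card (c.stem 8) \<le> card (nball K 8)"
    using sph_nball[of K 8] by (intro card_mono finb) (auto simp: c.stem_def)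
  then have X8: "card (c.stem 8) \<le> (10 + Suc \<Delta> ^ 6) * Suc \<Delta> ^ 8" using cb[of 8] by linarith
  have "\<exists>m A B \<rho>. m \<le> (10 + Suc \<Delta> ^ 6) * Suc \<Delta> ^ (r + 2) \<and> rayed {..<n} N m A B M \<rho> \<and>
         (\<forall>g. (\<forall>i<m. g (\<rho> i 0) = 0) \<longrightarrow> qf g \<le> 0) \<and>
         (\<exists>f. (\<forall>v. v \<notin> (\<lambda>i. \<rho> i 0) ` {..<m} \<longrightarrow> f v = 0) \<and> qf f > 0)"
    if r: "8 \<le> r" and w: "\<forall>d. r \<le> d \<and> d < r + (3 + M) \<longrightarrow> card (c.stem (Suc d)) = card (c.stem d)" for r M
  proof -
    let ?m = "card (nball K (r + 2))"
    have w': "card (c.stem (Suc d)) = card (c.stem d)" if "r \<le> d" "d < r + 3 + M" for d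
      using w that by (simp add: add.assoc)
    obtain A B \<rho> where R: "rayed {..<n} N ?m A B M \<rho>" "(\<lambda>i. \<rho> i 0) ` {..<?m} = nball K (r + 2)"
      using c.window_rayed[OF r w'] by blast
    have "nball K 0 \<subseteq> nball K (r + 2)" and sub1: "nball K 1 \<subseteq> nball K (r + 2)"
      by (rule nball_mono; simp)+
    then have sub0: "K \<subseteq> nball K (r + 2)" unfolding nball.simps(1) by blast
    have "qf g \<le> 0" if g: "\<forall>i<?m. g (\<rho> i 0) = 0" for g
    proof -
      let ?S = "{..<n} - nball K (r + 2)" and ?g = "\<lambda>v. if v < n then g v else 0"
      have g0: "g v = 0" if "v \<in> nball K (r + 2)" for v
      proof -
        have "v \<in> (\<lambda>i. \<rho> i 0) ` {..<?m}" using that R(2) by simp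
        then show ?thesis using g by blast
      qed
      have nh: "\<not> hot ?S" using sub1 by (intro c.cold) blast+
      have z: "?g v = 0" if "v \<notin> ?S" for v
        using that g0 by (cases "v < n") (simp_all del: nball.simps)
      have "\<not> qf ?g > 0"
      proof
        assume "qf ?g > 0"
        then have "hot ?S" unfolding hot_def using z by (intro exI[of _ ?g]) blast
        then show False using nh by contradiction
      qed
      moreover have "qf ?g = qf g" by (rule qf_cong) simp
      ultimately show ?thesis by simp
    qed
    moreover have "\<exists>f. (\<forall>v. v \<notin> (\<lambda>i. \<rho> i 0) ` {..<?m} \<longrightarrow> f v = 0) \<and> qf f > 0"
      using hot_mono[OF K(2) sub0] unfolding R(2) hot_def .
    ultimately show ?thesis using R(1) cb[of "r + 2"] by blast
  qed
  then show ?thesis using X8 c.card_stem_Suc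
    by (intro exI[of _ "\<lambda>d. card (c.stem d)"] conjI allI impI) auto
qed

end

context rayed_graph
begin

lemma core_supported:
  assumes f: "\<And>v. v \<notin> (\<lambda>i. \<rho> i 0) ` {..<m} \<Longrightarrow> f v = 0"
  shows "ip f h = (\<Sum>i<m. f (\<rho> i 0) * h (\<rho> i 0))"
    and "ip f (adj f) = (\<Sum>i<m. f (\<rho> i 0) * nbr (\<lambda>i. f (\<rho> i 0)) i)"
proof -
  have *: "ip f h = (\<Sum>i<m. f (\<rho> i 0) * h (\<rho> i 0))" for h
  proof -
    have "ip f h = (\<Sum>v\<in>(\<lambda>i. \<rho> i 0) ` {..<m}. f v * h v)" unfolding ip_def
      using \<rho>0 f by (intro sum.mono_neutral_right) auto
    then show ?thesis by (simp add: sum_core)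
  qed
  show "ip f h = (\<Sum>i<m. f (\<rho> i 0) * h (\<rho> i 0))" by (rule *)
  have f1: "f (\<rho> i 1) = 0" if "i \<in> B" for i
  proof (rule f, rule notI)
    assume "\<rho> i 1 \<in> (\<lambda>i. \<rho> i 0) ` {..<m}"
    then obtain j where "j < m" "\<rho> i 1 = \<rho> j 0" by auto
    then show False using \<rho>inj[of i 1 j 0] that Bm by (simp add: ok_def)
  qed
  show "ip f (adj f) = (\<Sum>i<m. f (\<rho> i 0) * nbr (\<lambda>i. f (\<rho> i 0)) i)"
    unfolding * by (intro sum.cong refl) (simp add: adj_core f1 del: One_nat_def)
qed

lemma core_rayleigh: "(\<Sum>i<m. w i * nbr w i) \<le> lam * (\<Sum>i<m. w i * w i)"
proof -
  \<comment> \<open>Since \<open>0 ^ 0 = 1\<close>, the choice \<open>z = 0\<close> makes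
    \<open>bump\<close> carry \<open>w\<close> to the core vertices.\<close>
  define f where "f = (\<lambda>v. if v \<in> (\<lambda>i. \<rho> i 0) ` {..<m} then bump w 0 v else 0)"
  have e: "f (\<rho> i 0) = w i" if "i < m" for i using that by (simp add: bump_at f_def)
  have s: "f v = 0" if "v \<notin> (\<lambda>i. \<rho> i 0) ` {..<m}" for v using that by (simp add: f_def)
  have n: "nbr (\<lambda>i. f (\<rho> i 0)) i = nbr w i" for i by (rule nbr_cong) (rule e)
  have "ip f (adj f) = (\<Sum>i<m. f (\<rho> i 0) * nbr (\<lambda>i. f (\<rho> i 0)) i)" by (rule core_supported(2)) (rule s)
  also have "\<dots> = (\<Sum>i<m. w i * nbr w i)" unfolding n by (intro sum.cong refl) (simp add: e)
  finally have 1: "ip f (adj f) = (\<Sum>i<m. w i * nbr w i)" .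
  have "ip f f = (\<Sum>i<m. f (\<rho> i 0) * f (\<rho> i 0))" by (rule core_supported(1)) (rule s)
  also have "\<dots> = (\<Sum>i<m. w i * w i)" by (intro sum.cong refl) (simp add: e)
  finally show ?thesis using rayleigh[of f] 1 by simp
qed

lemma core_hot_sum:
  assumes "\<And>v. v \<notin> (\<lambda>i. \<rho> i 0) ` {..<m} \<Longrightarrow> f v = 0" "qf f > 0"
  shows "(\<Sum>i<m. f (\<rho> i 0) * nbr (\<lambda>i. f (\<rho> i 0)) i) > 2 * (\<Sum>i<m. f (\<rho> i 0) * f (\<rho> i 0))"
proof -
  have "ip f f = (\<Sum>i<m. f (\<rho> i 0) * f (\<rho> i 0))" by (rule core_supported(1)) (rule assms(1))
  moreover have "ip f (adj f) = (\<Sum>i<m. f (\<rho> i 0) * nbr (\<lambda>i. f (\<rho> i 0)) i)"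
    by (rule core_supported(2)) (rule assms(1))
  ultimately show ?thesis using assms(2) unfolding qf_def by linarith
qed

end

theorem salem_limit_pisot:
  fixes n :: "nat \<Rightarrow> nat" and \<phi> :: real
  assumes S: "\<And>k. salem_graph (n k) (E k)" and bip: "\<And>k. bipartite (n k) (E k) \<longleftrightarrow> bip"
    and lim: "(\<lambda>k. salem_lambda (n k) (E k)) \<longlonglongrightarrow> \<phi> + 1 / \<phi>"
    and ne: "\<And>k. salem_lambda (n k) (E k) \<noteq> \<phi> + 1 / \<phi>" and \<phi>: "\<phi> \<ge> 1"
  shows "if bip then pisot (\<phi>\<^sup>2) else pisot \<phi>"
proof -
  define lam where "lam = (\<lambda>k. salem_lambda (n k) (E k))"
  define N where "N = (\<lambda>k. nbs (n k) (E k))"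
  have "\<exists>e \<mu> k0. spec_graph (n k) (N k) e \<mu> k0 (lam k) \<and>
      (\<forall>l<n k. \<mu> l < -2 \<longrightarrow> bip \<and> \<mu> l = - lam k)" for k
  proof -
    obtain e \<mu> k0 where "spec_graph (n k) (nbs (n k) (E k)) e \<mu> k0 (salem_lambda (n k) (E k))"
      "\<And>l. l < n k \<Longrightarrow> \<mu> l < -2 \<Longrightarrow> bipartite (n k) (E k) \<and> \<mu> l = - salem_lambda (n k) (E k)"
      by (rule salem_spec_graph[OF S[of k]], rule that, assumption+)
    then show ?thesis unfolding bip lam_def N_def by blast
  qed
  then obtain e \<mu> k0 where spec: "\<And>k. spec_graph (n k) (N k) (e k) (\<mu> k) (k0 k) (lam k)"
    and low: "\<And>k l. l < n k \<Longrightarrow> \<mu> k l < -2 \<Longrightarrow> bip \<and> \<mu> k l = - lam k" by metis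
  have "Bseq lam" using lim unfolding lam_def by (intro convergent_imp_Bseq convergentI)
  then obtain b where b: "\<And>k. \<bar>lam k\<bar> \<le> b" by (auto simp: Bseq_def)
  define \<Delta> where "\<Delta> = nat \<lceil>b\<^sup>2\<rceil>"
  have deg: "card (N k v) \<le> \<Delta>" if "v < n k" for k v
  proof -
    interpret spec_graph "n k" "N k" "e k" "\<mu> k" "k0 k" "lam k" by (rule spec)
    have "real (card (N k v)) \<le> (lam k)\<^sup>2" by (rule degree_le[OF that])
    also have "\<dots> \<le> b\<^sup>2" using b[of k] by (metis abs_ge_zero power2_abs power_mono)
    also have "\<dots> \<le> real \<Delta>" unfolding \<Delta>_def by (rule of_nat_ceiling)
    finally show ?thesis by simp
  qed
  define P where "P = (\<lambda>k r M m A B \<rho>. m \<le> (10 + Suc \<Delta> ^ 6) * Suc \<Delta> ^ (r + 2) \<and> rayed {..<n k} (N k) m A B M \<rho> \<and>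
         (\<forall>g. (\<forall>i<m. g (\<rho> i 0) = 0) \<longrightarrow> fgraph.qf {..<n k} (N k) g \<le> 0) \<and>
         (\<exists>f. (\<forall>v. v \<notin> (\<lambda>i. \<rho> i 0) ` {..<m} \<longrightarrow> f v = 0) \<and> fgraph.qf {..<n k} (N k) f > 0))"
  define W where "W = (\<lambda>k X. (\<forall>d\<ge>8. X (Suc d) \<le> X d) \<and> X 8 \<le> (10 + Suc \<Delta> ^ 6) * Suc \<Delta> ^ 8 \<and>
    (\<forall>r M. 8 \<le> r \<longrightarrow> (\<forall>d. r \<le> d \<and> d < r + (3 + M) \<longrightarrow> X (Suc d) = X d) \<longrightarrow>
      (\<exists>m A B \<rho>. P k r M m A B \<rho>)))"
  have "\<exists>X. W k X" for k
  proof -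
    interpret spec_graph "n k" "N k" "e k" "\<mu> k" "k0 k" "lam k" by (rule spec)
    show ?thesis unfolding W_def P_def by (rule rays_of_bounded_degree) (rule deg)
  qed
  then obtain X where W: "\<And>k. W k (X k)" by metis
  have X: "d \<ge> 8 \<Longrightarrow> X k (Suc d) \<le> X k d"
    "X k 8 \<le> (10 + Suc \<Delta> ^ 6) * Suc \<Delta> ^ 8"
    "8 \<le> r \<Longrightarrow> \<forall>d. r \<le> d \<and> d < r + (3 + M) \<longrightarrow> X k (Suc d) = X k d \<Longrightarrow>
      \<exists>m A B \<rho>. P k r M m A B \<rho>" for k d r M
    using W[of k] unfolding W_def by blast+
  obtain r where r: "r \<ge> 8" and win: "\<And>j. \<exists>k\<ge>j. \<forall>d. r \<le> d \<and> d < r + j \<longrightarrow> X k (Suc d) = X k d"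
    using common_window[of 8 X, OF X(1,2)] by blast
  have "\<exists>k m A B \<rho>. j \<le> k \<and> P k r (Suc j) m A B \<rho>" for j
  proof -
    \<comment> \<open>The ray length \<open>Suc j\<close> is at least 1, as
      \<open>rayed_graph\<close> demands, and grows with \<open>j\<close>; the summand 3 is the
      margin in \<open>window_rayed\<close>.\<close>
    obtain k where k: "k \<ge> 3 + Suc j" "\<forall>d. r \<le> d \<and> d < r + (3 + Suc j) \<longrightarrow> X k (Suc d) = X k d"
      using win by blast
    then have "j \<le> k" by simp
    with X(3)[OF r k(2)] show ?thesis by blast
  qed
  then obtain kk mf Af Bf \<rho>f where P: "\<And>j. j \<le> kk j" "\<And>j. P (kk j) r (Suc j) (mf j) (Af j) (Bf j) (\<rho>f j)"
    by metis
  define mm where "mm = (10 + Suc \<Delta> ^ 6) * Suc \<Delta> ^ (r + 2)"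
  \<comment> \<open>The bound \<open>mm\<close> on the number of core vertices leaves finitely many
    such triples, so one of them occurs infinitely often.\<close>
  define F where "F = (\<lambda>j. (mf j, Af j, Bf j))"
  have "F j \<in> {..mm} \<times> Pow ({..<mm} \<times> {..<mm}) \<times> Pow {..<mm}" for j
  proof -
    have m: "mf j \<le> mm" using P(2)[of j] unfolding mm_def P_def by blast
    have R: "rayed {..<n (kk j)} (N (kk j)) (mf j) (Af j) (Bf j) (Suc j) (\<rho>f j)" using P(2)[of j] unfolding P_def by blast
    have sub: "{..<mf j} \<subseteq> {..<mm}" using m by simp
    have "Af j \<subseteq> {..<mm} \<times> {..<mm}"
      by (rule order_trans[OF rayed_subset(1)[OF R] Sigma_mono[OF sub sub]])
    moreover have "Bf j \<subseteq> {..<mm}" by (rule order_trans[OF rayed_subset(2)[OF R] sub])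
    ultimately show ?thesis using m unfolding F_def by simp
  qed
  then have "finite (range F)"
    by (intro finite_subset[of "range F" "{..mm} \<times> Pow ({..<mm} \<times> {..<mm}) \<times> Pow {..<mm}"]) blast+
  then obtain j0 where inf: "infinite {j \<in> UNIV. F j = F j0}"
    using pigeonhole_infinite[of UNIV F] infinite_UNIV_nat by blast
  define J where "J = {j \<in> UNIV. F j = F j0}"
  define s where "s = enumerate J"
  have sJ: "F (s j) = F j0" for j using enumerate_in_set[OF inf[folded J_def], of j] by (simp add: s_def J_def)
  have sj: "j \<le> s j" for j using le_enumerate[OF inf[folded J_def]] by (simp add: s_def)
  define m where "m = mf j0"
  define A where "A = Af j0"
  define B where "B = Bf j0"
  define \<kappa> where "\<kappa> = (\<lambda>j. kk (s j))"
  define \<rho> where "\<rho> = (\<lambda>j. \<rho>f (s j))"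
  have \<kappa>j: "j \<le> \<kappa> j" for j using sj[of j] P(1)[of "s j"] by (simp add: \<kappa>_def)
  have Q: "P (\<kappa> j) r (Suc (s j)) m A B (\<rho> j)" for j
    using P(2)[of "s j"] sJ[of j] unfolding F_def m_def A_def B_def \<kappa>_def \<rho>_def by simp
  have core: "core m A B"
  proof
    have R: "rayed {..<n (\<kappa> 0)} (N (\<kappa> 0)) m A B (Suc (s 0)) (\<rho> 0)" using Q[of 0] unfolding P_def by blast
    show "A \<subseteq> {..<m} \<times> {..<m}" "B \<subseteq> {..<m}" by (rule rayed_subset[OF R])+
    interpret spec_graph "n (\<kappa> 0)" "N (\<kappa> 0)" "e (\<kappa> 0)" "\<mu> (\<kappa> 0)" "k0 (\<kappa> 0)" "lam (\<kappa> 0)" by (rule spec)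
    show "(j, i) \<in> A" if "(i, j) \<in> A" for i j by (rule rayed_sym[OF R that])
  qed
  have G: "rayed_graph (n (\<kappa> j)) (N (\<kappa> j)) (e (\<kappa> j)) (\<mu> (\<kappa> j)) (k0 (\<kappa> j)) (lam (\<kappa> j)) m A B (Suc (s j)) (\<rho> j)" for j
  proof (intro rayed_graph.intro spec core rayed_graph_axioms.intro)
    show "rayed {..<n (\<kappa> j)} (N (\<kappa> j)) m A B (Suc (s j)) (\<rho> j)" using Q[of j] unfolding P_def by blast
  qed simp
  obtain f where f: "\<And>v. v \<notin> (\<lambda>i. \<rho> 0 i 0) ` {..<m} \<Longrightarrow> f v = 0" "fgraph.qf {..<n (\<kappa> 0)} (N (\<kappa> 0)) f > 0"
    using Q[of 0] unfolding P_def by blast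
  interpret core m A B by (rule core)
  define w where "w = (\<lambda>i. f (\<rho> 0 i 0))"
  define S1 where "S1 = (\<Sum>i<m. w i * nbr w i)"
  define S2 where "S2 = (\<Sum>i<m. w i * w i)"
  have S12: "S1 > 2 * S2"
    unfolding S1_def S2_def w_def by (rule rayed_graph.core_hot_sum[OF G f])
  have "S2 \<ge> 0" unfolding S2_def by (intro sum_nonneg) simp
  moreover have "S2 \<noteq> 0"
  proof
    assume z: "S2 = 0"
    then have "\<forall>i\<in>{..<m}. w i * w i = 0" unfolding S2_def by (subst (asm) sum_nonneg_eq_0_iff) auto
    then have "S1 = 0" unfolding S1_def by (intro sum.neutral) auto
    then show False using S12 z by simp
  qed
  ultimately have S2: "S2 > 0" by simp
  \<comment> \<open>One graph supplies \<open>w\<close>, but the quotient involves only the core.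
    The gap therefore holds along the whole subsequence, and it rules out
    \<open>\<phi> = 1\<close>.\<close>
  define \<epsilon> where "\<epsilon> = S1 / S2 - 2"
  have \<epsilon>: "\<epsilon> > 0" using S12 S2 by (simp add: \<epsilon>_def pos_less_divide_eq)
  have gap: "lam (\<kappa> j) \<ge> 2 + \<epsilon>" for j
  proof -
    have "S1 \<le> lam (\<kappa> j) * S2" unfolding S1_def S2_def by (rule rayed_graph.core_rayleigh[OF G])
    then show ?thesis using S2 by (simp add: \<epsilon>_def pos_divide_le_eq)
  qed
  have "filterlim \<kappa> sequentially sequentially"
    by (rule filterlim_at_top_mono[OF filterlim_ident]) (simp add: \<kappa>j)
  then have lim': "(\<lambda>j. lam (\<kappa> j)) \<longlonglongrightarrow> \<phi> + 1 / \<phi>"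
    by (rule filterlim_compose[OF lim[folded lam_def]])
  have "2 + \<epsilon> \<le> \<phi> + 1 / \<phi>" by (rule LIMSEQ_le_const[OF lim']) (use gap in blast)
  then have "\<phi> \<noteq> 1" using \<epsilon> by auto
  then have \<phi>1: "\<phi> > 1" using \<phi> by simp
  show ?thesis
  proof (rule rayed_limit_pisot[of "\<lambda>j. n (\<kappa> j)" "\<lambda>j. N (\<kappa> j)" "\<lambda>j. e (\<kappa> j)" "\<lambda>j. \<mu> (\<kappa> j)" "\<lambda>j. k0 (\<kappa> j)"
        "\<lambda>j. lam (\<kappa> j)" m A B "\<lambda>j. Suc (s j)" \<rho> \<epsilon> \<phi> bip])
    show "rayed_graph (n (\<kappa> j)) (N (\<kappa> j)) (e (\<kappa> j)) (\<mu> (\<kappa> j)) (k0 (\<kappa> j)) (lam (\<kappa> j)) m A B (Suc (s j)) (\<rho> j)" for j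
      by (rule G)
    show "j \<le> Suc (s j)" for j using sj[of j] by simp
    show "fgraph.qf {..<n (\<kappa> j)} (N (\<kappa> j)) g \<le> 0" if "\<And>i. i < m \<Longrightarrow> g (\<rho> j i 0) = 0" for j g
      using Q[of j] that unfolding P_def by blast
    show "lam (\<kappa> j) \<noteq> \<phi> + 1 / \<phi>" for j using ne by (simp add: lam_def)
    show "bip \<and> \<mu> (\<kappa> j) l = - lam (\<kappa> j)" if "l < n (\<kappa> j)" "\<mu> (\<kappa> j) l < -2" for j l
      by (rule low[OF that])
  qed (rule \<epsilon> gap lim' \<phi>1)+
qed

lemma salem_lambda_gt_2: "salem_graph n E \<Longrightarrow> salem_lambda n E > 2"
  unfolding salem_graph_def using salem_lambda_eq by (metis unique_big_eig_def)

text \<open>Infinitely many graphs of an approximating sequence agree on being bipartite. On numbers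
  above 1 the map from \<open>t\<close> to \<open>t + 1 / t\<close> is injective, so elements of
  \<open>T_graph\<close> other than \<open>x\<close> have indices different from the limit index, as
  \<open>salem_limit_pisot\<close> requires.\<close>

lemma islimpt_T_graph_pisot:
  assumes x: "x islimpt T_graph"
  shows "pisot x"
proof -
  obtain f where f: "\<And>k. f k \<in> T_graph - {x}" "f \<longlonglongrightarrow> x" using x unfolding islimpt_sequential by blast
  then have "\<forall>k. \<exists>n E. f k = salem_tau n E \<and> salem_graph n E" unfolding T_graph_def by blast
  then obtain n E where nE: "\<And>k. f k = salem_tau (n k) (E k)" "\<And>k. salem_graph (n k) (E k)" by metis
  have "\<exists>bip. infinite {k. bipartite (n k) (E k) \<longleftrightarrow> bip}"
  proof (rule ccontr)
    assume "\<not> ?thesis"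
    then have "finite ({k. bipartite (n k) (E k) \<longleftrightarrow> True} \<union> {k. bipartite (n k) (E k) \<longleftrightarrow> False})" by blast
    also have "{k. bipartite (n k) (E k) \<longleftrightarrow> True} \<union> {k. bipartite (n k) (E k) \<longleftrightarrow> False} = UNIV" by blast
    finally show False using infinite_UNIV_nat by blast
  qed
  then obtain bip where inf: "infinite {k. bipartite (n k) (E k) \<longleftrightarrow> bip}" by blast
  define s where "s = enumerate {k. bipartite (n k) (E k) \<longleftrightarrow> bip}"
  have sb: "bipartite (n (s k)) (E (s k)) \<longleftrightarrow> bip" for k
    using enumerate_in_set[OF inf, of k] by (simp add: s_def)
  have "strict_mono s" unfolding s_def by (rule strict_mono_enumerate[OF inf])
  then have fs: "(\<lambda>k. f (s k)) \<longlonglongrightarrow> x" using LIMSEQ_subseq_LIMSEQ[OF f(2)] by (simp add: o_def)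
  define lam where "lam = (\<lambda>k. salem_lambda (n (s k)) (E (s k)))"
  define t where "t = (\<lambda>k. 1 / jroot (lam k))"
  have l2: "lam k > 2" for k unfolding lam_def by (rule salem_lambda_gt_2[OF nE(2)])
  have t1: "t k > 1" for k using jroot(1,2)[OF l2[of k]] by (simp add: t_def)
  have tl: "t k + 1 / t k = lam k" for k using jroot(3)[OF l2[of k]] by (simp add: t_def add.commute)
  have ft: "f (s k) = (if bip then (t k)\<^sup>2 else t k)" for k
    unfolding nE(1) salem_tau_eq[OF salem_lambda_gt_2[OF nE(2)]] sb t_def lam_def ..
  define \<phi> where "\<phi> = (if bip then sqrt x else x)"
  have t\<phi>: "t \<longlonglongrightarrow> \<phi>"
  proof (cases bip)
    case True
    have "sqrt (f (s k)) = t k" for k using ft[of k] True t1[of k] by simp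
    then have "(\<lambda>k. sqrt (f (s k))) = t" by (rule ext)
    then show ?thesis using tendsto_real_sqrt[OF fs] True by (simp add: \<phi>_def)
  next
    case False
    then show ?thesis using fs ft by (simp add: \<phi>_def)
  qed
  have \<phi>: "\<phi> \<ge> 1" by (rule LIMSEQ_le_const[OF t\<phi>]) (use t1 less_imp_le in blast)
  have x\<phi>: "x = (if bip then \<phi>\<^sup>2 else \<phi>)"
  proof (cases bip)
    case True
    then have "sqrt x \<ge> 1" using \<phi> by (simp add: \<phi>_def)
    then have "x \<ge> 0" by simp
    then show ?thesis using True by (simp add: \<phi>_def)
  qed (simp add: \<phi>_def)
  have "(\<lambda>k. t k + 1 / t k) \<longlonglongrightarrow> \<phi> + 1 / \<phi>" using \<phi> by (intro tendsto_intros t\<phi>) simp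
  then have lim: "lam \<longlonglongrightarrow> \<phi> + 1 / \<phi>" unfolding tl .
  have ne: "lam k \<noteq> \<phi> + 1 / \<phi>" for k
  proof
    assume e: "lam k = \<phi> + 1 / \<phi>"
    have "\<phi> \<noteq> 1" using e l2[of k] by auto
    then have "\<phi> > 1" using \<phi> by linarith
    have ii: "1 / (1 / a) = a" for a :: real by simp
    have "1 / t k = 1 / \<phi>"
    proof (rule joukowsky_inj)
      show "1 / t k + 1 / (1 / t k) = 1 / \<phi> + 1 / (1 / \<phi>)" unfolding ii using e tl[of k] by linarith
    qed (use t1[of k] \<open>\<phi> > 1\<close> in simp_all)
    then have "t k = \<phi>" by simp
    then have "f (s k) = x" using ft[of k] x\<phi> by simp
    then show False using f(1)[of "s k"] by simp
  qed
  have "if bip then pisot (\<phi>\<^sup>2) else pisot \<phi>"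
    by (rule salem_limit_pisot[of "\<lambda>k. n (s k)" "\<lambda>k. E (s k)"]) (use nE(2) sb lim ne \<phi> in \<open>auto simp: lam_def\<close>)
  then show ?thesis using x\<phi> by (auto split: if_splits)
qed

theorem theorem1:
  shows "(\<forall>x. x islimpt T_graph \<longrightarrow> pisot x) \<and>
         closed (T_graph \<union> {x. x islimpt T_graph})"
  using islimpt_T_graph_pisot closed_closure[of T_graph] by (simp add: closure_def)

end
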